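(* In the setting described in the context, $(R,\psi)$ is a non-abelian representation of $\mathcal{S}_\theta$.
   Context: A representation of a slim partial linear space $(P,L)$ (every line has $3$ points; $x*y$ denotes the third point of the line $xy$) is a pair $(R,\psi)$, $R$ a group, $\psi$ a map from $P$ to the involutions of $R$ with (R1) $\langle\psi(P)\rangle=R$ and (R2) $\psi$ injective on each line and $\psi(x)\psi(y)=\psi(x*y)$ for each line $\{x,y,x*y\}$. It is non-abelian if $R$ is non-abelian. Let $\Delta=Q(5,2)\otimes Q(5,2)$, the unique slim dense near hexagon on $243$ points ($Q(5,2)$: generalized quadrangle of order $(2,4)$; $W(2)$: of order $(2,2)$). Known facts: any two points lie in a unique quad (convex subspace of diameter $2$), a $(3\times3)$-grid or a $Q(5,2)$; for a $Q(5,2)$-quad $Q$ and $x\notin Q$, $\pi_Q(x)$ is the unique point of $Q$ collinear with $x$ ($\pi_Q(x)=x$ if $x\in Q$), $\mathcal{R}_Q(x)$ the third point of $x\pi_Q(x)$; there are partitions $T_1,T_2$ of the points into $Q(5,2)$-quads, each element of $T_1$ meeting each element of $T_2$ in a line. Fix distinct $Q,\overline{Q}\in T_1$, $\overline{\overline{Q}}:=\mathcal{R}_Q(\overline{Q})$, $S:=\{Q\cap Q_2:Q_2\in T_2\}$ (a spread of symmetry of the quadrangle $Q$), $R_L\in T_2$ the quad containing $L\in S$, fix $L^*\in S$, $R^*:=R_{L^*}$, and let $W^0,W^1,W^2$ be the three $W(2)$-subquadrangles of $R^*$ containing the grid $R^*\cap(Q\cup\overline{Q}\cup\overline{\overline{Q}})$.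 For $L_1,L_2\in S$, $\theta(L_1,L_2)\in\mathbb{Z}_3$ is the unique element with $\pi_{R^*}\circ\pi_{R_{L_2}}\circ\pi_{R_{L_1}}(W^i)=W^{i+\theta(L_1,L_2)}$ for all $i$. Let $M^*=R^*\cap Q_1$ with $Q_1\in T_1\setminus\{Q,\overline{Q},\overline{\overline{Q}}\}$. For $x\in L^*$, $\epsilon(x):=i$ if the point of $M^*$ collinear with $x$ lies in $W^i$; for $y\in Q\setminus L^*$, $\epsilon(y):=\epsilon(x)$ with $x$ the point of $L^*$ collinear with $y$. $\mathcal{S}_\theta$ is the geometry built from the quadrangle $Q$, its spread $S$ and $\theta$: points are (P1) points $x$ of $Q$, (P2) symbols $\bar{x}$, (P3) symbols $\bar{\bar{x}}$ ($x\in Q$), (P4) triples $(x,y,i)$ with $i\in\mathbb{Z}_3$, $x,y$ distinct, $xy\in S$. Lines: (L1) lines $\{x,y,z\}$ of $Q$; (L2) $\{\bar{x},\bar{y},\bar{z}\}$, (L3) $\{\bar{\bar{x}},\bar{\bar{y}},\bar{\bar{z}}\}$ for lines $\{x,y,z\}$ of $Q$; (L4) $\{x,\bar{x},\bar{\bar{x}}\}$; for $\{a,b,c\}\in S$, $i\in\mathbb{Z}_3$: (L5) $\{a,(a,b,i),(a,c,i)\}$, (L6) $\{\bar{a},(b,a,i),(c,a,i)\}$, (L7) $\{\bar{\bar{a}},(b,c,i),(c,b,i)\}$; (L8) $\{(a,b,i),(b,c,j),(c,a,k)\}$, $\{a,b,c\}\in S$, $\{i,j,k\}=\mathbb{Z}_3$;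 (L9) $\{(a,u,i),(b,v,j),(c,w,k)\}$ with $\{a,b,c\},\{u,v,w\}$ disjoint lines of $Q$, $a\sim u$, $b\sim v$, $c\sim w$, $au,bv,cw\in S$, $j=i+\theta(au,bv)$, $k=i+\theta(au,cw)$. Let $Y$ be the set of points of types (P1)–(P3); with the lines of types (L1)–(L4) it is isomorphic to $Q(5,2)\times\mathbb{L}_3$. Let $R=2^{1+18}_-$ with $R'=\{1,\lambda\}$, written as a central product $R=M\circ N$ with $M\cong2^{1+12}_+$, $N\cong2^{1+6}_-$ (extra-special groups; $[M,N]=1$, $M\cap N=\{1,\lambda\}$). Let $(M,\phi)$ be any non-abelian representation of the geometry $Y$. Let $\delta:Q\to I_2(N)$ (involutions of $N$) be any map such that: $\delta$ is injective; $[\delta(x),\delta(y)]=1$ iff $y$ equals or is collinear with $x$; for distinct collinear $x,y$, $\delta(x*y)=\delta(x)\delta(y)$ if $xy\in S$ and $\delta(x*y)=\delta(x)\delta(y)\lambda$ otherwise; $\delta(Q)$ generates $N$. Extend $\delta$ to points of type (P4) by $\delta(a,b,j):=\delta(u)$, where $u$ is the unique point of the line $ab\in S$ with $\epsilon(u)=j$. Define $\psi$ on the points of $\mathcal{S}_\theta$ by $\psi(q):=\phi(q)$ for $q\in Y$ and $\psi(a,b,i):=\phi(b)\phi(\bar{a})\delta(a,b,i)$ for points $(a,b,i)$ of type (P4). *)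

theory Defs
  imports
    "HOL-Algebra.Generated_Groups"
    "HOL-Library.Disjoint_Sets"
    "HOL-Library.Numeral_Type"
begin

text \<open>A point-line geometry is given by a set of points and a set of lines, each line being
  a set of points. The residues modulo 3 are the numeral type \<open>3\<close>.\<close>

section \<open>Partial linear spaces and near hexagons\<close>

definition partial_linear_space :: "'p set \<Rightarrow> 'p set set \<Rightarrow> bool" where
  "partial_linear_space P L \<longleftrightarrow>
     (\<forall>l\<in>L. l \<subseteq> P \<and> (\<exists>x\<in>l. \<exists>y\<in>l. x \<noteq> y)) \<and>
     (\<forall>l\<in>L. \<forall>m\<in>L. \<forall>x\<in>l \<inter> m. \<forall>y\<in>l \<inter> m. x \<noteq> y \<longrightarrow> l = m)"

definition slim :: "'p set set \<Rightarrow> bool" where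
  "slim L \<longleftrightarrow> (\<forall>l\<in>L. card l = 3)"

text \<open>Collinear points are distinct by convention.\<close>

definition collin :: "'p set set \<Rightarrow> 'p \<Rightarrow> 'p \<Rightarrow> bool" where
  "collin L x y \<longleftrightarrow> x \<noteq> y \<and> (\<exists>l\<in>L. x \<in> l \<and> y \<in> l)"

definition line_through :: "'p set set \<Rightarrow> 'p \<Rightarrow> 'p \<Rightarrow> 'p set" where
  "line_through L x y = (THE l. l \<in> L \<and> x \<in> l \<and> y \<in> l)"

text \<open>The third point \<open>x * y\<close> of the line through two collinear points of a slim geometry.\<close>

definition third :: "'p set set \<Rightarrow> 'p \<Rightarrow> 'p \<Rightarrow> 'p" where
  "third L x y = (THE z. z \<in> line_through L x y \<and> z \<noteq> x \<and> z \<noteq> y)"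

definition collin_rel :: "'p set set \<Rightarrow> ('p \<times> 'p) set" where
  "collin_rel L = {(x, y). collin L x y}"

definition connected_geometry :: "'p set \<Rightarrow> 'p set set \<Rightarrow> bool" where
  "connected_geometry P L \<longleftrightarrow> (\<forall>x\<in>P. \<forall>y\<in>P. (x, y) \<in> (collin_rel L)\<^sup>*)"

text \<open>Distance in the collinearity graph; meaningful only for points in the same component.\<close>

definition pdist :: "'p set set \<Rightarrow> 'p \<Rightarrow> 'p \<Rightarrow> nat" where
  "pdist L x y = (LEAST n. (x, y) \<in> collin_rel L ^^ n)"

definition has_diameter :: "'p set set \<Rightarrow> 'p set \<Rightarrow> nat \<Rightarrow> bool" where
  "has_diameter L X n \<longleftrightarrow>
     (\<forall>x\<in>X. \<forall>y\<in>X. pdist L x y \<le> n) \<and> (\<exists>x\<in>X. \<exists>y\<in>X. pdist L x y = n)"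

definition near_hexagon :: "'p set \<Rightarrow> 'p set set \<Rightarrow> bool" where
  "near_hexagon P L \<longleftrightarrow>
     partial_linear_space P L \<and> connected_geometry P L \<and> has_diameter L P 3 \<and>
     (\<forall>x\<in>P. \<forall>l\<in>L. \<exists>!y. y \<in> l \<and> (\<forall>z\<in>l. pdist L x y \<le> pdist L x z))"

text \<open>Density also asks for at least three points on each line, which slimness provides.\<close>

definition slim_dense_near_hexagon :: "'p set \<Rightarrow> 'p set set \<Rightarrow> bool" where
  "slim_dense_near_hexagon P L \<longleftrightarrow>
     near_hexagon P L \<and> slim L \<and>
     (\<forall>x\<in>P. \<forall>y\<in>P. pdist L x y = 2 \<longrightarrow>
        (\<exists>u v. u \<noteq> v \<and> collin L x u \<and> collin L u y \<and> collin L x v \<and> collin L v y))"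

section \<open>Quads and generalized quadrangles\<close>

definition subspace_of :: "'p set \<Rightarrow> 'p set set \<Rightarrow> 'p set \<Rightarrow> bool" where
  "subspace_of P L X \<longleftrightarrow>
     X \<subseteq> P \<and> (\<forall>l\<in>L. \<forall>x\<in>l \<inter> X. \<forall>y\<in>l \<inter> X. x \<noteq> y \<longrightarrow> l \<subseteq> X)"

definition lines_in :: "'p set set \<Rightarrow> 'p set \<Rightarrow> 'p set set" where
  "lines_in L X = {l \<in> L. l \<subseteq> X}"

definition convex_subspace :: "'p set \<Rightarrow> 'p set set \<Rightarrow> 'p set \<Rightarrow> bool" where
  "convex_subspace P L X \<longleftrightarrow>
     subspace_of P L X \<and>
     (\<forall>x\<in>X. \<forall>y\<in>X. \<forall>z\<in>P. pdist L x z + pdist L z y = pdist L x y \<longrightarrow> z \<in> X)"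

definition quad :: "'p set \<Rightarrow> 'p set set \<Rightarrow> 'p set \<Rightarrow> bool" where
  "quad P L X \<longleftrightarrow> convex_subspace P L X \<and> has_diameter L X 2"

definition gen_quadrangle :: "nat \<Rightarrow> nat \<Rightarrow> 'p set \<Rightarrow> 'p set set \<Rightarrow> bool" where
  "gen_quadrangle s t P L \<longleftrightarrow>
     partial_linear_space P L \<and> P \<noteq> {} \<and>
     (\<forall>l\<in>L. card l = s + 1) \<and>
     (\<forall>x\<in>P. card {l \<in> L. x \<in> l} = t + 1) \<and>
     (\<forall>x\<in>P. \<forall>l\<in>L. x \<notin> l \<longrightarrow> (\<exists>!y. y \<in> l \<and> collin L x y))"

text \<open>\<open>Q(5,2)\<close> and \<open>W(2)\<close> are the unique generalized quadrangles of
  orders \<open>(2,4)\<close> and \<open>(2,2)\<close>.\<close>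

definition Q52_quad :: "'p set \<Rightarrow> 'p set set \<Rightarrow> 'p set \<Rightarrow> bool" where
  "Q52_quad P L X \<longleftrightarrow> quad P L X \<and> gen_quadrangle 2 4 X (lines_in L X)"

definition W2_subquadrangle :: "'p set set \<Rightarrow> 'p set \<Rightarrow> 'p set \<Rightarrow> bool" where
  "W2_subquadrangle L X W \<longleftrightarrow>
     subspace_of X (lines_in L X) W \<and> gen_quadrangle 2 2 W (lines_in L W)"

text \<open>Used for a quad \<open>X\<close>, and also for a line \<open>X\<close> when \<open>x\<close> is collinear with exactly one of
  its points.\<close>

definition proj :: "'p set set \<Rightarrow> 'p set \<Rightarrow> 'p \<Rightarrow> 'p" where
  "proj L X x = (if x \<in> X then x else (THE y. y \<in> X \<and> collin L x y))"

definition reflect :: "'p set set \<Rightarrow> 'p set \<Rightarrow> 'p \<Rightarrow> 'p" where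
  "reflect L X x = (if x \<in> X then x else third L x (proj L X x))"

text \<open>The quad \<open>R\<^sub>l\<close> of the partition \<open>T\<close> that contains the line \<open>l\<close>.\<close>

definition quad_on :: "'p set set \<Rightarrow> 'p set \<Rightarrow> 'p set" where
  "quad_on T l = (THE X. X \<in> T \<and> l \<subseteq> X)"

text \<open>The function \<open>\<epsilon>\<close>, for lines \<open>l = L\<^sup>*\<close> and \<open>m = M\<^sup>*\<close> and the three subquadrangles \<open>W\<close>.\<close>

definition eps :: "'p set set \<Rightarrow> 'p set \<Rightarrow> 'p set \<Rightarrow> (3 \<Rightarrow> 'p set) \<Rightarrow> 'p \<Rightarrow> 3" where
  "eps L l m W y = (THE i. proj L m (proj L l y) \<in> W i)"

section \<open>The geometry \<open>S\<^sub>\<theta>\<close>\<close>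

datatype 'p spoint = Pt 'p | Bar 'p | BarBar 'p | Tri 'p 'p "3"

definition Y_points :: "'p set \<Rightarrow> 'p spoint set" where
  "Y_points Q = Pt ` Q \<union> Bar ` Q \<union> BarBar ` Q"

definition Y_lines :: "'p set \<Rightarrow> 'p set set \<Rightarrow> 'p spoint set set" where
  "Y_lines Q LQ =
     {Pt ` l | l. l \<in> LQ} \<union> {Bar ` l | l. l \<in> LQ} \<union> {BarBar ` l | l. l \<in> LQ} \<union>
     {{Pt x, Bar x, BarBar x} | x. x \<in> Q}"

definition S_points :: "'p set \<Rightarrow> 'p set set \<Rightarrow> 'p spoint set" where
  "S_points Q S = Y_points Q \<union> {Tri x y i | x y i. x \<noteq> y \<and> (\<exists>l\<in>S. x \<in> l \<and> y \<in> l)}"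

definition S_lines ::
  "'p set \<Rightarrow> 'p set set \<Rightarrow> 'p set set \<Rightarrow> ('p set \<Rightarrow> 'p set \<Rightarrow> 3) \<Rightarrow> 'p spoint set set" where
  "S_lines Q LQ S \<theta> =
     Y_lines Q LQ \<union>
     {{Pt a, Tri a b i, Tri a c i} | a b c i. {a, b, c} \<in> S \<and> distinct [a, b, c]} \<union>
     {{Bar a, Tri b a i, Tri c a i} | a b c i. {a, b, c} \<in> S \<and> distinct [a, b, c]} \<union>
     {{BarBar a, Tri b c i, Tri c b i} | a b c i. {a, b, c} \<in> S \<and> distinct [a, b, c]} \<union>
     {{Tri a b i, Tri b c j, Tri c a k} | a b c i j k.
        {a, b, c} \<in> S \<and> distinct [a, b, c] \<and> {i, j, k} = UNIV} \<union>
     {{Tri a u i, Tri b v j, Tri c w k} | a b c u v w i j k.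
        {a, b, c} \<in> LQ \<and> distinct [a, b, c] \<and> {u, v, w} \<in> LQ \<and> distinct [u, v, w] \<and>
        {a, b, c} \<inter> {u, v, w} = {} \<and>
        collin LQ a u \<and> collin LQ b v \<and> collin LQ c w \<and>
        line_through LQ a u \<in> S \<and> line_through LQ b v \<in> S \<and> line_through LQ c w \<in> S \<and>
        j = i + \<theta> (line_through LQ a u) (line_through LQ b v) \<and>
        k = i + \<theta> (line_through LQ a u) (line_through LQ c w)}"

section \<open>Extra-special 2-groups\<close>

definition commutator :: "('g, 'b) monoid_scheme \<Rightarrow> 'g \<Rightarrow> 'g \<Rightarrow> 'g" where
  "commutator G x y = x \<otimes>\<^bsub>G\<^esub> y \<otimes>\<^bsub>G\<^esub> inv\<^bsub>G\<^esub> x \<otimes>\<^bsub>G\<^esub> inv\<^bsub>G\<^esub> y"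

definition involutions :: "('g, 'b) monoid_scheme \<Rightarrow> 'g set" where
  "involutions G = {x \<in> carrier G. x \<noteq> \<one>\<^bsub>G\<^esub> \<and> x \<otimes>\<^bsub>G\<^esub> x = \<one>\<^bsub>G\<^esub>}"

definition group_center :: "('g, 'b) monoid_scheme \<Rightarrow> 'g set" where
  "group_center G = {z \<in> carrier G. \<forall>x\<in>carrier G. z \<otimes>\<^bsub>G\<^esub> x = x \<otimes>\<^bsub>G\<^esub> z}"

definition maximal_subgroup :: "'g set \<Rightarrow> ('g, 'b) monoid_scheme \<Rightarrow> bool" where
  "maximal_subgroup H G \<longleftrightarrow>
     subgroup H G \<and> H \<noteq> carrier G \<and>
     (\<forall>K. subgroup K G \<and> H \<subseteq> K \<longrightarrow> K = H \<or> K = carrier G)"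

definition frattini :: "('g, 'b) monoid_scheme \<Rightarrow> 'g set" where
  "frattini G = carrier G \<inter> \<Inter> {H. maximal_subgroup H G}"

definition extraspecial2 :: "('g, 'b) monoid_scheme \<Rightarrow> bool" where
  "extraspecial2 G \<longleftrightarrow>
     group G \<and> finite (carrier G) \<and> (\<exists>k. order G = 2 ^ k) \<and>
     derived G (carrier G) = group_center G \<and> frattini G = group_center G \<and>
     card (group_center G) = 2"

text \<open>The standard presentations of \<open>D\<^sub>8\<close> and \<open>Q\<^sub>8\<close> define groups of order 8, so together with
  the order they determine the group.\<close>

definition dihedral8 :: "('g, 'b) monoid_scheme \<Rightarrow> bool" where
  "dihedral8 G \<longleftrightarrow>
     group G \<and> order G = 8 \<and>
     (\<exists>r\<in>carrier G. \<exists>s\<in>carrier G. generate G {r, s} = carrier G \<and>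
        r [^]\<^bsub>G\<^esub> (4::nat) = \<one>\<^bsub>G\<^esub> \<and> s [^]\<^bsub>G\<^esub> (2::nat) = \<one>\<^bsub>G\<^esub> \<and>
        s \<otimes>\<^bsub>G\<^esub> r \<otimes>\<^bsub>G\<^esub> inv\<^bsub>G\<^esub> s = inv\<^bsub>G\<^esub> r)"

definition quaternion8 :: "('g, 'b) monoid_scheme \<Rightarrow> bool" where
  "quaternion8 G \<longleftrightarrow>
     group G \<and> order G = 8 \<and>
     (\<exists>r\<in>carrier G. \<exists>s\<in>carrier G. generate G {r, s} = carrier G \<and>
        r [^]\<^bsub>G\<^esub> (4::nat) = \<one>\<^bsub>G\<^esub> \<and> s [^]\<^bsub>G\<^esub> (2::nat) = r [^]\<^bsub>G\<^esub> (2::nat) \<and>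
        s \<otimes>\<^bsub>G\<^esub> r \<otimes>\<^bsub>G\<^esub> inv\<^bsub>G\<^esub> s = inv\<^bsub>G\<^esub> r)"

text \<open>\<open>G\<close> is the internal central product, with amalgamated center, of the
  subgroups \<open>H 0, \<dots>, H (m - 1)\<close>.\<close>

definition central_product_of :: "('g, 'b) monoid_scheme \<Rightarrow> nat \<Rightarrow> (nat \<Rightarrow> 'g set) \<Rightarrow> bool" where
  "central_product_of G m H \<longleftrightarrow>
     (\<forall>i<m. subgroup (H i) G) \<and>
     (\<forall>i<m. \<forall>j<m. i \<noteq> j \<longrightarrow>
        (\<forall>x\<in>H i. \<forall>y\<in>H j. commutator G x y = \<one>\<^bsub>G\<^esub>) \<and> H i \<inter> H j = group_center G) \<and>
     generate G (\<Union>i<m. H i) = carrier G"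

text \<open>The groups \<open>2\<^sub>+\<^bsup>1+2m\<^esup>\<close> (central product of \<open>m\<close> copies of \<open>D\<^sub>8\<close>) and \<open>2\<^sub>-\<^bsup>1+2m\<^esup>\<close>
  (\<open>m - 1\<close> copies of \<open>D\<^sub>8\<close> and one of \<open>Q\<^sub>8\<close>).\<close>

definition extraspecial_plus :: "nat \<Rightarrow> ('g, 'b) monoid_scheme \<Rightarrow> bool" where
  "extraspecial_plus m G \<longleftrightarrow>
     extraspecial2 G \<and> order G = 2 ^ (1 + 2 * m) \<and>
     (\<exists>H. central_product_of G m H \<and> (\<forall>i<m. dihedral8 (G\<lparr>carrier := H i\<rparr>)))"

definition extraspecial_minus :: "nat \<Rightarrow> ('g, 'b) monoid_scheme \<Rightarrow> bool" where
  "extraspecial_minus m G \<longleftrightarrow>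
     m \<ge> 1 \<and> extraspecial2 G \<and> order G = 2 ^ (1 + 2 * m) \<and>
     (\<exists>H. central_product_of G m H \<and> (\<forall>i<m - 1. dihedral8 (G\<lparr>carrier := H i\<rparr>)) \<and>
        quaternion8 (G\<lparr>carrier := H (m - 1)\<rparr>))"

section \<open>Representations\<close>

definition representation ::
  "'p set \<Rightarrow> 'p set set \<Rightarrow> ('g, 'b) monoid_scheme \<Rightarrow> ('p \<Rightarrow> 'g) \<Rightarrow> bool" where
  "representation P L G \<psi> \<longleftrightarrow>
     partial_linear_space P L \<and> slim L \<and>
     group G \<and> \<psi> \<in> P \<rightarrow> involutions G \<and>
     generate G (\<psi> ` P) = carrier G \<and>
     (\<forall>l\<in>L. inj_on \<psi> l \<and>
        (\<forall>x\<in>l. \<forall>y\<in>l. x \<noteq> y \<longrightarrow> \<psi> x \<otimes>\<^bsub>G\<^esub> \<psi> y = \<psi> (third L x y)))"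

definition nonabelian_representation ::
  "'p set \<Rightarrow> 'p set set \<Rightarrow> ('g, 'b) monoid_scheme \<Rightarrow> ('p \<Rightarrow> 'g) \<Rightarrow> bool" where
  "nonabelian_representation P L G \<psi> \<longleftrightarrow> representation P L G \<psi> \<and> \<not> comm_group G"

text \<open>The extension of \<open>\<delta>\<close> to triples, for \<open>e = \<epsilon>\<close>.\<close>

definition delta_ext ::
  "'p set set \<Rightarrow> ('p \<Rightarrow> 3) \<Rightarrow> ('p \<Rightarrow> 'g) \<Rightarrow> 'p \<Rightarrow> 'p \<Rightarrow> 3 \<Rightarrow> 'g" where
  "delta_ext L e \<delta> a b j = \<delta> (THE u. u \<in> line_through L a b \<and> e u = j)"

fun psi ::
  "('g, 'b) monoid_scheme \<Rightarrow> ('p spoint \<Rightarrow> 'g) \<Rightarrow> ('p \<Rightarrow> 'p \<Rightarrow> 3 \<Rightarrow> 'g) \<Rightarrow> 'p spoint \<Rightarrow> 'g"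
where
  "psi G \<phi> d (Pt x) = \<phi> (Pt x)"
| "psi G \<phi> d (Bar x) = \<phi> (Bar x)"
| "psi G \<phi> d (BarBar x) = \<phi> (BarBar x)"
| "psi G \<phi> d (Tri a b i) = \<phi> (Pt b) \<otimes>\<^bsub>G\<^esub> \<phi> (Bar a) \<otimes>\<^bsub>G\<^esub> d a b i"

end

theory Submission
  imports Defs
begin

text \<open>For points \<open>x, y\<close> on distinct spread lines \<open>l, m\<close> of \<open>Q\<close>, collinearity of \<open>x\<close> and \<open>y\<close> is
  equivalent to \<open>\<epsilon> y = \<epsilon> x + \<theta> l m\<close>: the projections between quads commute, so transporting the
  point of \<open>M\<^sup>*\<close> attached to \<open>x\<close> along \<open>l\<close>, \<open>m\<close>, \<open>L\<^sup>*\<close> yields the one attached to \<open>y\<close>. Hence on a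
  line (L9) the three values of \<open>\<delta>\<close> come from a line of \<open>Q\<close> outside the spread, and they contribute a
  factor \<open>\<lambda>\<close>. This cancels the \<open>\<lambda>\<close> coming from \<open>\<phi>\<close>, because the images of \<open>x\<close> and \<open>Bar y\<close> commute
  precisely when \<open>x\<close> and \<open>y\<close> are equal or collinear. Since \<open>\<psi>\<close> turns out to be injective on all
  points, the product relations also show that two points of a line determine the line, so that the
  geometry is a slim partial linear space.\<close>

text \<open>Three facts behind the overview need real work. (1) \<open>\<epsilon>\<close> is a
  definite description, so the three points of \<open>Mstar\<close> must be shared out among the
  \<open>W i\<close>, one to each. This holds because every line of \<open>Rstar\<close> meets every
  \<open>W i\<close>, and because two of these subquadrangles with a common point off the grid
  coincide. That \<open>Qbb\<close> lies in \<open>T1\<close> has to be proved as well, since it is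
  given only as a reflected image. (2) About \<phi> only non-abelianness is known. Grids force near
  pairs to commute. On far pairs the answer is constant: the points far from a given point form a
  connected graph, and along an edge of it the two images differ by a factor belonging to a near
  point. If all far pairs commuted, \<open>M\<close> would be abelian. (3) Injectivity of \<psi> is
  read off from commutation with the images of \<open>Y\<close>: failing to commute with them
  recovers the underlying points of \<open>Q\<close>.\<close>

lemma collin_sym: "collin L x y \<longleftrightarrow> collin L y x"
  by (auto simp: collin_def)

lemma pls_line_unique:
  assumes "partial_linear_space P L" "l \<in> L" "m \<in> L" "x \<in> l" "y \<in> l" "x \<in> m" "y \<in> m" "x \<noteq> y"
  shows "l = m"
  using assms unfolding partial_linear_space_def by blast

lemma line_through_eq:
  assumes "partial_linear_space P L" "l \<in> L" "x \<in> l" "y \<in> l" "x \<noteq> y"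
  shows "line_through L x y = l"
  unfolding line_through_def using assms pls_line_unique[OF assms(1)]
  by (intro the_equality) blast+

lemma third_eq:
  assumes "partial_linear_space P L" "{x, y, z} \<in> L" "x \<noteq> y" "z \<noteq> x" "z \<noteq> y"
  shows "third L x y = z"
proof -
  have "line_through L x y = {x, y, z}"
    using line_through_eq[OF assms(1,2)] assms(3) by simp
  then show ?thesis unfolding third_def using assms by auto
qed

lemma card_3_third:
  assumes "card l = 3" "x \<in> l" "y \<in> l" "x \<noteq> y"
  obtains z where "l = {x, y, z}" "z \<noteq> x" "z \<noteq> y"
proof -
  obtain a b c where "l = {a, b, c}" "a \<noteq> b" "b \<noteq> c" "a \<noteq> c"
    using assms(1) by (auto simp: card_3_iff)
  then have "l = {x, y, a} \<and> a \<noteq> x \<and> a \<noteq> y \<or> l = {x, y, b} \<and> b \<noteq> x \<and> b \<noteq> y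
      \<or> l = {x, y, c} \<and> c \<noteq> x \<and> c \<noteq> y"
    using assms by auto
  then show ?thesis using that by metis
qed

lemma card_3_others:
  assumes "card l = 3" "x \<in> l"
  obtains y z where "l = {x, y, z}" "y \<noteq> x" "z \<noteq> x" "y \<noteq> z"
proof -
  obtain a b c where "l = {a, b, c}" "a \<noteq> b" "b \<noteq> c" "a \<noteq> c"
    using assms(1) by (auto simp: card_3_iff)
  then have "l = {x, a, b} \<and> a \<noteq> x \<and> b \<noteq> x \<and> a \<noteq> b \<or> l = {x, b, c} \<and> b \<noteq> x \<and> c \<noteq> x \<and> b \<noteq> c
      \<or> l = {x, a, c} \<and> a \<noteq> x \<and> c \<noteq> x \<and> a \<noteq> c"
    using assms by auto
  then show ?thesis using that by metis
qed

section \<open>Slim generalized quadrangles\<close>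

locale slim_gq =
  fixes t :: nat and P :: "'p set" and L :: "'p set set"
  assumes gq: "gen_quadrangle 2 t P L"
begin

lemma pls: "partial_linear_space P L"
  using gq by (simp add: gen_quadrangle_def)

lemma card_line: "l \<in> L \<Longrightarrow> card l = 3"
  using gq by (simp add: gen_quadrangle_def)

lemma card_pencil: "x \<in> P \<Longrightarrow> card {l \<in> L. x \<in> l} = t + 1"
  using gq by (simp add: gen_quadrangle_def)

lemma finite_pencil: "x \<in> P \<Longrightarrow> finite {l \<in> L. x \<in> l}"
  using card_pencil[of x] by (intro card_ge_0_finite) simp

lemma line_subset: "l \<in> L \<Longrightarrow> l \<subseteq> P"
  using pls by (simp add: partial_linear_space_def)

lemma line_unique:
  "l \<in> L \<Longrightarrow> m \<in> L \<Longrightarrow> x \<in> l \<Longrightarrow> y \<in> l \<Longrightarrow> x \<in> m \<Longrightarrow> y \<in> m \<Longrightarrow> x \<noteq> y \<Longrightarrow> l = m"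
  using pls_line_unique[OF pls] by blast

lemma collin_points: "collin L x y \<Longrightarrow> x \<in> P \<and> y \<in> P"
  unfolding collin_def using line_subset by (meson subsetD)

lemma collin_line: "l \<in> L \<Longrightarrow> x \<in> l \<Longrightarrow> y \<in> l \<Longrightarrow> x \<noteq> y \<Longrightarrow> collin L x y"
  by (auto simp: collin_def)

lemma projection: "x \<in> P \<Longrightarrow> l \<in> L \<Longrightarrow> x \<notin> l \<Longrightarrow> \<exists>y\<in>l. collin L x y"
  using gq by (fastforce simp: gen_quadrangle_def)

lemma projection_unique:
  assumes "l \<in> L" "x \<notin> l" "y \<in> l" "z \<in> l" "collin L x y" "collin L x z"
  shows "y = z"
proof -
  have "x \<in> P" using collin_points assms by blast
  then have "\<exists>!y. y \<in> l \<and> collin L x y"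
    using gq assms(1,2) by (simp add: gen_quadrangle_def)
  then show ?thesis using assms by blast
qed

lemma no_triangle:
  assumes "collin L x y" "collin L x z" "l \<in> L" "y \<in> l" "z \<in> l" "y \<noteq> z"
  shows "x \<in> l"
  using projection_unique assms by blast

lemma obtain_third:
  assumes "collin L x y"
  obtains z where "{x, y, z} \<in> L" "z \<noteq> x" "z \<noteq> y" "collin L x z" "collin L y z"
proof -
  obtain l where l: "l \<in> L" "x \<in> l" "y \<in> l" "x \<noteq> y"
    using assms by (auto simp: collin_def)
  then obtain z where "l = {x, y, z}" "z \<noteq> x" "z \<noteq> y"
    using card_3_third card_line by metis
  with l show ?thesis using that collin_line by force
qed

text \<open>Distance two in the quadrangle. Membership in \<open>P\<close> is built in because
  \<open>collin\<close> also fails for every point outside \<open>P\<close>.\<close>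

definition far :: "'p \<Rightarrow> 'p \<Rightarrow> bool" where
  "far x y \<longleftrightarrow> x \<in> P \<and> y \<in> P \<and> x \<noteq> y \<and> \<not> collin L x y"

lemma far_sym: "far x y \<longleftrightarrow> far y x"
  by (auto simp: far_def collin_sym)

lemma far_on_line:
  assumes "l \<in> L" "x \<notin> l" "z \<in> l" "collin L x z" "y \<in> l" "y \<noteq> z"
  shows "far x y"
  using assms projection_unique line_subset collin_points unfolding far_def by blast

lemma exists_line_avoiding:
  assumes "x \<in> P" "card F \<le> t" "finite F"
  obtains l where "l \<in> L" "x \<in> l" "l \<notin> F"
proof -
  have "\<not> {l \<in> L. x \<in> l} \<subseteq> F"
  proof
    assume "{l \<in> L. x \<in> l} \<subseteq> F"
    from card_mono[OF assms(3) this] show False using card_pencil[OF assms(1)] assms(2) by simp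
  qed
  then obtain l where "l \<in> {l \<in> L. x \<in> l}" "l \<notin> F" by (meson subsetI)
  then show ?thesis using that by blast
qed

text \<open>Choose a point \<open>z\<close> collinear with both \<open>x\<close> and
  \<open>x'\<close>, then leave \<open>z\<close> along a line other than those joining it to
  \<open>x\<close> and \<open>x'\<close>. On that line \<open>z\<close> is the only neighbour of
  either point, so the remaining points are far from both. When \<open>x\<close> and
  \<open>x'\<close> are far from each other two lines must be avoided, whence
  \<open>t \<ge> 2\<close>.\<close>

lemma exists_far_both:
  assumes "x \<in> P" "x' \<in> P" "t \<ge> 2"
  obtains y where "far x y" "far x' y"
proof (cases "far x x'")
  case True
  obtain l where l: "l \<in> L" "x \<in> l"
    using exists_line_avoiding[OF assms(1), of "{}"] by auto
  have "x' \<notin> l" using True l unfolding far_def collin_def by blast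
  then obtain z where z: "z \<in> l" "collin L x' z" using projection l assms by blast
  have "x \<noteq> z" using z True by (auto simp: far_def collin_sym)
  obtain l' where l': "l' \<in> L" "x' \<in> l'" "z \<in> l'" using z by (auto simp: collin_def)
  have "z \<in> P" using z l line_subset by blast
  then obtain m where m: "m \<in> L" "z \<in> m" "m \<notin> {l, l'}"
    using exists_line_avoiding[of z "{l, l'}"] assms(3) card_insert_le_m1[of 2 "{l'}" l] by auto
  obtain y y' where y: "m = {z, y, y'}" "y \<noteq> z" using card_3_others card_line m by metis
  have x: "x \<notin> m" using line_unique[of l m x z] l m z \<open>x \<noteq> z\<close> by auto
  have x': "x' \<notin> m" using line_unique[of l' m x' z] l' m z by (auto simp: collin_def)
  have "far x y" using far_on_line[OF m(1) x m(2)] collin_line[OF l(1), of x z] l z \<open>x \<noteq> z\<close> y by auto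
  moreover have "far x' y" using far_on_line[OF m(1) x' m(2)] z y by auto
  ultimately show ?thesis using that by blast
next
  case False
  have "\<exists>l\<in>L. x \<in> l \<and> x' \<in> l"
  proof (cases "x = x'")
    case True
    then show ?thesis using exists_line_avoiding[OF assms(1), of "{}"] by auto
  next
    case False
    then show ?thesis using \<open>\<not> far x x'\<close> assms by (auto simp: far_def collin_def)
  qed
  then obtain l where l: "l \<in> L" "x \<in> l" "x' \<in> l" by blast
  obtain z where z: "z \<in> l" "z \<noteq> x" "z \<noteq> x'"
  proof -
    have "card {x, x'} \<le> 2" by (simp add: card_insert_if)
    then have "\<not> l \<subseteq> {x, x'}" using card_line[OF l(1)] card_mono[of "{x, x'}" l] by auto
    then show ?thesis using that by blast
  qed
  have "z \<in> P" using z l line_subset by blast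
  then obtain m where m: "m \<in> L" "z \<in> m" "m \<notin> {l}"
    using exists_line_avoiding[of z "{l}"] assms(3) by auto
  obtain y y' where y: "m = {z, y, y'}" "y \<noteq> z" using card_3_others card_line m by metis
  have x: "x \<notin> m" using line_unique[of l m x z] l m z by auto
  have x': "x' \<notin> m" using line_unique[of l m x' z] l m z by auto
  have "far x y" using far_on_line[OF m(1) x m(2)] collin_line[OF l(1), of x z] l z y by auto
  moreover have "far x' y" using far_on_line[OF m(1) x' m(2)] collin_line[OF l(1), of x' z] l z y by auto
  ultimately show ?thesis using that by blast
qed

text \<open>Each of the \<open>t + 1\<close> lines through \<open>x\<close> misses \<open>y\<close>,
  hence carries exactly one neighbour of \<open>y\<close>.\<close>

lemma card_common_neighbours:
  assumes "far x y"
  shows "card {z. collin L x z \<and> collin L y z} = t + 1"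
proof -
  let ?C = "{z. collin L x z \<and> collin L y z}" and ?pen = "{l \<in> L. x \<in> l}"
  have x: "x \<in> P" and y: "y \<in> P" using assms by (auto simp: far_def)
  have ynot: "y \<notin> l" if "l \<in> ?pen" for l
    using assms that by (auto simp: far_def collin_def)
  have "\<exists>z. z \<in> l \<and> collin L y z" if "l \<in> ?pen" for l
    using projection[OF y _ ynot[OF that]] that by blast
  then obtain g where g: "\<And>l. l \<in> ?pen \<Longrightarrow> g l \<in> l \<and> collin L y (g l)" by metis
  have gx: "collin L x (g l)" if "l \<in> ?pen" for l
  proof -
    have "g l \<noteq> x" using g[OF that] assms by (auto simp: far_def collin_sym)
    then show ?thesis using g[OF that] that collin_line by blast
  qed
  have "bij_betw g ?pen ?C"
  proof (rule bij_betw_imageI)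
    show "inj_on g ?pen"
    proof (rule inj_onI)
      fix l m assume lm: "l \<in> ?pen" "m \<in> ?pen" "g l = g m"
      then show "l = m" using line_unique[of l m x "g l"] g[of l] g[of m] gx[of l]
        by (auto simp: collin_def)
    qed
    show "g ` ?pen = ?C"
    proof (intro equalityI subsetI)
      fix z assume "z \<in> g ` ?pen" then show "z \<in> ?C" using g gx by blast
    next
      fix z assume z: "z \<in> ?C"
      then obtain l where l: "l \<in> ?pen" "z \<in> l" by (auto simp: collin_def)
      then have "g l = z" using projection_unique[of l y "g l" z] ynot[OF l(1)] g[OF l(1)] z by auto
      then show "z \<in> g ` ?pen" using l by blast
    qed
  qed
  then show ?thesis using card_pencil[OF x] bij_betw_same_card by metis
qed

text \<open>If every common neighbour of \<open>y\<close> and \<open>y'\<close> were a neighbour of \<open>x\<close>, then the common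
  neighbours of \<open>y, y'\<close> would be exactly those of \<open>x, y'\<close>; this cannot happen both for \<open>y\<close> and
  for another point \<open>w\<close> on a line through \<open>y\<close>.\<close>

lemma far_connected:
  assumes step: "\<And>a b. far x a \<Longrightarrow> far x b \<Longrightarrow> collin L a b \<Longrightarrow> h a = h b"
    and y: "far x y" "far x y'" and t: "t \<ge> 1"
  shows "h y = h y'"
proof -
  let ?C = "\<lambda>a b. {z. collin L a z \<and> collin L b z}"
  have fin: "finite (?C a b)" "card (?C a b) = t + 1" if "far a b" for a b
    using card_common_neighbours[OF that] by (auto intro: card_ge_0_finite)
  \<comment> \<open>A common neighbour of \<open>a\<close> and \<open>y'\<close> that is far from
    \<open>x\<close> gives a path of two admissible edges from \<open>a\<close> to
    \<open>y'\<close>. If there is none, one neighbour set contains the other, and both have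
    \<open>t + 1\<close> elements.\<close>
  have main: "h a = h y' \<or> ?C a y' = ?C x y'" if a: "far x a" "far a y'" for a
  proof (cases "?C a y' \<subseteq> ?C x y'")
    case True
    then show ?thesis using card_subset_eq[OF fin(1)[OF y(2)]] fin(2) a y by metis
  next
    case False
    then obtain z where z: "collin L a z" "collin L y' z" "\<not> collin L x z" by blast
    have "x \<noteq> z" using z a by (auto simp: far_def collin_sym)
    then have "far x z" using z a collin_points by (auto simp: far_def)
    then show ?thesis using step[OF a(1) _ z(1)] step[OF y(2) _ z(2)] by auto
  qed
  show ?thesis
  proof (cases "far y y'")
    case False
    then show ?thesis using step y by (auto simp: far_def)
  next
    case True
    show ?thesis
    proof (rule ccontr)
      assume ne: "h y \<noteq> h y'"
      then have C: "?C y y' = ?C x y'" using main y True by blast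
      have "card (?C y y') \<noteq> 0" using fin[OF True] by simp
      then have "?C y y' \<noteq> {}" by (metis card.empty)
      then obtain z where z: "collin L y z" "collin L y' z" by blast
      have xz: "collin L x z" using C z by blast
      obtain w where w: "{y, z, w} \<in> L" "w \<noteq> y" "w \<noteq> z" "collin L y w"
        using obtain_third[OF z(1)] by metis
      have xn: "x \<notin> {y, z, w}" using y(1) collin_line[OF w(1), of x y] unfolding far_def by auto
      have yn: "y' \<notin> {y, z, w}" using True collin_line[OF w(1), of y y'] unfolding far_def by auto
      have xw: "far x w" using far_on_line[OF w(1) xn _ xz] w by auto
      have yw: "far w y'" using far_on_line[OF w(1) yn _ z(2)] w by (auto simp: far_sym)
      have hw: "h y = h w" using step[OF y(1) xw w(4)] .
      then have Cw: "?C w y' = ?C x y'" using main[OF xw yw] ne by auto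
      \<comment> \<open>The neighbour \<open>v\<close> of \<open>y'\<close> on a second line through
        \<open>y\<close> belongs to \<open>?C y y'\<close>, which equals \<open>?C x y'\<close> and
        \<open>?C w y'\<close>. So \<open>v\<close> is collinear with both \<open>y\<close> and
        \<open>w\<close>, a triangle.\<close>
      have "y \<in> P" using y by (auto simp: far_def)
      then obtain m where m: "m \<in> L" "y \<in> m" "m \<notin> {{y, z, w}}"
        using exists_line_avoiding[of y "{{y, z, w}}"] t by auto
      have "y' \<notin> m" using True m by (auto simp: far_def collin_def)
      moreover have "y' \<in> P" using True by (auto simp: far_def)
      ultimately obtain v where v: "v \<in> m" "collin L y' v" using projection m by blast
      have "v \<noteq> y" using v True by (auto simp: far_def collin_sym)
      then have yv: "collin L y v" using collin_line m v by blast
      then have "collin L w v" using C Cw v by blast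
      then have "v \<in> {y, z, w}"
        using no_triangle[OF _ _ w(1), of v y w] yv w(2) by (auto simp: collin_sym)
      then show False using line_unique[OF m(1) w(1) m(2) v(1)] m \<open>v \<noteq> y\<close> by auto
    qed
  qed
qed

text \<open>If \<open>x\<close> and \<open>y\<close> are collinear, any other point on a second line
  through \<open>x\<close> is near \<open>x\<close> and far from \<open>y\<close>. This is what
  later recovers a point of \<open>Q\<close> from commutation data.\<close>

lemma far_separates:
  assumes x: "x \<in> P" "y \<in> P" "x \<noteq> y" and t: "t \<ge> 1"
  shows "\<exists>z\<in>P. far x z \<noteq> far y z"
proof (cases "far x y")
  case True
  then have "far y x" "\<not> far x x" by (auto simp: far_sym) (simp add: far_def)
  then show ?thesis using x by blast
next
  case False
  then obtain l where l: "l \<in> L" "x \<in> l" "y \<in> l" using x by (auto simp: far_def collin_def)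
  obtain m where m: "m \<in> L" "x \<in> m" "m \<notin> {l}"
    by (rule exists_line_avoiding[OF x(1), of "{l}"]) (use t in auto)
  obtain z z' where z: "m = {x, z, z'}" "z \<noteq> x" using card_3_others[OF card_line[OF m(1)] m(2)] by metis
  have "y \<notin> m" using line_unique[OF l(1) m(1), of x y] l m x by auto
  then have "far y z" using far_on_line[OF m(1) _ m(2)] collin_line[OF l(1,3,2)] x z by auto
  moreover have "\<not> far x z" using collin_line[OF m(1,2), of z] z by (auto simp: far_def)
  moreover have "z \<in> P" using line_subset[OF m(1)] z by auto
  ultimately show ?thesis by blast
qed

text \<open>The nine points are those of a \<open>3 \<times> 3\<close> grid with \<open>x\<close> and \<open>y\<close> in opposite positions.\<close>

lemma grid:
  assumes xy: "far x y" and t: "t \<ge> 1"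
  obtains u v p q r s n where "{u, x, p} \<in> L" "{y, v, q} \<in> L" "{u, y, r} \<in> L" "{x, v, s} \<in> L"
    "{p, q, n} \<in> L" "{r, s, n} \<in> L" "distinct [u, x, p]" "distinct [y, v, q]" "distinct [u, y, r]"
    "distinct [x, v, s]" "distinct [p, q, n]" "distinct [r, s, n]"
proof -
  let ?C = "{z. collin L x z \<and> collin L y z}"
  have "card ?C = t + 1" using card_common_neighbours[OF xy] .
  then have fin: "finite ?C" and ge: "card ?C \<ge> 2" using t by (auto intro: card_ge_0_finite)
  have "?C \<noteq> {}" using ge by (metis card.empty not_numeral_le_zero)
  then obtain u where u: "u \<in> ?C" by blast
  have "\<not> ?C \<subseteq> {u}" using card_mono[of "{u}" ?C] ge by (metis card.empty card.insert empty_iff finite.intros not_less_eq_eq numeral_2_eq_2)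
  then obtain v where v: "v \<in> ?C" "u \<noteq> v" by blast
  have uv: "\<not> collin L u v"
  proof
    assume a: "collin L u v"
    then obtain l where l: "l \<in> L" "u \<in> l" "v \<in> l" by (auto simp: collin_def)
    have "x \<in> l" using no_triangle[of x u v l] u v l by auto
    moreover have "y \<in> l" using no_triangle[of y u v l] u v l by auto
    ultimately show False using xy collin_line[OF l(1)] by (auto simp: far_def)
  qed
  have c: "collin L u x" "collin L y v" "collin L u y" "collin L x v" "\<not> collin L x y" "x \<noteq> y"
    using u v xy by (auto simp: collin_sym far_def)
  obtain p where p: "{u, x, p} \<in> L" "p \<noteq> u" "p \<noteq> x" "collin L u p" "collin L x p"
    using obtain_third[OF c(1)] .
  obtain q where q: "{y, v, q} \<in> L" "q \<noteq> y" "q \<noteq> v" "collin L y q" "collin L v q"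
    using obtain_third[OF c(2)] .
  obtain r where r: "{u, y, r} \<in> L" "r \<noteq> u" "r \<noteq> y" "collin L u r" "collin L y r"
    using obtain_third[OF c(3)] .
  obtain s where s: "{x, v, s} \<in> L" "s \<noteq> x" "s \<noteq> v" "collin L x s" "collin L v s"
    using obtain_third[OF c(4)] .
  have ny: "y \<notin> {u, x, p}" using collin_line[OF p(1), of x y] c by auto
  have nx: "x \<notin> {y, v, q}" using collin_line[OF q(1), of x y] c by auto
  have nv: "v \<notin> {u, x, p}" using collin_line[OF p(1), of u v] uv v(2) by auto
  have nu: "u \<notin> {y, v, q}" using collin_line[OF q(1), of u v] uv v(2) by auto
  have nx': "x \<notin> {u, y, r}" using collin_line[OF r(1), of x y] c by auto
  have nv': "v \<notin> {u, y, r}" using collin_line[OF r(1), of u v] uv v(2) by auto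
  have ny': "y \<notin> {x, v, s}" using collin_line[OF s(1), of x y] c by auto
  have nu': "u \<notin> {x, v, s}" using collin_line[OF s(1), of u v] uv v(2) by auto
  have py: "\<not> collin L y p" "y \<noteq> p"
    using projection_unique[OF p(1) ny, of u p] c p ny by (auto simp: collin_sym)
  have pv: "\<not> collin L v p" "v \<noteq> p"
    using projection_unique[OF p(1) nv, of x p] c p nv by (auto simp: collin_sym)
  have qx: "\<not> collin L x q" "x \<noteq> q"
    using projection_unique[OF q(1) nx, of v q] c q nx by (auto simp: collin_sym)
  have qu: "\<not> collin L u q" "u \<noteq> q"
    using projection_unique[OF q(1) nu, of y q] c q nu by (auto simp: collin_sym)
  have rx: "\<not> collin L x r" "x \<noteq> r"
    using projection_unique[OF r(1) nx', of u r] c r nx' by (auto simp: collin_sym)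
  have rv: "\<not> collin L v r" "v \<noteq> r"
    using projection_unique[OF r(1) nv', of y r] c r nv' by (auto simp: collin_sym)
  have sy: "\<not> collin L y s" "y \<noteq> s"
    using projection_unique[OF s(1) ny', of v s] c s ny' by (auto simp: collin_sym)
  have su: "\<not> collin L u s" "u \<noteq> s"
    using projection_unique[OF s(1) nu', of x s] c s nu' by (auto simp: collin_sym)
  have P: "p \<in> P" "r \<in> P" "s \<in> P" using p r s line_subset by auto
  have pn: "p \<notin> {y, v, q}" using collin_line[OF q(1), of y p] py pv by auto
  have pq: "collin L p q"
    using projection[OF P(1) q(1) pn] py pv by (auto simp: collin_sym)
  have rn: "r \<notin> {x, v, s}" using collin_line[OF s(1), of x r] rx rv by auto
  have rs: "collin L r s"
    using projection[OF P(2) s(1) rn] rx rv by (auto simp: collin_sym)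
  obtain n where n: "{p, q, n} \<in> L" "n \<noteq> p" "n \<noteq> q" "collin L p n" "collin L q n"
    using obtain_third[OF pq] .
  have pr: "\<not> collin L p r \<and> p \<noteq> r"
  proof -
    have "p \<notin> {u, y, r}" using collin_line[OF r(1), of p y] py p by (auto simp: collin_sym)
    then show ?thesis using projection_unique[OF r(1), of p u r] p r by (auto simp: collin_sym)
  qed
  have qr: "\<not> collin L q r \<and> q \<noteq> r"
  proof -
    have "q \<notin> {u, y, r}" using collin_line[OF r(1), of q u] qu q by (auto simp: collin_sym)
    then show ?thesis using projection_unique[OF r(1), of q y r] q r by (auto simp: collin_sym)
  qed
  have ps: "\<not> collin L p s \<and> p \<noteq> s"
  proof -
    have "p \<notin> {x, v, s}" using collin_line[OF s(1), of p v] pv p by (auto simp: collin_sym)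
    then show ?thesis using projection_unique[OF s(1), of p x s] p s by (auto simp: collin_sym)
  qed
  have qs: "\<not> collin L q s \<and> q \<noteq> s"
  proof -
    have "q \<notin> {x, v, s}" using collin_line[OF s(1), of q x] qx q by (auto simp: collin_sym)
    then show ?thesis using projection_unique[OF s(1), of q v s] q s by (auto simp: collin_sym)
  qed
  \<comment> \<open>The ninth point: neither \<open>p\<close> nor \<open>q\<close> is near
    \<open>r\<close> or \<open>s\<close>, so the neighbours of \<open>r\<close> and of
    \<open>s\<close> on the line \<open>{p, q, n}\<close> can only be \<open>n\<close>. Hence
    \<open>n\<close> is on the line through \<open>r\<close> and \<open>s\<close>.\<close>
  have "r \<notin> {p, q, n}" using collin_line[OF n(1), of p r] pr qr by auto
  then have rn: "collin L n r" using projection[OF P(2) n(1)] pr qr by (auto simp: collin_sym)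
  have "s \<notin> {p, q, n}" using collin_line[OF n(1), of p s] ps qs by auto
  then have sn: "collin L n s" using projection[OF P(3) n(1)] ps qs by (auto simp: collin_sym)
  obtain k where k: "{r, s, k} \<in> L" "k \<noteq> r" "k \<noteq> s" using obtain_third[OF rs] by metis
  have "n \<in> {r, s, k}" using no_triangle[OF rn sn k(1)] rs by (auto simp: collin_def)
  then have "{r, s, n} \<in> L" "n \<noteq> r" "n \<noteq> s" using k rn sn by (auto simp: collin_def)
  then show ?thesis
    using that[OF p(1) q(1) r(1) s(1) n(1)] p q r s n c rs pq by (auto simp: collin_def)
qed

end

section \<open>Subquadrangles of order (2,2) in a quadrangle of order (2,4)\<close>

locale gq_with_sub = slim_gq 4 P L for P :: "'p set" and L +
  fixes W :: "'p set"
  assumes sub: "subspace_of P L W" and gqW: "gen_quadrangle 2 2 W (lines_in L W)"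
begin

sublocale W: slim_gq 2 W "lines_in L W"
  by unfold_locales (rule gqW)

lemma line_in_W: "l \<in> L \<Longrightarrow> x \<in> l \<Longrightarrow> y \<in> l \<Longrightarrow> x \<noteq> y \<Longrightarrow> x \<in> W \<Longrightarrow> y \<in> W \<Longrightarrow> l \<subseteq> W"
  using sub unfolding subspace_of_def by (metis IntI)

lemma W_subset: "W \<subseteq> P" using sub by (simp add: subspace_of_def)

text \<open>The neighbours in \<open>W\<close> of a point outside \<open>W\<close> form an ovoid of \<open>W\<close>, so there are five of
  them, one on each line through that point.\<close>

lemma line_meets_W:
  assumes m: "m \<in> L"
  shows "m \<inter> W \<noteq> {}"
proof
  assume dis: "m \<inter> W = {}"
  obtain x where x: "x \<in> m" using card_line[OF m] by fastforce
  have xP: "x \<in> P" using x m line_subset by blast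
  have xW: "x \<notin> W" using x dis by blast
  have on: "\<exists>o'\<in>l. o' \<in> W \<and> collin L x o'" if "l \<in> L" "l \<subseteq> W" for l
    using projection[OF xP that(1)] that xW by blast
  have indep: False if ind: "a \<in> W" "b \<in> W" "collin L x a" "collin L x b" "collin L a b" for a b
  proof -
    obtain l where l: "l \<in> L" "a \<in> l" "b \<in> l" "a \<noteq> b" using ind by (auto simp: collin_def)
    then have "x \<in> l" using no_triangle ind by blast
    then show False using line_in_W[OF l] ind xW by blast
  qed
  obtain w where "w \<in> W" using gqW by (auto simp: gen_quadrangle_def)
  then obtain l0 where "l0 \<in> L" "l0 \<subseteq> W"
    using W.exists_line_avoiding[of w "{}"] by (auto simp: lines_in_def)
  then obtain c where c: "c \<in> W" "collin L x c" using on by blast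
  obtain k where k: "k \<in> L" "k \<subseteq> W" "c \<in> k"
    using W.exists_line_avoiding[of c "{}"] c by (auto simp: lines_in_def)
  obtain a b where ab: "k = {c, a, b}" "a \<noteq> c" "b \<noteq> c" "a \<noteq> b"
    using card_3_others[OF card_line[OF k(1)] k(3)] .
  \<comment> \<open>A point of \<open>k\<close> other than \<open>c\<close> is on two further lines
    of \<open>W\<close>, each carrying a neighbour of \<open>x\<close>. Together with
    \<open>c\<close>, the points \<open>a\<close> and \<open>b\<close> therefore supply 1 + 2 + 2 =
    5 neighbours.\<close>
  have two: "\<exists>d e. d \<in> W \<and> e \<in> W \<and> collin L x d \<and> collin L x e \<and> collin L g d \<and> collin L g e \<and>
      d \<noteq> e \<and> d \<notin> k \<and> e \<notin> k" if g: "g \<in> k" "g \<noteq> c" for g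
  proof -
    have gW: "g \<in> W" using g k by blast
    have xg: "\<not> collin L x g" using indep[of g c] gW c collin_line[OF k(1) g(1) k(3) g(2)] by blast
    obtain l1 where l1: "l1 \<in> L" "l1 \<subseteq> W" "g \<in> l1" "l1 \<noteq> k"
      using W.exists_line_avoiding[OF gW, of "{k}"] by (auto simp: lines_in_def)
    have c2: "card {k, l1} \<le> 2" by (simp add: card_insert_if)
    obtain l2 where l2': "l2 \<in> lines_in L W" "g \<in> l2" "l2 \<notin> {k, l1}"
      by (rule W.exists_line_avoiding[OF gW c2]) simp
    then have l2: "l2 \<in> L" "l2 \<subseteq> W" "g \<in> l2" "l2 \<noteq> k" "l2 \<noteq> l1" by (auto simp: lines_in_def)
    obtain d where d: "d \<in> l1" "collin L x d" using on l1 by blast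
    obtain e where e: "e \<in> l2" "collin L x e" using on l2 by blast
    have ne: "d \<noteq> g" "e \<noteq> g" using xg d e by auto
    have "d \<noteq> e" using line_unique[of l1 l2 g d] l1 l2 d e ne by blast
    moreover have "d \<notin> k" using line_unique[of l1 k g d] l1 k d ne g by blast
    moreover have "e \<notin> k" using line_unique[of l2 k g e] l2 k e ne g by blast
    moreover have "collin L g d" "collin L g e" using collin_line l1 l2 d e ne by metis+
    ultimately show ?thesis using d e l1 l2 by blast
  qed
  obtain d e where de: "d \<in> W" "e \<in> W" "collin L x d" "collin L x e" "collin L a d" "collin L a e"
    "d \<noteq> e" "d \<notin> k" "e \<notin> k" using two[of a] ab by blast
  obtain f g where fg: "f \<in> W" "g \<in> W" "collin L x f" "collin L x g" "collin L b f" "collin L b g"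
    "f \<noteq> g" "f \<notin> k" "g \<notin> k" using two[of b] ab by blast
  have nab: "\<not> (collin L a z \<and> collin L b z)" if "z \<notin> k" for z
    using no_triangle[of z a b k] k that ab by (auto simp: collin_sym)
  define Z where "Z = {c, d, e, f, g}"
  have "c \<noteq> d" "c \<noteq> e" "c \<noteq> f" "c \<noteq> g" using k(3) de fg by auto
  moreover have "d \<noteq> f" "d \<noteq> g" "e \<noteq> f" "e \<noteq> g" using nab de fg by blast+
  ultimately have Z: "card Z = 5" "finite Z"
    using de(7) fg(7) unfolding Z_def by auto
  have ZW: "z \<in> W \<and> collin L x z" if "z \<in> Z" for z using that c de fg unfolding Z_def by auto
  then have "\<forall>z\<in>Z. \<exists>l. l \<in> L \<and> x \<in> l \<and> z \<in> l" unfolding collin_def by blast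
  then obtain h where h: "\<And>z. z \<in> Z \<Longrightarrow> h z \<in> L \<and> x \<in> h z \<and> z \<in> h z" by metis
  have inj: "inj_on h Z"
  proof (rule inj_onI, rule ccontr)
    fix y z assume yz: "y \<in> Z" "z \<in> Z" "h y = h z" "y \<noteq> z"
    then have "collin L y z" using collin_line h by metis
    then show False using indep ZW yz by blast
  qed
  \<comment> \<open>Pairwise non-collinear neighbours of \<open>x\<close> lie on different lines
    through \<open>x\<close>. Five of them exhaust the pencil of \<open>x\<close>, so one of them
    lies on \<open>m\<close>.\<close>
  have sub: "h ` Z \<subseteq> {l \<in> L. x \<in> l}" using h by blast
  have "card (h ` Z) = card {l \<in> L. x \<in> l}" using card_image[OF inj] Z card_pencil[OF xP] by simp
  then have "h ` Z = {l \<in> L. x \<in> l}" using card_subset_eq[OF finite_pencil[OF xP] sub] by blast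
  then obtain z where "z \<in> Z" "m = h z" using m x by blast
  then show False using h ZW dis by blast
qed

text \<open>Says that two subquadrangles sharing a grid and one more point coincide. The reason is
  that a point of \<open>W\<close> off \<open>G\<close> has a neighbour on each of
  \<open>l1\<close>, \<open>l2\<close>, \<open>l3\<close>, and the joining lines are all three lines
  of \<open>W\<close> through it. If the point is also in \<open>V\<close>, these lines have two
  points in \<open>V\<close> and so lie in \<open>V\<close>. Membership in \<open>V\<close> thus
  spreads through \<open>W\<close> outside \<open>G\<close>, which is shown to be connected.\<close>

lemma subspace_inter:
  assumes V: "gq_with_sub P L V" and G: "subspace_of P L G" "G \<subseteq> W" "G \<subseteq> V"
    and l: "l1 \<in> L" "l2 \<in> L" "l3 \<in> L" "l1 \<subseteq> G" "l2 \<subseteq> G" "l3 \<subseteq> G"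
      "l1 \<inter> l2 = {}" "l1 \<inter> l3 = {}" "l2 \<inter> l3 = {}"
    and p: "p \<in> W" "p \<in> V" "p \<notin> G"
  shows "W \<subseteq> V"
proof -
  interpret V: gq_with_sub P L V by fact
  have G_line: "m \<subseteq> G" if "m \<in> L" "a \<in> m" "b \<in> m" "a \<noteq> b" "a \<in> G" "b \<in> G" for m a b
    using G(1) that unfolding subspace_of_def by (metis IntI)
  have nbr: "\<exists>g m. g \<in> k \<and> m \<in> L \<and> x \<in> m \<and> g \<in> m \<and> x \<noteq> g"
    if x: "x \<in> W" "x \<notin> G" and k: "k \<in> L" "k \<subseteq> G" for x k
  proof -
    have "x \<in> P" using x W_subset by blast
    moreover have "x \<notin> k" using x k by blast
    ultimately obtain g where "g \<in> k" "collin L x g" using projection k by blast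
    then show ?thesis unfolding collin_def by blast
  qed
  have step: "r \<in> V" if x: "x \<in> W" "x \<in> V" "x \<notin> G" and r: "r \<in> W" "collin L x r" for x r
  proof -
    obtain g1 m1 where g1: "g1 \<in> l1" "m1 \<in> L" "x \<in> m1" "g1 \<in> m1" "x \<noteq> g1"
      using nbr[of x l1] x l by blast
    obtain g2 m2 where g2: "g2 \<in> l2" "m2 \<in> L" "x \<in> m2" "g2 \<in> m2" "x \<noteq> g2"
      using nbr[of x l2] x l by blast
    obtain g3 m3 where g3: "g3 \<in> l3" "m3 \<in> L" "x \<in> m3" "g3 \<in> m3" "x \<noteq> g3"
      using nbr[of x l3] x l by blast
    have gG: "g1 \<in> G" "g2 \<in> G" "g3 \<in> G" "g1 \<noteq> g2" "g1 \<noteq> g3" "g2 \<noteq> g3"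
      using g1 g2 g3 l by auto
    have ne: "m1 \<noteq> m2" "m1 \<noteq> m3" "m2 \<noteq> m3"
      using G_line g1 g2 g3 gG x by blast+
    have mV: "m1 \<subseteq> V" "m2 \<subseteq> V" "m3 \<subseteq> V"
      using V.line_in_W[OF g1(2-5)] V.line_in_W[OF g2(2-5)] V.line_in_W[OF g3(2-5)] x gG G by blast+
    have mW: "m1 \<subseteq> W" "m2 \<subseteq> W" "m3 \<subseteq> W"
      using line_in_W[OF g1(2-5)] line_in_W[OF g2(2-5)] line_in_W[OF g3(2-5)] x gG G by blast+
    let ?pen = "{k \<in> lines_in L W. x \<in> k}"
    have sub: "{m1, m2, m3} \<subseteq> ?pen" using mW g1 g2 g3 by (auto simp: lines_in_def)
    have "card {m1, m2, m3} = card ?pen" using ne W.card_pencil[OF x(1)] by simp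
    then have pen: "?pen = {m1, m2, m3}" using card_subset_eq[OF W.finite_pencil[OF x(1)] sub] by simp
    obtain m where m: "m \<in> L" "x \<in> m" "r \<in> m" "x \<noteq> r" using r by (auto simp: collin_def)
    then have "m \<in> ?pen" using line_in_W[OF m x(1) r(1)] by (simp add: lines_in_def)
    then have "m = m1 \<or> m = m2 \<or> m = m3" unfolding pen by simp
    then show ?thesis using mV m(3) by (metis subsetD)
  qed
  show ?thesis
  proof
    fix q assume q: "q \<in> W"
    show "q \<in> V"
    proof (cases "q \<in> G \<or> q = p \<or> collin L p q")
      case True
      then show ?thesis using step[OF p q] G p by blast
    next
      case False
      then have qG: "q \<notin> G" and qp: "q \<noteq> p" "\<not> collin L p q" by auto
      have qP: "q \<in> P" using q W_subset by blast
      \<comment> \<open>The line from \<open>p\<close> to a point \<open>g\<close> of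
        \<open>G\<close> has a third point \<open>p'\<close> off \<open>G\<close>. Since
        \<open>q\<close> is not collinear with \<open>p\<close>, its neighbour on this line is
        \<open>g\<close> or \<open>p'\<close>. In the second case \<open>p'\<close> is a stepping
        stone from \<open>p\<close> to \<open>q\<close>.\<close>
      have split: "\<exists>g p'. g \<in> k \<and> {p, g, p'} \<in> L \<and> p \<noteq> g \<and> p' \<in> W \<and> p' \<in> V \<and> p' \<notin> G \<and>
          collin L p g \<and> (collin L q g \<or> collin L q p')" if k: "k \<in> L" "k \<subseteq> G" for k
      proof -
        obtain g m where g: "g \<in> k" "m \<in> L" "p \<in> m" "g \<in> m" "p \<noteq> g"
          using nbr[OF p(1,3) k] by blast
        obtain p' where p': "m = {p, g, p'}" "p' \<noteq> p" "p' \<noteq> g"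
          using card_3_third[OF card_line[OF g(2)] g(3-5)] .
        have gG: "g \<in> G" using g k by blast
        have "p' \<notin> G" using G_line[OF g(2), of g p'] p' gG p g by auto
        moreover have "m \<subseteq> W" using line_in_W[OF g(2-5)] p G gG by blast
        moreover have "m \<subseteq> V" using V.line_in_W[OF g(2-5)] p G gG by blast
        moreover have "q \<notin> m" using collin_line[OF g(2,3), of q] qp by blast
        then have "\<exists>z\<in>m. collin L q z" using projection[OF qP g(2)] by blast
        then have "collin L q g \<or> collin L q p'" using p' qp by (auto simp: collin_sym)
        ultimately show ?thesis using g p' collin_line[OF g(2-5)] by blast
      qed
      obtain g1 p1 where g1: "g1 \<in> l1" "{p, g1, p1} \<in> L" "p \<noteq> g1" "p1 \<in> W" "p1 \<in> V" "p1 \<notin> G"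
        "collin L p g1" "collin L q g1 \<or> collin L q p1" using split[of l1] l by blast
      obtain g2 p2 where g2: "g2 \<in> l2" "{p, g2, p2} \<in> L" "p \<noteq> g2" "p2 \<in> W" "p2 \<in> V" "p2 \<notin> G"
        "collin L p g2" "collin L q g2 \<or> collin L q p2" using split[of l2] l by blast
      have gG: "g1 \<in> G" "g2 \<in> G" "g1 \<noteq> g2" using g1 g2 l by auto
      show ?thesis
      proof (cases "collin L q p1 \<or> collin L q p2")
        case True
        then show ?thesis
          using step[OF g1(4-6) q] step[OF g2(4-6) q] by (auto simp: collin_sym)
      next
        case False
        then have qg: "collin L q g1" "collin L q g2" using g1 g2 by auto
        \<comment> \<open>When both neighbours lie in \<open>G\<close>, the path is lengthened: the
          third point \<open>q'\<close> on the line through \<open>q\<close> and \<open>g1\<close>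
          is near neither \<open>p\<close> nor \<open>g2\<close>, hence near \<open>p2\<close>. This
          gives the path \<open>p\<close>, \<open>p2\<close>, \<open>q'\<close>, \<open>q\<close>
          outside \<open>G\<close>.\<close>
        obtain q' where q': "{q, g1, q'} \<in> L" "q' \<noteq> q" "q' \<noteq> g1" "collin L q q'" "collin L g1 q'"
          using obtain_third[OF qg(1)] .
        have qW: "q' \<in> W" using line_in_W[OF q'(1), of q g1] q gG G qg by (auto simp: collin_def)
        have q'G: "q' \<notin> G" using G_line[OF q'(1), of g1 q'] q' gG qG by auto
        have "\<not> collin L q' p"
        proof
          assume "collin L q' p"
          then have "p \<in> {q, g1, q'}"
            using no_triangle[of p g1 q', OF _ _ q'(1)] g1 q' by (auto simp: collin_sym)
          then show False using collin_line[OF q'(1), of p q] qp by auto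
        qed
        moreover have "\<not> collin L q' g2"
        proof
          assume "collin L q' g2"
          then have "g2 \<in> {q, g1, q'}"
            using no_triangle[of g2 q q', OF _ _ q'(1)] qg q' by (auto simp: collin_sym)
          then show False using G_line[OF q'(1), of g1 g2] gG qG by auto
        qed
        moreover have "q' \<notin> {p, g2, p2}"
          using q' qp False q'G gG by (auto simp: collin_sym)
        then have "\<exists>z\<in>{p, g2, p2}. collin L q' z" using projection[OF _ g2(2)] qW W_subset by blast
        ultimately have "collin L p2 q'" by (auto simp: collin_sym)
        then have "q' \<in> V" using step[OF g2(4-6) qW] by blast
        then show ?thesis using step[OF qW _ q'G q] q' by (auto simp: collin_sym)
      qed
    qed
  qed
qed

end

section \<open>Two transversal partitions of a near hexagon into quads\<close>

locale slim_near_hexagon =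
  fixes P :: "'p set" and L :: "'p set set"
  assumes nh: "near_hexagon P L" and slim: "slim L"
begin

lemma pls: "partial_linear_space P L"
  using nh by (simp add: near_hexagon_def)

lemma card_line: "l \<in> L \<Longrightarrow> card l = 3"
  using slim by (simp add: slim_def)

lemma line_subset: "l \<in> L \<Longrightarrow> l \<subseteq> P"
  using pls by (simp add: partial_linear_space_def)

lemma line_unique:
  "l \<in> L \<Longrightarrow> m \<in> L \<Longrightarrow> x \<in> l \<Longrightarrow> y \<in> l \<Longrightarrow> x \<in> m \<Longrightarrow> y \<in> m \<Longrightarrow> x \<noteq> y \<Longrightarrow> l = m"
  using pls_line_unique[OF pls] .

lemma collin_points: "collin L x y \<Longrightarrow> x \<in> P \<and> y \<in> P"
  unfolding collin_def using line_subset by (meson subsetD)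

lemma collin_line: "l \<in> L \<Longrightarrow> x \<in> l \<Longrightarrow> y \<in> l \<Longrightarrow> x \<noteq> y \<Longrightarrow> collin L x y"
  by (auto simp: collin_def)

lemma pdist_le: "(x, y) \<in> collin_rel L ^^ n \<Longrightarrow> pdist L x y \<le> n"
  unfolding pdist_def by (rule Least_le)

lemma pdist_path:
  assumes "x \<in> P" "y \<in> P"
  shows "(x, y) \<in> collin_rel L ^^ pdist L x y"
proof -
  have "(x, y) \<in> (collin_rel L)\<^sup>*"
    using nh assms by (simp add: near_hexagon_def connected_geometry_def)
  then obtain n where "(x, y) \<in> collin_rel L ^^ n" by (auto simp: rtrancl_power)
  then show ?thesis unfolding pdist_def by (rule LeastI)
qed

lemma pdist_eq_0: "x \<in> P \<Longrightarrow> y \<in> P \<Longrightarrow> pdist L x y = 0 \<longleftrightarrow> x = y"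
  using pdist_path[of x y] pdist_le[of x y 0] by auto

lemma pdist_eq_1:
  assumes "x \<in> P" "y \<in> P"
  shows "pdist L x y = 1 \<longleftrightarrow> collin L x y"
proof
  assume "pdist L x y = 1"
  then show "collin L x y" using pdist_path[OF assms] by (auto simp: collin_rel_def)
next
  assume c: "collin L x y"
  then have "pdist L x y \<le> 1" using pdist_le[of x y 1] by (simp add: collin_rel_def)
  moreover have "pdist L x y \<noteq> 0" using c pdist_eq_0[OF assms] by (auto simp: collin_def)
  ultimately show "pdist L x y = 1" by simp
qed

lemma pdist_eq_2:
  assumes "collin L x z" "collin L z y" "x \<noteq> y" "\<not> collin L x y"
  shows "pdist L x y = 2"
proof -
  have "(x, y) \<in> collin_rel L ^^ 2"
    using assms by (auto simp: collin_rel_def numeral_2_eq_2)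
  then have "pdist L x y \<le> 2" by (rule pdist_le)
  moreover have "x \<in> P" "y \<in> P" using collin_points assms by blast+
  then have "pdist L x y \<noteq> 0" "pdist L x y \<noteq> 1" using pdist_eq_0 pdist_eq_1 assms by auto
  ultimately show ?thesis by simp
qed

lemma nearest:
  assumes "x \<in> P" "l \<in> L"
  obtains y where "y \<in> l" "\<And>z. z \<in> l \<Longrightarrow> z \<noteq> y \<Longrightarrow> pdist L x y < pdist L x z"
proof -
  have "\<exists>!y. y \<in> l \<and> (\<forall>z\<in>l. pdist L x y \<le> pdist L x z)"
    using nh assms by (simp add: near_hexagon_def)
  then obtain y where y: "y \<in> l" "\<forall>z\<in>l. pdist L x y \<le> pdist L x z"
    and un: "\<And>y'. y' \<in> l \<and> (\<forall>z\<in>l. pdist L x y' \<le> pdist L x z) \<Longrightarrow> y' = y" by blast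
  have "pdist L x y < pdist L x z" if "z \<in> l" "z \<noteq> y" for z
  proof (rule ccontr)
    assume "\<not> pdist L x y < pdist L x z"
    then have "\<forall>v\<in>l. pdist L x z \<le> pdist L x v" using y(2) by fastforce
    then show False using un that by blast
  qed
  then show ?thesis using that y by blast
qed

text \<open>Two points of \<open>l\<close> at distance 1 from \<open>x\<close> cannot both be the
  unique nearest one, so the nearest point is at distance 0.\<close>

lemma no_triangle:
  assumes c: "collin L x y" "collin L x z" and l: "l \<in> L" "y \<in> l" "z \<in> l" "y \<noteq> z"
  shows "x \<in> l"
proof -
  have P: "x \<in> P" "y \<in> P" "z \<in> P" using collin_points c by blast+
  have d: "pdist L x y = 1" "pdist L x z = 1" using pdist_eq_1 P c by auto
  obtain w where w: "w \<in> l" "\<And>z. z \<in> l \<Longrightarrow> z \<noteq> w \<Longrightarrow> pdist L x w < pdist L x z"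
    using nearest[OF P(1) l(1)] by blast
  have "pdist L x w < 1" using w(2)[of y] w(2)[of z] l d by metis
  then have "x = w" using pdist_eq_0 P w(1) line_subset[OF l(1)] by blast
  then show ?thesis using w by simp
qed

lemma triangle_line:
  assumes "collin L x y" "collin L x z" "collin L y z"
  shows "{x, y, z} \<in> L" "third L x y = z" "line_through L x y = {x, y, z}"
proof -
  obtain l where l: "l \<in> L" "y \<in> l" "z \<in> l" "y \<noteq> z" using assms by (auto simp: collin_def)
  have "x \<in> l" using no_triangle[OF assms(1,2) l] .
  obtain w where "l = {y, z, w}" "w \<noteq> y" "w \<noteq> z" using card_3_third[OF card_line[OF l(1)] l(2-4)] .
  then have "l = {x, y, z}" using \<open>x \<in> l\<close> assms by (auto simp: collin_def)
  then show 1: "{x, y, z} \<in> L" using l by simp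
  show "third L x y = z" using third_eq[OF pls 1] assms by (auto simp: collin_def)
  show "line_through L x y = {x, y, z}" using line_through_eq[OF pls 1] assms by (auto simp: collin_def)
qed

lemma obtain_third:
  assumes "collin L x y"
  obtains z where "{x, y, z} \<in> L" "z \<noteq> x" "z \<noteq> y" "collin L x z" "collin L y z"
    "third L x y = z" "line_through L x y = {x, y, z}"
proof -
  obtain l where l: "l \<in> L" "x \<in> l" "y \<in> l" "x \<noteq> y"
    using assms by (auto simp: collin_def)
  obtain z where z: "l = {x, y, z}" "z \<noteq> x" "z \<noteq> y"
    using card_3_third[OF card_line[OF l(1)] l(2-4)] .
  have "collin L x z" "collin L y z" using collin_line[OF l(1)] z by auto
  then show ?thesis using that[of z] triangle_line[OF assms, of z] z l by auto
qed

text \<open>If \<open>y\<close> and \<open>z\<close> are collinear, their line contains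
  \<open>x\<close> and lies in the subspace \<open>X\<close>. If not, \<open>x\<close> is on a
  geodesic from \<open>y\<close> to \<open>z\<close> and convexity puts it in
  \<open>X\<close>.\<close>

lemma quad_nearest_unique:
  assumes X: "quad P L X" and x: "x \<notin> X" "y \<in> X" "z \<in> X" "collin L x y" "collin L x z"
  shows "y = z"
proof (rule ccontr)
  assume ne: "y \<noteq> z"
  have sub: "subspace_of P L X" using X by (simp add: quad_def convex_subspace_def)
  have P: "x \<in> P" "y \<in> P" "z \<in> P" using collin_points x by blast+
  show False
  proof (cases "collin L y z")
    case True
    then have "{x, y, z} \<in> L" using triangle_line x by blast
    from sub[unfolded subspace_of_def, THEN conjunct2, rule_format, OF this, of y z]
    show False using x ne by simp
  next
    case False
    have "pdist L y z = 2" using pdist_eq_2[of y x z] x ne False by (simp add: collin_sym)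
    moreover have "pdist L y x = 1" "pdist L x z = 1" using pdist_eq_1 P x by (auto simp: collin_sym)
    ultimately have "pdist L y x + pdist L x z = pdist L y z" by simp
    then show False using X P x unfolding quad_def convex_subspace_def by blast
  qed
qed

end

locale quad_partitions = slim_near_hexagon +
  fixes T1 T2 :: "'a set set"
  assumes T1: "partition_on P T1" "\<forall>X\<in>T1. Q52_quad P L X"
    and T2: "partition_on P T2" "\<forall>X\<in>T2. Q52_quad P L X"
    and T1_T2: "\<forall>X\<in>T1. \<forall>X'\<in>T2. X \<inter> X' \<in> L"
begin

text \<open>The hypotheses are symmetric in \<open>T1\<close> and \<open>T2\<close>, so every fact
  about one partition is transferred to the other by reinterpreting the locale.\<close>

lemma swap: "quad_partitions P L T2 T1"
proof -
  have "\<forall>X\<in>T2. \<forall>X'\<in>T1. X \<inter> X' \<in> L" using T1_T2 by (metis Int_commute)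
  then show ?thesis using T1 T2 by unfold_locales
qed

lemma T1_quad: "A \<in> T1 \<Longrightarrow> quad P L A" using T1 by (simp add: Q52_quad_def)

lemma T1_gq: "A \<in> T1 \<Longrightarrow> gen_quadrangle 2 4 A (lines_in L A)" using T1 by (simp add: Q52_quad_def)

lemma T1_subset: "A \<in> T1 \<Longrightarrow> A \<subseteq> P" using T1(1) by (auto simp: partition_on_def)

lemma T1_subspace:
  "A \<in> T1 \<Longrightarrow> l \<in> L \<Longrightarrow> x \<in> l \<Longrightarrow> y \<in> l \<Longrightarrow> x \<noteq> y \<Longrightarrow> x \<in> A \<Longrightarrow> y \<in> A \<Longrightarrow> l \<subseteq> A"
  using T1_quad unfolding quad_def convex_subspace_def subspace_of_def by (metis IntI)

lemma T1_unique: "A \<in> T1 \<Longrightarrow> B \<in> T1 \<Longrightarrow> x \<in> A \<Longrightarrow> x \<in> B \<Longrightarrow> A = B"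
  using T1(1) unfolding partition_on_def disjoint_def by blast

lemma T1_cover: "x \<in> P \<Longrightarrow> \<exists>A\<in>T1. x \<in> A"
  using T1(1) by (auto simp: partition_on_def)

lemma T2_gq: "A \<in> T2 \<Longrightarrow> gen_quadrangle 2 4 A (lines_in L A)"
  and T2_unique: "A \<in> T2 \<Longrightarrow> B \<in> T2 \<Longrightarrow> x \<in> A \<Longrightarrow> x \<in> B \<Longrightarrow> A = B"
  and T2_cover: "x \<in> P \<Longrightarrow> \<exists>A\<in>T2. x \<in> A"
proof -
  interpret S: quad_partitions P L T2 T1 by (rule swap)
  show "A \<in> T2 \<Longrightarrow> gen_quadrangle 2 4 A (lines_in L A)" by (rule S.T1_gq)
  show "A \<in> T2 \<Longrightarrow> B \<in> T2 \<Longrightarrow> x \<in> A \<Longrightarrow> x \<in> B \<Longrightarrow> A = B" by (rule S.T1_unique)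
  show "x \<in> P \<Longrightarrow> \<exists>A\<in>T2. x \<in> A" by (rule S.T1_cover)
qed

text \<open>The projection is found inside the quad \<open>X\<close> of the other partition:
  \<open>A \<inter> X\<close> is a line of the quadrangle \<open>X\<close>, and \<open>x\<close> has
  a neighbour on it. This also shows that projecting to \<open>A\<close> never leaves
  \<open>X\<close>.\<close>

lemma T1_proj:
  assumes A: "A \<in> T1" and X: "X \<in> T2" "x \<in> X"
  shows "proj L A x \<in> A \<inter> X" "x \<notin> A \<Longrightarrow> collin L x (proj L A x)"
proof -
  have "proj L A x \<in> A \<inter> X \<and> collin L x (proj L A x)" if x: "x \<notin> A"
  proof -
    interpret X: slim_gq 4 X "lines_in L X" using T2_gq[OF X(1)] by unfold_locales
    have "A \<inter> X \<in> lines_in L X" using T1_T2 A X by (auto simp: lines_in_def)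
    then obtain y where y: "y \<in> A \<inter> X" "collin (lines_in L X) x y"
      using X.projection[OF X(2)] x by blast
    then have c: "collin L x y" by (auto simp: collin_def lines_in_def)
    have "proj L A x = y"
      unfolding proj_def using x y c quad_nearest_unique[OF T1_quad[OF A] x]
      by (auto intro!: the_equality)
    then show ?thesis using y c by simp
  qed
  then show "proj L A x \<in> A \<inter> X" "x \<notin> A \<Longrightarrow> collin L x (proj L A x)"
    using X by (cases "x \<in> A"; simp add: proj_def)+
qed

lemma T1_proj_eq:
  assumes "A \<in> T1" "x \<notin> A" "y \<in> A" "collin L x y"
  shows "proj L A x = y"
proof -
  obtain X where "X \<in> T2" "x \<in> X" using T2_cover collin_points assms(4) by blast
  then show ?thesis using quad_nearest_unique[OF T1_quad[OF assms(1)]] T1_proj assms by blast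
qed

lemma T2_proj:
  assumes A: "A \<in> T2" and X: "X \<in> T1" "x \<in> X"
  shows "proj L A x \<in> A \<inter> X" "x \<notin> A \<Longrightarrow> collin L x (proj L A x)"
proof -
  interpret S: quad_partitions P L T2 T1 by (rule swap)
  show "proj L A x \<in> A \<inter> X" "x \<notin> A \<Longrightarrow> collin L x (proj L A x)" using S.T1_proj[OF assms] .
qed

lemma T2_proj_eq:
  assumes "A \<in> T2" "x \<notin> A" "y \<in> A" "collin L x y"
  shows "proj L A x = y"
proof -
  interpret S: quad_partitions P L T2 T1 by (rule swap)
  show ?thesis using S.T1_proj_eq[OF assms] .
qed

lemma proj_inside: "x \<in> A \<Longrightarrow> proj L A x = x" by (simp add: proj_def)

text \<open>Suppose the projections \<open>q\<close> of \<open>x\<close> and \<open>p\<close> of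
  \<open>y\<close> were not collinear. Then \<open>q\<close> is at distance two from both
  \<open>y\<close> and \<open>p\<close>, so the nearest point to \<open>q\<close> on their line is
  the third point \<open>z\<close>, which is collinear with \<open>q\<close>. But \<open>z\<close>
  is outside \<open>A\<close> and would have the two neighbours \<open>p\<close> and
  \<open>q\<close> in \<open>A\<close>.\<close>

lemma T1_proj_collin:
  assumes A: "A \<in> T1" and B: "B \<in> T1" and xy: "x \<in> B" "y \<in> B" "collin L x y"
  shows "collin L (proj L A x) (proj L A y)"
proof (cases "A = B")
  case True
  then show ?thesis using xy by (simp add: proj_inside)
next
  case False
  have dis: "z \<notin> A" if "z \<in> B" for z using T1_unique[OF A B] False that by blast
  have P: "x \<in> P" "y \<in> P" using collin_points xy by blast+
  obtain X where X: "X \<in> T2" "x \<in> X" using T2_cover P by blast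
  obtain Y where Y: "Y \<in> T2" "y \<in> Y" using T2_cover P by blast
  define p where "p = proj L A y"
  define q where "q = proj L A x"
  have q: "q \<in> A" "collin L x q" using T1_proj[OF A X] dis xy by (auto simp: q_def)
  have p: "p \<in> A" "collin L y p" using T1_proj[OF A Y] dis xy by (auto simp: p_def)
  have "p \<noteq> q"
  proof
    assume "p = q"
    then have "{p, x, y} \<in> L" using triangle_line[of p x y] p q xy by (auto simp: collin_sym)
    then have "p \<in> B" using T1_subspace[OF B, of "{p, x, y}" x y] xy by (auto simp: collin_def)
    then show False using dis p by blast
  qed
  have "collin L p q"
  proof (rule ccontr)
    assume npq: "\<not> collin L p q"
    obtain z where z: "{y, p, z} \<in> L" "z \<noteq> y" "z \<noteq> p" "collin L y z" "collin L p z"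
      using obtain_third[OF p(2)] .
    have zA: "z \<notin> A" using T1_subspace[OF A z(1), of p z] z p dis xy by auto
    have qP: "q \<in> P" "p \<in> P" "z \<in> P" using collin_points q p z by blast+
    have yq: "\<not> collin L q y" "q \<noteq> y"
      using quad_nearest_unique[OF T1_quad[OF A] dis[OF xy(2)] p(1) q(1) p(2)] \<open>p \<noteq> q\<close> q dis xy
      by (auto simp: collin_sym)
    have d: "pdist L q y = 2" using pdist_eq_2[of q x y] q xy yq by (auto simp: collin_sym)
    obtain w where w: "w \<in> {y, p, z}" "\<And>v. v \<in> {y, p, z} \<Longrightarrow> v \<noteq> w \<Longrightarrow> pdist L q w < pdist L q v"
      using nearest[OF qP(1) z(1)] by blast
    have dp: "pdist L q p = 2"
    proof -
      have "pdist L q p \<le> 2" using T1_quad[OF A] p q unfolding quad_def has_diameter_def by blast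
      moreover have "pdist L q p \<noteq> 0" "pdist L q p \<noteq> 1"
        using pdist_eq_0 pdist_eq_1 qP npq \<open>p \<noteq> q\<close> by (auto simp: collin_sym)
      ultimately show ?thesis by simp
    qed
    have "y \<noteq> p" using p(2) by (auto simp: collin_def)
    then have "w \<noteq> y" "w \<noteq> p" using w(2)[of y] w(2)[of p] d dp by auto
    then have "w = z" using w by blast
    then have "pdist L q z < 2" using w(2)[of y] d \<open>w \<noteq> y\<close> by auto
    then have "pdist L q z = 0 \<or> pdist L q z = 1" by auto
    then have "q = z \<or> collin L q z" using pdist_eq_0 pdist_eq_1 qP by blast
    then have "collin L z q" using zA q by (auto simp: collin_sym)
    then show False
      using quad_nearest_unique[OF T1_quad[OF A] zA p(1) q(1)] z \<open>p \<noteq> q\<close> by (auto simp: collin_sym)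
  qed
  then show ?thesis by (simp add: p_def q_def collin_sym)
qed

lemma T2_proj_inverse:
  assumes "X \<in> T2" "Y \<in> T2" "B \<in> T1" "x \<in> B \<inter> X"
  shows "proj L X (proj L Y x) = x"
proof (cases "X = Y")
  case True
  then show ?thesis using assms by (simp add: proj_inside)
next
  case False
  then have "x \<notin> Y" using assms T2_unique by blast
  then have "proj L Y x \<in> Y" "collin L x (proj L Y x)" using T2_proj assms by blast+
  then show ?thesis using T2_proj_eq[of X "proj L Y x" x] assms False T2_unique
    by (metis IntE collin_sym)
qed

lemma T1_proj_inverse:
  assumes "X \<in> T1" "Y \<in> T1" "B \<in> T2" "x \<in> B \<inter> X"
  shows "proj L X (proj L Y x) = x"
proof -
  interpret S: quad_partitions P L T2 T1 by (rule swap)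
  show ?thesis using S.T2_proj_inverse[OF assms] .
qed

text \<open>The edge from \<open>y\<close> to \<open>proj L X y\<close> lies in \<open>B\<close>, so
  its projection to \<open>A\<close> is again an edge. Its second end is then a neighbour in
  \<open>X\<close> of \<open>proj L A y\<close>, and such a neighbour is unique.\<close>

lemma proj_commute:
  assumes A: "A \<in> T1" and B: "B \<in> T1" and X: "X \<in> T2" and y: "y \<in> B"
  shows "proj L A (proj L X y) = proj L X (proj L A y)"
proof (cases "y \<in> X")
  case True
  then show ?thesis using T1_proj(1)[OF A X True] by (simp add: proj_inside)
next
  case False
  obtain Y where Y: "Y \<in> T2" "y \<in> Y" using T2_cover y T1_subset[OF B] by blast
  have XY: "z \<notin> X" if "z \<in> Y" for z using T2_unique[OF X Y(1)] False Y(2) that by blast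
  have z: "proj L X y \<in> X \<inter> B" "collin L y (proj L X y)" using T2_proj[OF X B y] False by auto
  have "collin L (proj L A y) (proj L A (proj L X y))" using T1_proj_collin[OF A B y] z by blast
  moreover have "proj L A y \<notin> X" using T1_proj(1)[OF A Y] XY by blast
  moreover have "proj L A (proj L X y) \<in> X" using T1_proj(1)[OF A X] z by blast
  ultimately show ?thesis using T2_proj_eq[OF X] by metis
qed

lemma collin_lines_in:
  assumes "A \<in> T1" "x \<in> A" "y \<in> A"
  shows "collin (lines_in L A) x y \<longleftrightarrow> collin L x y"
proof
  assume "collin L x y"
  then obtain l where l: "l \<in> L" "x \<in> l" "y \<in> l" "x \<noteq> y" by (auto simp: collin_def)
  then have "l \<in> lines_in L A" using T1_subspace[OF assms(1) l assms(2,3)] by (simp add: lines_in_def)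
  then show "collin (lines_in L A) x y" using l by (auto simp: collin_def)
qed (auto simp: collin_def lines_in_def)

text \<open>\<open>eps\<close> projects to the lines \<open>Lstar\<close> and \<open>Mstar\<close>,
  whereas commutation is available for quads. Both projections agree because the neighbour in
  \<open>X\<close> of a point of \<open>A\<close> already lies in \<open>A\<close>.\<close>

lemma proj_line_T2:
  assumes A: "A \<in> T1" and X: "X \<in> T2" and y: "y \<in> A"
  shows "proj L (A \<inter> X) y = proj L X y"
proof (cases "y \<in> X")
  case True
  then show ?thesis using y by (simp add: proj_inside)
next
  case False
  have "(THE z. z \<in> A \<inter> X \<and> collin L y z) = proj L X y"
    using T2_proj[OF X A y] False T2_proj_eq[OF X False] by (intro the_equality) auto
  then show ?thesis using False by (simp add: proj_def)
qed

lemma proj_line_T1: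
  assumes "A \<in> T1" "X \<in> T2" "y \<in> X"
  shows "proj L (X \<inter> A) y = proj L A y"
proof -
  interpret S: quad_partitions P L T2 T1 by (rule swap)
  show ?thesis using S.proj_line_T2 assms by blast
qed

lemma quad_on_eq:
  assumes A: "A \<in> T1" and X: "X \<in> T2"
  shows "quad_on T2 (A \<inter> X) = X"
proof -
  have "A \<inter> X \<in> L" using T1_T2 A X by blast
  then have "card (A \<inter> X) = 3" by (rule card_line)
  then obtain x where "x \<in> A \<inter> X" by (metis card_3_iff insertI1)
  then show ?thesis unfolding quad_on_def using X T2_unique by (intro the_equality) blast+
qed

section \<open>Reflection of one quad in another, and the grids it produces\<close>

lemma reflect_T1:
  assumes A: "A \<in> T1" and B: "B \<in> T1" "A \<noteq> B" and b: "b \<in> B"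
  shows "{b, proj L A b, reflect L A b} \<in> L" "distinct [b, proj L A b, reflect L A b]"
    "reflect L A b \<notin> A" "reflect L A b \<notin> B"
    "collin L b (proj L A b)" "collin L b (reflect L A b)" "collin L (proj L A b) (reflect L A b)"
proof -
  obtain X where X: "X \<in> T2" "b \<in> X" using T2_cover b T1_subset[OF B(1)] by blast
  have bA: "b \<notin> A" using T1_unique[OF A B(1)] B b by blast
  have p: "proj L A b \<in> A" "collin L b (proj L A b)" using T1_proj[OF A X] bA by auto
  have pB: "proj L A b \<notin> B" using T1_unique[OF A B(1)] B p by blast
  obtain z where z: "{b, proj L A b, z} \<in> L" "z \<noteq> b" "z \<noteq> proj L A b" "collin L b z"
    "collin L (proj L A b) z" "third L b (proj L A b) = z" using obtain_third[OF p(2)] by metis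
  have "reflect L A b = z" using bA z by (simp add: reflect_def)
  moreover have "z \<notin> A" using T1_subspace[OF A z(1), of "proj L A b" z] z p bA by auto
  moreover have "z \<notin> B" using T1_subspace[OF B(1) z(1), of b z] z p b pB by auto
  ultimately show "{b, proj L A b, reflect L A b} \<in> L" "distinct [b, proj L A b, reflect L A b]"
    "reflect L A b \<notin> A" "reflect L A b \<notin> B"
    "collin L b (proj L A b)" "collin L b (reflect L A b)" "collin L (proj L A b) (reflect L A b)"
    using z p by (auto simp: collin_def)
qed

text \<open>Going around three quads \<open>A, B, C\<close> of \<open>T1\<close> by projections is an automorphism of \<open>A\<close> that
  stabilizes every line of the spread of \<open>A\<close>. Its fixed points are those on lines meeting \<open>A, B, C\<close>, and
  they propagate along the lines of \<open>A\<close> outside the spread: one fixed point makes it the identity.\<close>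

lemma reflect_quad:
  assumes A: "A \<in> T1" and B: "B \<in> T1" "A \<noteq> B" and C: "C \<in> T1"
    and c0: "c0 \<in> C" "c0 \<in> reflect L A ` B"
  shows "reflect L A ` B = C"
proof -
  obtain b0 where b0: "b0 \<in> B" "c0 = reflect L A b0" using c0 by blast
  have AC: "A \<noteq> C" "B \<noteq> C" using reflect_T1(3,4)[OF A B b0(1)] b0 c0 by auto
  have sep: "x \<notin> B \<and> x \<notin> C" if "x \<in> A" for x using T1_unique A B C AC that by blast
  have BA: "x \<notin> A \<and> x \<notin> C" if "x \<in> B" for x using T1_unique A B C AC that by blast
  have CA: "x \<notin> A \<and> x \<notin> B" if "x \<in> C" for x using T1_unique A B C AC that by blast
  define f where "f x = proj L A (proj L C (proj L B x))" for x
  have fX: "proj L B x \<in> B \<inter> X" "proj L C (proj L B x) \<in> C \<inter> X" "f x \<in> A \<inter> X"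
    if "X \<in> T2" "x \<in> X" for x X
    using T1_proj(1)[OF B(1)] T1_proj(1)[OF C] T1_proj(1)[OF A] that unfolding f_def by blast+
  have f_collin: "collin L (f x) (f y)" if "x \<in> A" "y \<in> A" "collin L x y" for x y
  proof -
    have P: "x \<in> P" "y \<in> P" using collin_points that(3) by blast+
    obtain X Y where XY: "X \<in> T2" "x \<in> X" "Y \<in> T2" "y \<in> Y" using T2_cover P by meson
    show ?thesis unfolding f_def
      using fX[OF XY(1,2)] fX[OF XY(3,4)] T1_proj_collin[OF B(1) A that]
        T1_proj_collin[OF C B(1)] T1_proj_collin[OF A C] by blast
  qed
  \<comment> \<open>If \<open>x\<close> is fixed, then both \<open>y\<close> and \<open>f y\<close>
    are neighbours of \<open>x\<close> in the quad \<open>Y\<close>, and there is only one such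
    neighbour.\<close>
  have step: "f y = y" if x: "x \<in> A" "x \<in> X" "f x = x" and y: "y \<in> A" "y \<in> Y"
    and XY: "X \<in> T2" "Y \<in> T2" "X \<noteq> Y" and c: "collin L x y" for x y X Y
  proof -
    have xY: "x \<notin> Y" using T2_unique XY x by blast
    have "collin L x (f y)" using f_collin[OF x(1) y(1) c] x by simp
    moreover have "f y \<in> Y" using fX[OF XY(2) y(2)] by blast
    ultimately show ?thesis using T2_proj_eq[OF XY(2) xY] y c by metis
  qed
  \<comment> \<open>Starting at \<open>proj L A b\<close>, the tour passes through \<open>b\<close>
    and \<open>proj L C b\<close>. It closes up exactly when these three points are pairwise
    collinear, that is, when the third point of the line from \<open>b\<close> to
    \<open>proj L A b\<close> is in \<open>C\<close>.\<close>
  have fixed_iff: "f (proj L A b) = proj L A b \<longleftrightarrow> reflect L A b \<in> C" if b: "b \<in> B" for b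
  proof -
    obtain X where X: "X \<in> T2" "b \<in> X" using T2_cover b T1_subset[OF B(1)] by blast
    note r = reflect_T1[OF A B b]
    have bb: "proj L B (proj L A b) = b" using T1_proj_inverse[OF B(1) A X(1)] X b by blast
    have d: "proj L C b \<in> C" "collin L b (proj L C b)" using T1_proj[OF C X] BA[OF b] by auto
    show ?thesis
    proof
      assume "f (proj L A b) = proj L A b"
      then have "proj L A (proj L C b) = proj L A b" unfolding f_def bb .
      then have "collin L (proj L C b) (proj L A b)"
        using T1_proj(2)[OF A X(1), of "proj L C b"] T1_proj(1)[OF C X] CA by auto
      then have "third L b (proj L A b) = proj L C b"
        using triangle_line(2)[OF r(5) d(2)] by (simp add: collin_sym)
      then show "reflect L A b \<in> C" using d BA[OF b] by (simp add: reflect_def)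
    next
      assume rC: "reflect L A b \<in> C"
      have "proj L C b = reflect L A b" using T1_proj_eq[OF C _ rC r(6)] BA[OF b] by blast
      moreover have "proj L A (reflect L A b) = proj L A b"
        using T1_proj_eq[OF A r(3)] r(7) T1_proj(1)[OF A X] by (auto simp: collin_sym)
      ultimately show "f (proj L A b) = proj L A b" unfolding f_def bb by simp
    qed
  qed
  obtain X where X: "X \<in> T2" "b0 \<in> X" using T2_cover b0 T1_subset[OF B(1)] by blast
  define x where "x = proj L A b0"
  have x: "x \<in> A" "x \<in> X" "f x = x"
    using T1_proj(1)[OF A X] fixed_iff[OF b0(1)] b0 c0 by (auto simp: x_def)
  \<comment> \<open>Fixedness only passes between different spread lines, so another point
    \<open>z\<close> of the spread line of \<open>x\<close> is reached by a detour \<open>x\<close>,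
    \<open>y\<close>, \<open>v\<close>, \<open>z\<close>. The line \<open>m\<close> from
    \<open>y\<close> to \<open>v\<close> avoids both \<open>n\<close> and the spread line of
    \<open>y\<close>, which keeps \<open>v\<close> off \<open>X\<close> and off
    \<open>Y\<close>.\<close>
  have fX_all: "f z = z" if z: "z \<in> A" "z \<in> X" for z
  proof (cases "z = x")
    case True
    then show ?thesis using x by simp
  next
    case False
    interpret A: slim_gq 4 A "lines_in L A" using T1_gq[OF A] by unfold_locales
    have AX: "A \<inter> X \<in> lines_in L A" using T1_T2 A X by (auto simp: lines_in_def)
    obtain n where n: "n \<in> lines_in L A" "x \<in> n" "n \<notin> {A \<inter> X}"
      by (rule A.exists_line_avoiding[OF x(1), of "{A \<inter> X}"]) simp_all
    obtain y y' where y: "n = {x, y, y'}" "y \<noteq> x" using card_3_others[OF A.card_line[OF n(1)] n(2)] by metis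
    have nL: "n \<in> L" "n \<subseteq> A" using n by (auto simp: lines_in_def)
    have yA: "y \<in> A" "collin L x y" using y nL collin_line[OF nL(1)] by auto
    have yX: "y \<notin> X" using A.line_unique[OF n(1) AX, of x y] n y yA x by auto
    obtain Y where Y: "Y \<in> T2" "y \<in> Y" using T2_cover yA T1_subset[OF A] by blast
    have fy: "f y = y" using step[OF x yA(1) Y(2) X(1) Y(1)] yA yX Y by blast
    have AY: "A \<inter> Y \<in> lines_in L A" using T1_T2 A Y by (auto simp: lines_in_def)
    have c2: "card {n, A \<inter> Y} \<le> 4" by (simp add: card_insert_if)
    obtain m where m: "m \<in> lines_in L A" "y \<in> m" "m \<notin> {n, A \<inter> Y}"
      by (rule A.exists_line_avoiding[OF yA(1) c2]) simp
    have mL: "m \<in> L" "m \<subseteq> A" using m by (auto simp: lines_in_def)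
    have xm: "x \<notin> m" using A.line_unique[OF n(1) m(1), of x y] n y m by auto
    have projy: "proj L X y = x" using T2_proj_eq[OF X(1) yX x(2)] yA by (simp add: collin_sym)
    have zy: "\<not> collin L z y" using T2_proj_eq[OF X(1) yX z(2)] projy False by (auto simp: collin_sym)
    have zm: "z \<notin> m" using collin_line[OF mL(1), of z y] m zy z yX by auto
    obtain v where v: "v \<in> m" "collin (lines_in L A) z v" using A.projection[OF z(1) m(1) zm] by blast
    have zv: "collin L v z" using v by (auto simp: collin_def lines_in_def)
    have vy: "v \<noteq> y" using zy zv by (auto simp: collin_sym)
    have yv: "collin L y v" using collin_line[OF mL(1) m(2) v(1)] vy by blast
    have vX: "v \<notin> X" using T2_proj_eq[OF X(1) yX _ yv] projy v xm by auto
    have vY: "v \<notin> Y" using A.line_unique[OF m(1) AY m(2) v(1)] vy Y yA v mL m by auto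
    have vA: "v \<in> A" using v mL by blast
    obtain V where V: "V \<in> T2" "v \<in> V" using T2_cover vA T1_subset[OF A] by blast
    have "f v = v" using step[OF yA(1) Y(2) fy vA V(2) Y(1) V(1) _ yv] vY V by blast
    then show ?thesis using step[OF vA V(2) _ z V(1) X(1) _ zv] vX V by blast
  qed
  have f_all: "f y = y" if y: "y \<in> A" for y
  proof (cases "y \<in> X")
    case True
    then show ?thesis using fX_all y by blast
  next
    case False
    obtain Y where Y: "Y \<in> T2" "y \<in> Y" using T2_cover y T1_subset[OF A] by blast
    have z: "proj L X y \<in> A" "proj L X y \<in> X" "collin L (proj L X y) y"
      using T2_proj[OF X(1) A y] False by (auto simp: collin_sym)
    show ?thesis using step[OF z(1,2) fX_all[OF z(1,2)] y Y(2) X(1) Y(1) _ z(3)] False Y by blast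
  qed
  have rC: "reflect L A b \<in> C" if b: "b \<in> B" for b
  proof -
    obtain Z where "Z \<in> T2" "b \<in> Z" using T2_cover b T1_subset[OF B(1)] by blast
    then have "proj L A b \<in> A" using T1_proj(1)[OF A] by blast
    then show ?thesis using fixed_iff[OF b] f_all by blast
  qed
  show ?thesis
  proof (intro equalityI subsetI)
    fix c assume "c \<in> reflect L A ` B" then show "c \<in> C" using rC by blast
  next
    fix c assume c: "c \<in> C"
    obtain Z where Z: "Z \<in> T2" "c \<in> Z" using T2_cover c T1_subset[OF C] by blast
    define b where "b = proj L B c"
    have b: "b \<in> B" "proj L C b = c"
      using T1_proj(1)[OF B(1) Z] T1_proj_inverse[OF C B(1) Z(1)] c Z by (auto simp: b_def)
    have "proj L C b = reflect L A b"
      using T1_proj_eq[OF C _ rC[OF b(1)] reflect_T1(6)[OF A B b(1)]] BA[OF b(1)] by blast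
    then show "c \<in> reflect L A ` B" using b by auto
  qed
qed

text \<open>Applied to \<open>Qbb\<close>, which is defined only as an image. The quad of
  \<open>T1\<close> through a single image point is the whole image, by
  \<open>reflect_quad\<close>.\<close>

lemma reflect_in_T1:
  assumes A: "A \<in> T1" and B: "B \<in> T1" "A \<noteq> B"
  shows "reflect L A ` B \<in> T1" "reflect L A ` B \<noteq> A" "reflect L A ` B \<noteq> B"
proof -
  obtain b where b: "b \<in> B" using T1_gq[OF B(1)] by (auto simp: gen_quadrangle_def)
  note r = reflect_T1[OF A B b]
  have "reflect L A b \<in> P" using r(6) collin_points by blast
  then obtain C where C: "C \<in> T1" "reflect L A b \<in> C" using T1_cover by blast
  then show "reflect L A ` B \<in> T1" using reflect_quad[OF A B C] b by auto
  show "reflect L A ` B \<noteq> A" "reflect L A ` B \<noteq> B" using r(3,4) b by auto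
qed

text \<open>Needed to see that the grid in \<open>Rstar\<close> is a subspace. Since a point outside
  a quad has only one neighbour in it, a line meeting two of the three quads is one of the lines
  \<open>{b, proj L A b, reflect L A b}\<close>.\<close>

lemma reflect_transversal:
  assumes A: "A \<in> T1" and B: "B \<in> T1" "A \<noteq> B"
    and l: "l \<in> L" "x \<in> l" "y \<in> l" "x \<noteq> y"
    and xy: "x \<in> A \<union> B \<union> reflect L A ` B" "y \<in> A \<union> B \<union> reflect L A ` B"
  shows "l \<subseteq> A \<union> B \<union> reflect L A ` B"
proof -
  let ?C = "reflect L A ` B"
  note C = reflect_in_T1[OF A B]
  have sep: "\<And>z. z \<in> A \<Longrightarrow> z \<notin> B \<and> z \<notin> ?C" "\<And>z. z \<in> B \<Longrightarrow> z \<notin> ?C"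
    using T1_unique[OF A B(1)] T1_unique[OF A C(1)] T1_unique[OF B(1) C(1)] B C by blast+
  have line: "{b, proj L A b, reflect L A b} \<subseteq> A \<union> B \<union> ?C" if b: "b \<in> B" for b
  proof -
    obtain Z where "Z \<in> T2" "b \<in> Z" using T2_cover b T1_subset[OF B(1)] by blast
    then show ?thesis using T1_proj(1)[OF A] b by blast
  qed
  have AB: "l \<subseteq> A \<union> B \<union> ?C" if u: "u \<in> l" "v \<in> l" "u \<in> A" "v \<in> B" for u v
  proof -
    have "collin L v u" using collin_line[OF l(1)] u sep by blast
    then have "proj L A v = u" using T1_proj_eq[OF A _ u(3)] u sep by blast
    moreover have "u \<noteq> v" using u sep by blast
    ultimately have "l = {v, proj L A v, reflect L A v}"
      using line_unique[OF l(1) reflect_T1(1)[OF A B u(4)], of u v] u by simp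
    then show ?thesis using line[OF u(4)] by simp
  qed
  have AC: "l \<subseteq> A \<union> B \<union> ?C" if u: "u \<in> l" "v \<in> l" "u \<in> A" "v \<in> ?C" for u v
  proof -
    obtain b where b: "b \<in> B" "v = reflect L A b" using u by blast
    note r = reflect_T1[OF A B b(1)]
    have "collin L v u" using collin_line[OF l(1)] u sep by blast
    then have "proj L A v = u" using T1_proj_eq[OF A _ u(3)] r b by blast
    moreover have "proj L A v = proj L A b"
    proof -
      obtain Z where "Z \<in> T2" "b \<in> Z" using T2_cover b T1_subset[OF B(1)] by blast
      then have "proj L A b \<in> A" using T1_proj(1)[OF A] by blast
      then show ?thesis using T1_proj_eq[OF A r(3)] r(7) b by (simp add: collin_sym)
    qed
    ultimately have pb: "proj L A b = u" by simp
    have "u \<noteq> v" using u sep by blast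
    then have "l = {b, proj L A b, reflect L A b}" using line_unique[OF l(1) r(1), of u v] pb b u by simp
    then show ?thesis using line[OF b(1)] by simp
  qed
  have BC: "l \<subseteq> A \<union> B \<union> ?C" if u: "u \<in> l" "v \<in> l" "u \<in> B" "v \<in> ?C" for u v
  proof -
    obtain b where b: "b \<in> B" "v = reflect L A b" using u by blast
    note r = reflect_T1[OF A B b(1)]
    have "collin L v u" using collin_line[OF l(1)] u sep by blast
    then have ub: "u = b" using quad_nearest_unique[OF T1_quad[OF B(1)] r(4) u(3) b(1)] b r(6)
      by (simp add: collin_sym)
    have "u \<noteq> v" using u sep by blast
    then have "l = {b, proj L A b, reflect L A b}" using line_unique[OF l(1) r(1), of u v] ub b u by simp
    then show ?thesis using line[OF b(1)] by simp
  qed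
  have same: "l \<subseteq> A \<union> B \<union> ?C" if "D \<in> {A, B, ?C}" "x \<in> D" "y \<in> D" for D
  proof -
    have "l \<subseteq> D" using T1_subspace[OF _ l that(2,3)] that(1) A B(1) C(1) by blast
    then show ?thesis using that(1) by blast
  qed
  show ?thesis
    using xy same AB[OF l(2,3)] AB[OF l(3,2)] AC[OF l(2,3)] AC[OF l(3,2)] BC[OF l(2,3)] BC[OF l(3,2)]
    by (metis Un_iff insertI1 insertI2)
qed

end

section \<open>The functions \<epsilon> and \<theta>, and collinearity in terms of them\<close>

locale theta_setting = quad_partitions P L T1 T2
  for P L and T1 T2 :: "'p set set" +
  fixes Q Qb Qbb Lstar Rstar Mstar Q1 :: "'p set" and S :: "'p set set"
    and W :: "3 \<Rightarrow> 'p set"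
    and \<theta> :: "'p set \<Rightarrow> 'p set \<Rightarrow> 3"
    and \<epsilon> :: "'p \<Rightarrow> 3"
  assumes Q: "Q \<in> T1" "Qb \<in> T1" "Q \<noteq> Qb"
    and Qbb: "Qbb = reflect L Q ` Qb"
    and S: "S = {Q \<inter> X | X. X \<in> T2}"
    and Lstar: "Lstar \<in> S"
    and Rstar: "Rstar = quad_on T2 Lstar"
    and W: "bij_betw W UNIV
              {X. W2_subquadrangle L Rstar X \<and> Rstar \<inter> (Q \<union> Qb \<union> Qbb) \<subseteq> X}"
    and theta: "\<forall>L1\<in>S. \<forall>L2\<in>S. \<forall>i.
              (proj L Rstar \<circ> proj L (quad_on T2 L2) \<circ> proj L (quad_on T2 L1)) ` W i
                = W (i + \<theta> L1 L2)"
    and Q1: "Q1 \<in> T1 - {Q, Qb, Qbb}"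
    and Mstar: "Mstar = Rstar \<inter> Q1"
    and eps: "\<epsilon> = eps L Lstar Mstar W"
begin

lemma Rstar_T2: "Rstar \<in> T2" and Lstar_eq: "Lstar = Q \<inter> Rstar"
proof -
  obtain X where "X \<in> T2" "Lstar = Q \<inter> X" using Lstar S by blast
  then show "Rstar \<in> T2" "Lstar = Q \<inter> Rstar" using quad_on_eq[OF Q(1)] Rstar by auto
qed

lemma W_gq: "gq_with_sub Rstar (lines_in L Rstar) (W i)"
  and W_grid: "Rstar \<inter> (Q \<union> Qb \<union> Qbb) \<subseteq> W i"
proof -
  have "W i \<in> {X. W2_subquadrangle L Rstar X \<and> Rstar \<inter> (Q \<union> Qb \<union> Qbb) \<subseteq> X}"
    using W by (auto simp: bij_betw_def)
  then have w: "W2_subquadrangle L Rstar (W i)" and "Rstar \<inter> (Q \<union> Qb \<union> Qbb) \<subseteq> W i" by blast+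
  then show "Rstar \<inter> (Q \<union> Qb \<union> Qbb) \<subseteq> W i" by blast
  have "W i \<subseteq> Rstar" using w by (auto simp: W2_subquadrangle_def subspace_of_def)
  then have "lines_in (lines_in L Rstar) (W i) = lines_in L (W i)" by (auto simp: lines_in_def)
  then show "gq_with_sub Rstar (lines_in L Rstar) (W i)"
    using w T2_gq[OF Rstar_T2]
    by (simp add: gq_with_sub_def gq_with_sub_axioms_def slim_gq_def W2_subquadrangle_def)
qed

lemma Q1_T1: "Q1 \<in> T1" and Mstar_line: "Mstar \<in> L"
proof -
  show "Q1 \<in> T1" using Q1 by blast
  then show "Mstar \<in> L" unfolding Mstar using T1_T2 Rstar_T2 by (metis Int_commute)
qed

text \<open>The grid contains the three disjoint lines cut out of \<open>Rstar\<close> by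
  \<open>Q\<close>, \<open>Qb\<close> and \<open>Qbb\<close>, and a point of \<open>Mstar\<close> is
  off the grid because \<open>Q1\<close> is a fourth quad. So \<open>subspace_inter\<close> makes
  two \<open>W i\<close> through that point equal.\<close>

lemma W_disjoint_on_Mstar:
  assumes m: "m \<in> Mstar" "m \<in> W i" "m \<in> W j"
  shows "i = j"
proof -
  let ?G = "Rstar \<inter> (Q \<union> Qb \<union> Qbb)"
  note C = reflect_in_T1[OF Q, folded Qbb]
  have mG: "m \<notin> ?G"
    using m(1) T1_unique[OF Q1_T1, of _ m] Q(1,2) C(1) Q1 unfolding Mstar by blast
  have G: "subspace_of Rstar (lines_in L Rstar) ?G"
    unfolding subspace_of_def
  proof (intro conjI ballI impI)
    fix l x y assume l: "l \<in> lines_in L Rstar" "x \<in> l \<inter> ?G" "y \<in> l \<inter> ?G" "x \<noteq> y"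
    then have "l \<in> L" "l \<subseteq> Rstar" by (auto simp: lines_in_def)
    moreover have "l \<subseteq> Q \<union> Qb \<union> Qbb"
      using reflect_transversal[OF Q \<open>l \<in> L\<close>, of x y] l unfolding Qbb by blast
    ultimately show "l \<subseteq> ?G" by blast
  qed blast
  have lines: "A \<inter> Rstar \<in> lines_in L Rstar" if "A \<in> T1" for A
    using T1_T2 that Rstar_T2 by (auto simp: lines_in_def)
  have dis: "(A \<inter> Rstar) \<inter> (B \<inter> Rstar) = {}" if "A \<in> T1" "B \<in> T1" "A \<noteq> B" for A B
    using T1_unique that by blast
  have sub: "W k \<subseteq> W k'" if "m \<in> W k" "m \<in> W k'" for k k'
  proof -
    interpret Wk: gq_with_sub Rstar "lines_in L Rstar" "W k" by (rule W_gq)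
    show ?thesis
      by (rule Wk.subspace_inter[OF W_gq G W_grid W_grid lines[OF Q(1)] lines[OF Q(2)] lines[OF C(1)]
          _ _ _ dis[OF Q] dis[OF Q(1) C(1)] dis[OF Q(2) C(1)] that mG])
        (use C in blast)+
  qed
  have "W i = W j" using sub m by blast
  then show ?thesis using W by (auto simp: bij_betw_def dest: injD)
qed

text \<open>Each of the three \<open>W i\<close> meets the line \<open>Mstar\<close>, no point is in
  two of them, and \<open>Mstar\<close> has three points. This makes the description in
  \<open>eps\<close> well defined.\<close>

lemma Mstar_W: "\<exists>!m. m \<in> Mstar \<and> m \<in> W i" and Mstar_cover: "m \<in> Mstar \<Longrightarrow> \<exists>i. m \<in> W i"
proof -
  have "\<exists>m. m \<in> Mstar \<inter> W i" for i
  proof -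
    interpret Wi: gq_with_sub Rstar "lines_in L Rstar" "W i" by (rule W_gq)
    have "Mstar \<in> lines_in L Rstar" using Mstar_line Mstar by (auto simp: lines_in_def)
    then show ?thesis using Wi.line_meets_W by blast
  qed
  then obtain f where f: "\<And>i. f i \<in> Mstar \<inter> W i" by metis
  have inj: "inj f" using f W_disjoint_on_Mstar by (intro injI) (metis IntE)
  have sub: "range f \<subseteq> Mstar" using f by blast
  have "card (range f) = card Mstar" using card_image[OF inj] card_line[OF Mstar_line] by simp
  moreover have "finite Mstar" using card_line[OF Mstar_line] by (intro card_ge_0_finite) simp
  ultimately have surj: "range f = Mstar" using sub card_subset_eq by blast
  show "\<exists>i. m \<in> W i" if "m \<in> Mstar" using that f surj by blast
  show "\<exists>!m. m \<in> Mstar \<and> m \<in> W i"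
  proof (rule ex1I)
    show "f i \<in> Mstar \<and> f i \<in> W i" using f by blast
    fix m assume m: "m \<in> Mstar \<and> m \<in> W i"
    then obtain j where "m = f j" using surj by blast
    then show "m = f i" using f[of j] m W_disjoint_on_Mstar by blast
  qed
qed

text \<open>The point of \<open>Mstar\<close> on which \<open>eps\<close> is evaluated, reached by
  projecting to \<open>Q1\<close> before \<open>Rstar\<close> instead of after; the two orders agree
  by \<open>proj_commute\<close>.\<close>

definition mu :: "'p \<Rightarrow> 'p" where "mu y = proj L Rstar (proj L Q1 y)"

lemma proj_Q1: "X \<in> T2 \<Longrightarrow> y \<in> X \<Longrightarrow> proj L Q1 y \<in> Q1 \<inter> X"
  using T1_proj(1)[OF Q1_T1] .

lemma mu_Mstar: "y \<in> Q \<Longrightarrow> mu y \<in> Mstar"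
proof -
  assume "y \<in> Q"
  then obtain X where "X \<in> T2" "y \<in> X" using T2_cover T1_subset[OF Q(1)] by blast
  then show ?thesis using proj_Q1 T2_proj(1)[OF Rstar_T2 Q1_T1] by (auto simp: Mstar mu_def)
qed

lemma eps_iff:
  assumes y: "y \<in> Q"
  shows "\<epsilon> y = i \<longleftrightarrow> mu y \<in> W i"
proof -
  have "proj L Rstar y \<in> Rstar" using T2_proj(1)[OF Rstar_T2 Q(1) y] by blast
  then have "proj L Mstar (proj L Lstar y) = mu y"
    using proj_line_T2[OF Q(1) Rstar_T2 y] proj_line_T1[OF Q1_T1 Rstar_T2]
      proj_commute[OF Q1_T1 Q(1) Rstar_T2 y] by (simp add: Mstar Lstar_eq mu_def)
  then have e: "\<epsilon> y = (THE i. mu y \<in> W i)" by (simp add: eps eps_def)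
  obtain j where j: "mu y \<in> W j" using Mstar_cover[OF mu_Mstar[OF y]] by blast
  have "\<epsilon> y = j" unfolding e
    using j W_disjoint_on_Mstar[OF mu_Mstar[OF y]] by (intro the_equality) blast+
  then show ?thesis using j W_disjoint_on_Mstar[OF mu_Mstar[OF y]] by blast
qed

text \<open>On a spread line \<open>mu\<close> is a composite of invertible projections, hence
  injective, and the points of \<open>Mstar\<close> are separated by the indices of the
  \<open>W i\<close>. Both sides have three elements.\<close>

lemma eps_bij:
  assumes l: "l \<in> S"
  shows "bij_betw \<epsilon> l UNIV"
proof -
  obtain X where X: "X \<in> T2" "l = Q \<inter> X" using l S by blast
  have "inj_on \<epsilon> l"
  proof (rule inj_onI)
    fix y z assume yz: "y \<in> l" "z \<in> l" "\<epsilon> y = \<epsilon> z"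
    then have Q': "y \<in> Q" "z \<in> Q" "y \<in> X" "z \<in> X" using X by auto
    have "mu y = mu z"
      using Mstar_W[of "\<epsilon> z"] eps_iff[OF Q'(1)] eps_iff[OF Q'(2)] mu_Mstar Q' yz(3) by metis
    then have "proj L Q1 y = proj L Q1 z"
      using T2_proj_inverse[OF X(1) Rstar_T2 Q1_T1] proj_Q1[OF X(1)] Q' by (metis mu_def)
    then show "y = z"
      using T1_proj_inverse[OF Q(1) Q1_T1 X(1)] Q' by (metis IntI)
  qed
  moreover have "card l = 3" using card_line T1_T2 X Q(1) by simp
  ultimately have "card (\<epsilon> ` l) = CARD(3)" by (simp add: card_image)
  then have "\<epsilon> ` l = UNIV" using card_subset_eq[of "UNIV :: 3 set" "\<epsilon> ` l"] by simp
  then show ?thesis using \<open>inj_on \<epsilon> l\<close> by (simp add: bij_betw_def)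
qed

text \<open>Projecting \<open>mu x\<close> to \<open>X\<close> undoes the last step of
  \<open>mu\<close> and gives \<open>proj L Q1 x\<close>. Projecting on to \<open>Y\<close> and
  \<open>Rstar\<close> then yields \<open>mu (proj L Y x)\<close>, while the defining property of
  \<theta> says which \<open>W i\<close> it is in.\<close>

lemma eps_theta:
  assumes X: "X \<in> T2" and Y: "Y \<in> T2" and x: "x \<in> Q" "x \<in> X"
  shows "\<epsilon> (proj L Y x) = \<epsilon> x + \<theta> (Q \<inter> X) (Q \<inter> Y)"
proof -
  have y: "proj L Y x \<in> Q" using T2_proj(1)[OF Y Q(1) x(1)] by blast
  have "proj L X (mu x) = proj L Q1 x"
    unfolding mu_def by (rule T2_proj_inverse[OF X Rstar_T2 Q1_T1 proj_Q1[OF X x(2)]])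
  then have "proj L Rstar (proj L Y (proj L X (mu x))) = mu (proj L Y x)"
    using proj_commute[OF Q1_T1 Q(1) Y x(1)] by (simp add: mu_def)
  moreover have "mu x \<in> W (\<epsilon> x)" using eps_iff[OF x(1)] by blast
  moreover have "Q \<inter> X \<in> S" "Q \<inter> Y \<in> S" using S X Y by blast+
  then have "(proj L Rstar \<circ> proj L Y \<circ> proj L X) ` W (\<epsilon> x) = W (\<epsilon> x + \<theta> (Q \<inter> X) (Q \<inter> Y))"
    using theta quad_on_eq[OF Q(1)] X Y by (metis (no_types, lifting))
  ultimately have "mu (proj L Y x) \<in> W (\<epsilon> x + \<theta> (Q \<inter> X) (Q \<inter> Y))" by (metis comp_apply imageI)
  then show ?thesis using eps_iff[OF y] by blast
qed

lemma S_line: "l \<in> S \<Longrightarrow> l \<in> L \<and> l \<subseteq> Q"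
  unfolding S using T1_T2 Q(1) by auto

lemma S_unique: "l \<in> S \<Longrightarrow> m \<in> S \<Longrightarrow> x \<in> l \<Longrightarrow> x \<in> m \<Longrightarrow> l = m"
  unfolding S using T2_unique by auto

lemma S_cover:
  assumes "x \<in> Q"
  shows "\<exists>l\<in>S. x \<in> l"
proof -
  obtain X where "X \<in> T2" "x \<in> X" using T2_cover T1_subset[OF Q(1)] assms by blast
  then have "Q \<inter> X \<in> S" "x \<in> Q \<inter> X" using assms by (auto simp: S)
  then show ?thesis by blast
qed

text \<open>The only neighbour of \<open>x\<close> on \<open>m\<close> is its projection, whose
  value is given by \<open>eps_theta\<close>; \<epsilon> is injective on \<open>m\<close>.\<close>

lemma collin_iff_theta:
  assumes l: "l \<in> S" "m \<in> S" "l \<noteq> m" and x: "x \<in> l" and y: "y \<in> m"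
  shows "collin L x y \<longleftrightarrow> \<epsilon> y = \<epsilon> x + \<theta> l m"
proof -
  obtain X where X: "X \<in> T2" "l = Q \<inter> X" using l S by blast
  obtain Y where Y: "Y \<in> T2" "m = Q \<inter> Y" using l S by blast
  have xQ: "x \<in> Q" "x \<in> X" "y \<in> Q" "y \<in> Y" using x y X Y by auto
  have xY: "x \<notin> Y" using T2_unique[OF X(1) Y(1)] X Y x l by blast
  have p: "proj L Y x \<in> Y \<inter> Q" "collin L x (proj L Y x)"
    using T2_proj[OF Y(1) Q(1) xQ(1)] xY by auto
  have e: "\<epsilon> (proj L Y x) = \<epsilon> x + \<theta> l m" using eps_theta[OF X(1) Y(1) xQ(1,2)] X Y by simp
  show ?thesis
  proof
    assume "collin L x y"
    then show "\<epsilon> y = \<epsilon> x + \<theta> l m" using T2_proj_eq[OF Y(1) xY xQ(4)] e by simp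
  next
    assume "\<epsilon> y = \<epsilon> x + \<theta> l m"
    then have "y = proj L Y x"
      using e eps_bij[OF l(2)] p(1) y Y unfolding bij_betw_def by (metis Int_commute inj_onD)
    then show "collin L x y" using p by simp
  qed
qed

end

section \<open>Representations\<close>

text \<open>With the identity, \<open>a\<close>, \<open>b\<close> and \<open>c\<close> form a Klein
  four-group. One product relation per line therefore gives all six.\<close>

lemma (in group) involution_products:
  assumes "a \<in> involutions G" "b \<in> involutions G" "a \<otimes> b = c" "c \<in> involutions G"
  shows "b \<otimes> a = c" "a \<otimes> c = b" "c \<otimes> a = b" "b \<otimes> c = a" "c \<otimes> b = a"
proof -
  have car: "a \<in> carrier G" "b \<in> carrier G" and sq: "a \<otimes> a = \<one>" "b \<otimes> b = \<one>" "c \<otimes> c = \<one>"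
    using assms by (auto simp: involutions_def)
  have la: "a \<otimes> (a \<otimes> x) = x" "b \<otimes> (b \<otimes> x) = x" if "x \<in> carrier G" for x
    using that car sq by (metis l_one m_assoc)+
  have "inv (a \<otimes> b) = a \<otimes> b" using sq(3) car by (intro inv_equality) (auto simp: assms(3)[symmetric])
  moreover have "inv a = a" "inv b = b" using sq car by (auto intro: inv_equality)
  ultimately show ba: "b \<otimes> a = c" using inv_mult_group[OF car] assms(3) by simp
  show "a \<otimes> c = b" using la car by (simp add: assms(3)[symmetric])
  show "b \<otimes> c = a" using la car by (simp add: ba[symmetric])
  show "c \<otimes> a = b" using car sq by (simp add: ba[symmetric] m_assoc)
  show "c \<otimes> b = a" using car sq by (simp add: assms(3)[symmetric] m_assoc)
qed

lemma (in group) representationI: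
  assumes inv: "\<psi> \<in> X \<rightarrow> involutions G" and inj: "inj_on \<psi> X"
    and lines: "\<And>l. l \<in> Ls \<Longrightarrow> \<exists>p q r. l = {p, q, r} \<and> {p, q, r} \<subseteq> X \<and> \<psi> p \<otimes> \<psi> q = \<psi> r"
    and gen: "generate G (\<psi> ` X) = carrier G"
  shows "representation X Ls G \<psi>"
proof -
  have triple: "\<exists>p q r. l = {p, q, r} \<and> {p, q, r} \<subseteq> X \<and> \<psi> p \<otimes> \<psi> q = \<psi> r \<and> p \<noteq> q \<and> r \<noteq> p \<and> r \<noteq> q"
    if lL: "l \<in> Ls" for l
  proof -
    obtain p q r where l: "l = {p, q, r}" "{p, q, r} \<subseteq> X" "\<psi> p \<otimes> \<psi> q = \<psi> r" using lines[OF lL] by blast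
    have I: "\<psi> p \<in> involutions G" "\<psi> q \<in> involutions G" "\<psi> r \<in> involutions G" using inv l(2) by auto
    note prods = involution_products[OF I(1,2) l(3) I(3)]
    have "p \<noteq> q" "r \<noteq> p" "r \<noteq> q" using I l(3) prods by (auto simp: involutions_def)
    then show ?thesis using l by blast
  qed
  have third_pt: "\<exists>z. l = {x, y, z} \<and> z \<in> X \<and> z \<noteq> x \<and> z \<noteq> y \<and> \<psi> x \<otimes> \<psi> y = \<psi> z"
    if l: "l \<in> Ls" "x \<in> l" "y \<in> l" "x \<noteq> y" for l x y
  proof -
    obtain p q r where p: "l = {p, q, r}" "{p, q, r} \<subseteq> X" "\<psi> p \<otimes> \<psi> q = \<psi> r" "p \<noteq> q" "r \<noteq> p" "r \<noteq> q"
      using triple[OF l(1)] by blast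
    have I: "\<psi> p \<in> involutions G" "\<psi> q \<in> involutions G" "\<psi> r \<in> involutions G" using inv p(2) by auto
    note prods = involution_products[OF I(1,2) p(3) I(3)]
    consider "x = p" "y = q" | "x = p" "y = r" | "x = q" "y = p" | "x = q" "y = r" | "x = r" "y = p" | "x = r" "y = q"
      using l p(1) by auto
    then show ?thesis
    proof cases
      case 1 then show ?thesis using p by (intro exI[of _ r]) auto
    next
      case 2 then show ?thesis using p prods by (intro exI[of _ q]) auto
    next
      case 3 then show ?thesis using p prods by (intro exI[of _ r]) auto
    next
      case 4 then show ?thesis using p prods by (intro exI[of _ p]) auto
    next
      case 5 then show ?thesis using p prods by (intro exI[of _ q]) auto
    next
      case 6 then show ?thesis using p prods by (intro exI[of _ p]) auto
    qed
  qed
  have pls: "partial_linear_space X Ls"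
    unfolding partial_linear_space_def
  proof (intro conjI ballI impI)
    fix l assume "l \<in> Ls"
    from triple[OF this] show "l \<subseteq> X" "\<exists>x\<in>l. \<exists>y\<in>l. x \<noteq> y" by blast+
  next
    fix l m x y assume a: "l \<in> Ls" "m \<in> Ls" "x \<in> l \<inter> m" "y \<in> l \<inter> m" "x \<noteq> y"
    obtain z where z: "l = {x, y, z}" "z \<in> X" "\<psi> x \<otimes> \<psi> y = \<psi> z" using third_pt[of l x y] a by blast
    obtain z' where z': "m = {x, y, z'}" "z' \<in> X" "\<psi> x \<otimes> \<psi> y = \<psi> z'" using third_pt[of m x y] a by blast
    have "z = z'" using inj z z' by (auto dest: inj_onD)
    then show "l = m" using z z' by simp
  qed
  have "slim Ls" unfolding slim_def
  proof
    fix l assume "l \<in> Ls"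
    then obtain p q r where "l = {p, q, r}" "p \<noteq> q" "r \<noteq> p" "r \<noteq> q" using triple by blast
    then show "card l = 3" by auto
  qed
  moreover have "inj_on \<psi> l \<and> (\<forall>x\<in>l. \<forall>y\<in>l. x \<noteq> y \<longrightarrow> \<psi> x \<otimes> \<psi> y = \<psi> (third Ls x y))" if l: "l \<in> Ls" for l
  proof (intro conjI ballI impI)
    have "l \<subseteq> X" using pls l by (simp add: partial_linear_space_def)
    then show "inj_on \<psi> l" using inj inj_on_subset by blast
    fix x y assume xy: "x \<in> l" "y \<in> l" "x \<noteq> y"
    then obtain z where z: "l = {x, y, z}" "z \<noteq> x" "z \<noteq> y" "\<psi> x \<otimes> \<psi> y = \<psi> z" using third_pt[OF l] by blast
    then show "\<psi> x \<otimes> \<psi> y = \<psi> (third Ls x y)" using third_eq[OF pls, of x y z] l xy by simp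
  qed
  ultimately show ?thesis
    unfolding representation_def using pls inv gen is_group by blast
qed

lemma (in group) commutator_eq_one:
  assumes "x \<in> carrier G" "y \<in> carrier G"
  shows "commutator G x y = \<one> \<longleftrightarrow> x \<otimes> y = y \<otimes> x"
proof -
  have "commutator G x y = (x \<otimes> y) \<otimes> inv (y \<otimes> x)"
    using assms by (simp add: commutator_def inv_mult_group m_assoc)
  then show ?thesis using assms by (metis inv_equality inv_inv m_closed inv_closed r_inv)
qed

text \<open>Used contrapositively: since \<open>M\<close> is non-abelian, two of its generators fail
  to commute.\<close>

lemma (in group) generate_commutes:
  assumes K: "K \<subseteq> carrier G" and comm: "\<And>x y. x \<in> K \<Longrightarrow> y \<in> K \<Longrightarrow> x \<otimes> y = y \<otimes> x"
    and x: "x \<in> generate G K" and y: "y \<in> generate G K"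
  shows "x \<otimes> y = y \<otimes> x"
proof -
  have centralizer: "z \<otimes> g = g \<otimes> z"
    if z: "z \<in> carrier G" "\<And>k. k \<in> K \<Longrightarrow> z \<otimes> k = k \<otimes> z" and g: "g \<in> generate G K" for z g
    using g
  proof (induction rule: generate.induct)
    case one
    then show ?case using z by simp
  next
    case (incl h)
    then show ?case using z by blast
  next
    case (inv h)
    then have h: "h \<in> carrier G" "z \<otimes> h = h \<otimes> z" using K z by blast+
    have "z = inv h \<otimes> (h \<otimes> z)" using h(1) z(1) by (simp add: m_assoc[symmetric])
    then have "z \<otimes> inv h = inv h \<otimes> (z \<otimes> h) \<otimes> inv h" using h(2) by simp
    then show ?case using h(1) z(1) by (simp add: m_assoc)
  next
    case (eng g h)
    then have "g \<in> carrier G" "h \<in> carrier G" using generate_in_carrier[OF K] by blast+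
    then show ?case using eng.IH z(1) by (metis m_assoc)
  qed
  have xc: "x \<in> carrier G" using generate_in_carrier[OF K x] .
  have "k \<otimes> x = x \<otimes> k" if "k \<in> K" for k
    using centralizer[OF _ _ x, of k] comm that K by blast
  then show ?thesis using centralizer[OF xc _ y] by simp
qed

section \<open>Groups whose commutators lie in a central subgroup of order two\<close>

locale class2_group = group R for R (structure) +
  fixes lam
  assumes lam_closed [simp]: "lam \<in> carrier R" and lam_neq: "lam \<noteq> \<one>" and lam_sq: "lam \<otimes> lam = \<one>"
    and lam_central: "x \<in> carrier R \<Longrightarrow> lam \<otimes> x = x \<otimes> lam"
    and comm_cases: "x \<in> carrier R \<Longrightarrow> y \<in> carrier R \<Longrightarrow> x \<otimes> y = y \<otimes> x \<or> x \<otimes> y = y \<otimes> x \<otimes> lam"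
begin

definition com :: "'a \<Rightarrow> 'a \<Rightarrow> bool" where "com x y \<longleftrightarrow> x \<otimes> y = y \<otimes> x"

lemma com_sym: "com x y \<longleftrightarrow> com y x" by (auto simp: com_def)

lemma lam_shift: "x \<in> carrier R \<Longrightarrow> x \<otimes> lam \<noteq> x"
  using lam_neq by (metis lam_closed l_cancel_one)

lemma not_com: "x \<in> carrier R \<Longrightarrow> y \<in> carrier R \<Longrightarrow> \<not> com x y \<Longrightarrow> x \<otimes> y = y \<otimes> x \<otimes> lam"
  using comm_cases by (auto simp: com_def)

text \<open>The commutator is multiplicative in each argument with values in the group of order two,
  so failures to commute are counted modulo 2.\<close>

lemma com_mult_left:
  assumes c: "x \<in> carrier R" "y \<in> carrier R" "z \<in> carrier R"
  shows "com (x \<otimes> y) z \<longleftrightarrow> (com x z \<longleftrightarrow> com y z)"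
proof -
  have l: "lam \<otimes> a = a \<otimes> lam" "a \<otimes> lam \<otimes> lam = a" if "a \<in> carrier R" for a
    using lam_central[OF that] that by (simp_all add: m_assoc lam_sq)
  have e: "x \<otimes> y \<otimes> z = x \<otimes> (y \<otimes> z)" using c by (simp add: m_assoc)
  consider "com x z" "com y z" | "com x z" "\<not> com y z" | "\<not> com x z" "com y z"
    | "\<not> com x z" "\<not> com y z" by blast
  then show ?thesis
  proof cases
    case 1
    then have "x \<otimes> y \<otimes> z = z \<otimes> (x \<otimes> y)" using c unfolding com_def by (metis m_assoc)
    then show ?thesis using 1 by (simp add: com_def)
  next
    case 2
    have "x \<otimes> (y \<otimes> z) = (x \<otimes> z) \<otimes> y \<otimes> lam" using not_com[OF c(2,3) 2(2)] c by (simp add: m_assoc)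
    also have "\<dots> = (z \<otimes> x) \<otimes> y \<otimes> lam" using 2(1) by (simp add: com_def)
    also have "\<dots> = z \<otimes> (x \<otimes> y) \<otimes> lam" using c by (simp add: m_assoc)
    finally show ?thesis using 2 e lam_shift[of "z \<otimes> (x \<otimes> y)"] c by (simp add: com_def)
  next
    case 3
    have "x \<otimes> (y \<otimes> z) = (x \<otimes> z) \<otimes> y" using 3(2) c by (simp add: com_def m_assoc)
    also have "\<dots> = z \<otimes> x \<otimes> lam \<otimes> y" unfolding not_com[OF c(1,3) 3(1)] ..
    also have "\<dots> = z \<otimes> x \<otimes> (lam \<otimes> y)" using c by (simp add: m_assoc)
    also have "\<dots> = z \<otimes> (x \<otimes> y) \<otimes> lam" unfolding l(1)[OF c(2)] using c by (simp add: m_assoc)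
    finally show ?thesis using 3 e lam_shift[of "z \<otimes> (x \<otimes> y)"] c by (simp add: com_def)
  next
    case 4
    have "x \<otimes> (y \<otimes> z) = (x \<otimes> z) \<otimes> y \<otimes> lam" using not_com[OF c(2,3) 4(2)] c by (simp add: m_assoc)
    also have "\<dots> = z \<otimes> x \<otimes> lam \<otimes> y \<otimes> lam" unfolding not_com[OF c(1,3) 4(1)] ..
    also have "\<dots> = z \<otimes> x \<otimes> (lam \<otimes> y) \<otimes> lam" using c by (simp add: m_assoc)
    also have "\<dots> = z \<otimes> x \<otimes> (y \<otimes> lam \<otimes> lam)" unfolding l(1)[OF c(2)] using c by (simp add: m_assoc)
    also have "\<dots> = z \<otimes> (x \<otimes> y)" unfolding l(2)[OF c(2)] using c by (simp add: m_assoc)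
    finally show ?thesis using 4 e by (simp add: com_def)
  qed
qed

lemma com_mult_right:
  assumes "x \<in> carrier R" "y \<in> carrier R" "z \<in> carrier R"
  shows "com z (x \<otimes> y) \<longleftrightarrow> (com z x \<longleftrightarrow> com z y)"
  using com_mult_left[OF assms] by (simp add: com_sym)

lemma com_lam: "x \<in> carrier R \<Longrightarrow> com lam x"
  using lam_central by (simp add: com_def)

lemma com_refl: "com x x" by (simp add: com_def)

text \<open>Computes products of two images of triples, whose third factors are values of \<delta>
  and commute with everything from \<phi>. The only exchange that can cost a factor
  \<open>lam\<close> is that of \<open>q\<close> with \<open>p'\<close>.\<close>

lemma mult_triples:
  assumes c: "p \<in> carrier R" "q \<in> carrier R" "r \<in> carrier R" "p' \<in> carrier R" "q' \<in> carrier R" "r' \<in> carrier R"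
    and com: "com r p'" "com r q'"
  shows "com q p' \<Longrightarrow> p \<otimes> q \<otimes> r \<otimes> (p' \<otimes> q' \<otimes> r') = p \<otimes> p' \<otimes> (q \<otimes> q') \<otimes> (r \<otimes> r')"
    and "\<not> com q p' \<Longrightarrow> p \<otimes> q \<otimes> r \<otimes> (p' \<otimes> q' \<otimes> r') = p \<otimes> p' \<otimes> (q \<otimes> q') \<otimes> (r \<otimes> r' \<otimes> lam)"
proof -
  have a: "r \<otimes> (p' \<otimes> x) = p' \<otimes> (r \<otimes> x)" "r \<otimes> (q' \<otimes> x) = q' \<otimes> (r \<otimes> x)" if "x \<in> carrier R" for x
    using com that c unfolding com_def by (metis m_assoc)+
  have 0: "p \<otimes> q \<otimes> r \<otimes> (p' \<otimes> q' \<otimes> r') = p \<otimes> (q \<otimes> p') \<otimes> q' \<otimes> (r \<otimes> r')"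
    using a c by (simp add: m_assoc)
  show "p \<otimes> q \<otimes> r \<otimes> (p' \<otimes> q' \<otimes> r') = p \<otimes> p' \<otimes> (q \<otimes> q') \<otimes> (r \<otimes> r')" if "com q p'"
    unfolding 0 that[unfolded com_def] using c by (simp add: m_assoc)
  show "p \<otimes> q \<otimes> r \<otimes> (p' \<otimes> q' \<otimes> r') = p \<otimes> p' \<otimes> (q \<otimes> q') \<otimes> (r \<otimes> r' \<otimes> lam)" if n: "\<not> com q p'"
  proof -
    have "lam \<otimes> (q' \<otimes> (r \<otimes> r')) = q' \<otimes> (r \<otimes> (r' \<otimes> lam))" using lam_central[of "q' \<otimes> (r \<otimes> r')"] c by (simp add: m_assoc)
    then show ?thesis unfolding 0 not_com[OF c(2,4) n] using c by (simp add: m_assoc)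
  qed
qed

text \<open>The Mermin square: in a \<open>3 \<times> 3\<close> grid all of whose lines multiply to the identity, opposite
  points commute.\<close>

lemma grid_com:
  assumes "a \<in> carrier R" "b \<in> carrier R" "c \<in> carrier R" "d \<in> carrier R"
    and "(a \<otimes> b) \<otimes> (c \<otimes> d) = (a \<otimes> c) \<otimes> (b \<otimes> d)"
  shows "com b c"
proof -
  have "a \<otimes> ((b \<otimes> c) \<otimes> d) = a \<otimes> ((c \<otimes> b) \<otimes> d)" using assms by (simp add: m_assoc)
  then have "b \<otimes> c \<otimes> d = c \<otimes> b \<otimes> d" using assms by (simp add: m_assoc)
  then show ?thesis unfolding com_def using assms by (metis m_closed right_cancel)
qed

end

lemma (in group) class2_groupI:
  assumes ex: "extraspecial2 G" and der: "derived G (carrier G) = {\<one>, lam}"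
  shows "class2_group G lam"
proof -
  have cen: "group_center G = {\<one>, lam}" and card: "card (group_center G) = 2"
    using ex der by (auto simp: extraspecial2_def)
  have ne: "lam \<noteq> \<one>" using card cen by auto
  have lam: "lam \<in> carrier G" "\<And>x. x \<in> carrier G \<Longrightarrow> lam \<otimes> x = x \<otimes> lam"
    using cen by (auto simp: group_center_def)
  have sub: "subgroup {\<one>, lam} G" using derived_is_subgroup[of "carrier G"] der by simp
  have "lam \<otimes> lam \<in> {\<one>, lam}" using subgroup.m_closed[OF sub] by simp
  then have sq: "lam \<otimes> lam = \<one>" using ne lam(1) by auto
  have "x \<otimes> y = y \<otimes> x \<or> x \<otimes> y = y \<otimes> x \<otimes> lam" if xy: "x \<in> carrier G" "y \<in> carrier G" for x y
  proof -
    have "x \<otimes> y \<otimes> inv x \<otimes> inv y \<in> derived G (carrier G)"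
      unfolding derived_def using xy by (intro generate.incl) blast
    then have c: "commutator G x y = \<one> \<or> commutator G x y = lam" using der by (auto simp: commutator_def)
    have "commutator G x y = x \<otimes> y \<otimes> inv (y \<otimes> x)"
      using xy by (simp add: commutator_def inv_mult_group m_assoc)
    then have "commutator G x y \<otimes> (y \<otimes> x) = x \<otimes> y" using xy by (simp add: m_assoc)
    then show ?thesis using c lam(2)[of "y \<otimes> x"] xy by (elim disjE) simp_all
  qed
  then show ?thesis
    by (intro class2_group.intro class2_group_axioms.intro is_group lam ne sq)
qed

section \<open>Commutation relations forced on a non-abelian representation of
  \<open>Y\<close>\<close>

locale Y_representation = class2_group R lam + gq: slim_gq 4 Q LQ
  for R (structure) and lam and Q :: "'p set" and LQ +
  fixes \<phi> :: "'p spoint \<Rightarrow> 'a"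
  assumes phi_inv: "p \<in> Y_points Q \<Longrightarrow> \<phi> p \<in> involutions R"
    and phi_line: "{x, y, z} \<in> LQ \<Longrightarrow> distinct [x, y, z] \<Longrightarrow> F \<in> {Pt, Bar, BarBar} \<Longrightarrow>
      \<phi> (F x) \<otimes> \<phi> (F y) = \<phi> (F z)"
    and phi_fibre: "x \<in> Q \<Longrightarrow> \<phi> (Pt x) \<otimes> \<phi> (Bar x) = \<phi> (BarBar x)"
    and noncommuting: "\<exists>p\<in>Y_points Q. \<exists>q\<in>Y_points Q. \<not> com (\<phi> p) (\<phi> q)"
begin

lemma phi_involution:
  "x \<in> Q \<Longrightarrow> \<phi> (Pt x) \<in> involutions R" "x \<in> Q \<Longrightarrow> \<phi> (Bar x) \<in> involutions R"
  "x \<in> Q \<Longrightarrow> \<phi> (BarBar x) \<in> involutions R"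
  by (auto intro!: phi_inv simp: Y_points_def)

lemma phi_closed [simp]:
  "x \<in> Q \<Longrightarrow> \<phi> (Pt x) \<in> carrier R" "x \<in> Q \<Longrightarrow> \<phi> (Bar x) \<in> carrier R"
  "x \<in> Q \<Longrightarrow> \<phi> (BarBar x) \<in> carrier R"
  using phi_involution by (auto simp: involutions_def)

lemma line_Q: "{x, y, z} \<in> LQ \<Longrightarrow> x \<in> Q \<and> y \<in> Q \<and> z \<in> Q"
  using gq.line_subset by fastforce

text \<open>Collinear points commute because their product does not depend on the order; for far
  points \<open>grid\<close> supplies a Mermin square inside one copy of \<open>Q\<close>.\<close>

lemma phi_com_same:
  assumes F: "F \<in> {Pt, Bar, BarBar}" and x: "x \<in> Q" "y \<in> Q"
  shows "com (\<phi> (F x)) (\<phi> (F y))"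
proof -
  have cl: "\<phi> (F z) \<in> carrier R" if "z \<in> Q" for z using F that phi_closed by auto
  consider "x = y" | "collin LQ x y" | "gq.far x y" using x by (auto simp: gq.far_def)
  then show ?thesis
  proof cases
    case 1
    then show ?thesis by (simp add: com_refl)
  next
    case 2
    obtain z where z: "{x, y, z} \<in> LQ" "z \<noteq> x" "z \<noteq> y" using gq.obtain_third[OF 2] by metis
    have "x \<noteq> y" using 2 by (auto simp: collin_def)
    moreover have "{y, x, z} \<in> LQ" using z(1) by (simp add: insert_commute)
    ultimately show ?thesis using phi_line[of x y z F] phi_line[of y x z F] z F by (auto simp: com_def)
  next
    case 3
    obtain u v p q r s n where g: "{u, x, p} \<in> LQ" "{y, v, q} \<in> LQ" "{u, y, r} \<in> LQ" "{x, v, s} \<in> LQ"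
      "{p, q, n} \<in> LQ" "{r, s, n} \<in> LQ" "distinct [u, x, p]" "distinct [y, v, q]" "distinct [u, y, r]"
      "distinct [x, v, s]" "distinct [p, q, n]" "distinct [r, s, n]"
      by (rule gq.grid[OF 3]) simp
    have "u \<in> Q" "v \<in> Q" using line_Q[OF g(1)] line_Q[OF g(2)] by auto
    moreover have "(\<phi> (F u) \<otimes> \<phi> (F x)) \<otimes> (\<phi> (F y) \<otimes> \<phi> (F v)) = (\<phi> (F u) \<otimes> \<phi> (F y)) \<otimes> (\<phi> (F x) \<otimes> \<phi> (F v))"
      using phi_line[OF g(1,7) F] phi_line[OF g(2,8) F] phi_line[OF g(3,9) F] phi_line[OF g(4,10) F]
        phi_line[OF g(5,11) F] phi_line[OF g(6,12) F] by simp
    ultimately show ?thesis using grid_com cl x by blast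
  qed
qed

text \<open>Here the Mermin square consists of the three copies of the line
  \<open>{y, x, z}\<close>, crossed by the three fibres over its points; both products equal \<phi>
  of \<open>BarBar z\<close>.\<close>

lemma phi_com_near:
  assumes x: "x \<in> Q" "y \<in> Q" and far: "\<not> gq.far x y"
  shows "com (\<phi> (Pt x)) (\<phi> (Bar y))"
proof (cases "x = y")
  case True
  then show ?thesis
    using involution_products(1)[OF phi_involution(1,2)[OF x(1)] phi_fibre[OF x(1)] phi_involution(3)[OF x(1)]]
      phi_fibre[OF x(1)] by (simp add: com_def)
next
  case False
  then have "collin LQ y x" using far x by (auto simp: gq.far_def collin_sym)
  then obtain z where z: "{y, x, z} \<in> LQ" "z \<noteq> y" "z \<noteq> x" using gq.obtain_third by metis
  have d: "distinct [y, x, z]" using z False by auto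
  have zQ: "z \<in> Q" using line_Q[OF z(1)] by blast
  have "(\<phi> (Pt y) \<otimes> \<phi> (Pt x)) \<otimes> (\<phi> (Bar y) \<otimes> \<phi> (Bar x)) = (\<phi> (Pt y) \<otimes> \<phi> (Bar y)) \<otimes> (\<phi> (Pt x) \<otimes> \<phi> (Bar x))"
    using phi_line[OF z(1) d, of Pt] phi_line[OF z(1) d, of Bar] phi_line[OF z(1) d, of BarBar]
      phi_fibre x zQ by simp
  then show ?thesis using grid_com x phi_closed by blast
qed

text \<open>If \<open>c\<close> and \<open>d\<close> are collinear and far from \<open>a\<close>,
  the third point \<open>e\<close> of their line is near \<open>a\<close>, so its image commutes
  with that of \<open>a\<close>. By parity the images of \<open>c\<close> and \<open>d\<close>
  behave alike, and \<open>far_connected\<close> spreads this to all points far from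
  \<open>a\<close>.\<close>

lemma phi_com_const:
  assumes "gq.far x y" "gq.far x' y'"
  shows "com (\<phi> (Pt x)) (\<phi> (Bar y)) \<longleftrightarrow> com (\<phi> (Pt x')) (\<phi> (Bar y'))"
proof -
  have snd: "com (\<phi> (Pt a)) (\<phi> (Bar b)) \<longleftrightarrow> com (\<phi> (Pt a)) (\<phi> (Bar b'))"
    if ab: "gq.far a b" "gq.far a b'" for a b b'
  proof (rule gq.far_connected[OF _ ab])
    fix c d assume cd: "gq.far a c" "gq.far a d" "collin LQ c d"
    obtain e where e: "{c, d, e} \<in> LQ" "e \<noteq> c" "e \<noteq> d" using gq.obtain_third[OF cd(3)] by metis
    have Q: "a \<in> Q" "c \<in> Q" "d \<in> Q" "e \<in> Q" using ab line_Q[OF e(1)] by (auto simp: gq.far_def)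
    have "a \<notin> {c, d, e}" using cd gq.collin_line[OF e(1), of a c] e by (auto simp: gq.far_def)
    then have "collin LQ a e" using gq.projection[OF Q(1) e(1)] cd by (auto simp: gq.far_def)
    then have "com (\<phi> (Pt a)) (\<phi> (Bar e))" using phi_com_near Q by (auto simp: gq.far_def)
    moreover have "\<phi> (Bar c) \<otimes> \<phi> (Bar d) = \<phi> (Bar e)"
      using phi_line[OF e(1), of Bar] e cd(3) by (auto simp: collin_def)
    ultimately show "com (\<phi> (Pt a)) (\<phi> (Bar c)) \<longleftrightarrow> com (\<phi> (Pt a)) (\<phi> (Bar d))"
      using com_mult_right[of "\<phi> (Bar c)" "\<phi> (Bar d)" "\<phi> (Pt a)"] Q by simp
  qed simp
  have fst: "com (\<phi> (Pt b)) (\<phi> (Bar a)) \<longleftrightarrow> com (\<phi> (Pt b')) (\<phi> (Bar a))"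
    if ab: "gq.far a b" "gq.far a b'" for a b b'
  proof (rule gq.far_connected[OF _ ab])
    fix c d assume cd: "gq.far a c" "gq.far a d" "collin LQ c d"
    obtain e where e: "{c, d, e} \<in> LQ" "e \<noteq> c" "e \<noteq> d" using gq.obtain_third[OF cd(3)] by metis
    have Q: "a \<in> Q" "c \<in> Q" "d \<in> Q" "e \<in> Q" using ab line_Q[OF e(1)] by (auto simp: gq.far_def)
    have "a \<notin> {c, d, e}" using cd gq.collin_line[OF e(1), of a c] e by (auto simp: gq.far_def)
    then have "collin LQ a e" using gq.projection[OF Q(1) e(1)] cd by (auto simp: gq.far_def)
    then have "com (\<phi> (Pt e)) (\<phi> (Bar a))" using phi_com_near Q by (auto simp: gq.far_def collin_sym)
    moreover have "\<phi> (Pt c) \<otimes> \<phi> (Pt d) = \<phi> (Pt e)"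
      using phi_line[OF e(1), of Pt] e cd(3) by (auto simp: collin_def)
    ultimately show "com (\<phi> (Pt c)) (\<phi> (Bar a)) \<longleftrightarrow> com (\<phi> (Pt d)) (\<phi> (Bar a))"
      using com_mult_left[of "\<phi> (Pt c)" "\<phi> (Pt d)" "\<phi> (Bar a)"] Q by simp
  qed simp
  \<comment> \<open>Both coordinates are changed through a point \<open>w\<close> far from
    \<open>x\<close> and \<open>x'\<close>: from \<open>(x, y)\<close> to \<open>(x, w)\<close>,
    then to \<open>(x', w)\<close> and \<open>(x', y')\<close>.\<close>
  have "x \<in> Q" "x' \<in> Q" using assms by (auto simp: gq.far_def)
  then obtain w where w: "gq.far x w" "gq.far x' w" by (rule gq.exists_far_both) simp
  then show ?thesis
    using snd[OF assms(1) w(1)] snd[OF w(2) assms(2)] fst[of w x x'] gq.far_sym by blast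
qed

text \<open>By \<open>phi_com_const\<close> far pairs all commute or all fail to commute. In the
  first case the \<open>Pt\<close> and \<open>Bar\<close> images would commute throughout, and with
  them their products, the \<open>BarBar\<close> images.\<close>

lemma phi_com_iff:
  assumes x: "x \<in> Q" "y \<in> Q"
  shows "com (\<phi> (Pt x)) (\<phi> (Bar y)) \<longleftrightarrow> \<not> gq.far x y"
proof -
  have "\<exists>a b. gq.far a b \<and> \<not> com (\<phi> (Pt a)) (\<phi> (Bar b))"
  proof (rule ccontr)
    assume "\<not> ?thesis"
    then have PB: "com (\<phi> (Pt a)) (\<phi> (Bar b))" if "a \<in> Q" "b \<in> Q" for a b
      using phi_com_near that by blast
    have BP: "com (\<phi> (Bar b)) (\<phi> (Pt a))" if "a \<in> Q" "b \<in> Q" for a b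
      using PB[OF that] by (simp add: com_sym)
    have PP: "com (\<phi> (Pt a)) (\<phi> (Pt b))" "com (\<phi> (Bar a)) (\<phi> (Bar b))" if "a \<in> Q" "b \<in> Q" for a b
      using phi_com_same[of Pt] phi_com_same[of Bar] that by auto
    have 1: "com (\<phi> p) (\<phi> (Pt b))" "com (\<phi> p) (\<phi> (Bar b))" if p: "p \<in> Y_points Q" and b: "b \<in> Q" for p b
    proof -
      consider a where "p = Pt a" "a \<in> Q" | a where "p = Bar a" "a \<in> Q" | a where "p = BarBar a" "a \<in> Q"
        using p by (auto simp: Y_points_def)
      then have "com (\<phi> p) (\<phi> (Pt b)) \<and> com (\<phi> p) (\<phi> (Bar b))"
      proof cases
        case (3 a)
        then show ?thesis using b PB BP PP by (simp add: phi_fibre[symmetric] com_mult_left)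
      qed (use PB BP PP b in simp_all)
      then show "com (\<phi> p) (\<phi> (Pt b))" "com (\<phi> p) (\<phi> (Bar b))" by auto
    qed
    have "com (\<phi> p) (\<phi> q)" if p: "p \<in> Y_points Q" and q: "q \<in> Y_points Q" for p q
    proof -
      have pc: "\<phi> p \<in> carrier R" using phi_inv[OF p] by (simp add: involutions_def)
      consider b where "q = Pt b" "b \<in> Q" | b where "q = Bar b" "b \<in> Q" | b where "q = BarBar b" "b \<in> Q"
        using q by (auto simp: Y_points_def)
      then show ?thesis
      proof cases
        case (3 b)
        then show ?thesis using pc 1[OF p] by (simp add: phi_fibre[symmetric] com_mult_right)
      qed (use 1[OF p] in simp_all)
    qed
    then show False using noncommuting by blast
  qed
  then show ?thesis using phi_com_const phi_com_near x by blast
qed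

end

section \<open>Images under \<psi>: involutions, and injectivity\<close>

locale psi_setting = Y_representation R lam Q LQ \<phi>
  for R (structure) and lam and Q :: "'p set" and LQ and \<phi> +
  fixes S :: "'p set set" and \<theta> :: "'p set \<Rightarrow> 'p set \<Rightarrow> 3" and \<epsilon> :: "'p \<Rightarrow> 3"
    and \<delta> :: "'p \<Rightarrow> 'a" and d :: "'p \<Rightarrow> 'p \<Rightarrow> 3 \<Rightarrow> 'a" and M N :: "'a set"
  assumes S_line: "l \<in> S \<Longrightarrow> l \<in> LQ"
    and S_unique: "l \<in> S \<Longrightarrow> m \<in> S \<Longrightarrow> x \<in> l \<Longrightarrow> x \<in> m \<Longrightarrow> l = m"
    and S_cover: "x \<in> Q \<Longrightarrow> \<exists>l\<in>S. x \<in> l"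
    and eps_bij: "l \<in> S \<Longrightarrow> bij_betw \<epsilon> l UNIV"
    and collin_iff_theta: "l \<in> S \<Longrightarrow> m \<in> S \<Longrightarrow> l \<noteq> m \<Longrightarrow> x \<in> l \<Longrightarrow> y \<in> m \<Longrightarrow>
      collin LQ x y \<longleftrightarrow> \<epsilon> y = \<epsilon> x + \<theta> l m"
    and d_eq: "l \<in> S \<Longrightarrow> a \<in> l \<Longrightarrow> b \<in> l \<Longrightarrow> a \<noteq> b \<Longrightarrow> u \<in> l \<Longrightarrow> d a b (\<epsilon> u) = \<delta> u"
    and M: "subgroup M R" "p \<in> Y_points Q \<Longrightarrow> \<phi> p \<in> M" "generate R (\<phi> ` Y_points Q) = M"
    and N: "subgroup N R" "generate R (\<delta> ` Q) = N"
    and MN: "M <#> N = carrier R" "M \<inter> N = {\<one>, lam}" "g \<in> M \<Longrightarrow> h \<in> N \<Longrightarrow> com g h"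
    and delta_inv: "x \<in> Q \<Longrightarrow> \<delta> x \<in> involutions R" and delta_inj: "inj_on \<delta> Q"
    and delta_far: "gq.far x y \<Longrightarrow> \<not> com (\<delta> x) (\<delta> y)"
    and delta_S: "{x, y, z} \<in> LQ \<Longrightarrow> distinct [x, y, z] \<Longrightarrow> {x, y, z} \<in> S \<Longrightarrow> \<delta> z = \<delta> x \<otimes> \<delta> y"
    and delta_not_S: "{x, y, z} \<in> LQ \<Longrightarrow> distinct [x, y, z] \<Longrightarrow> {x, y, z} \<notin> S \<Longrightarrow>
      \<delta> z = \<delta> x \<otimes> \<delta> y \<otimes> lam"
begin

lemma delta_closed [simp]: "x \<in> Q \<Longrightarrow> \<delta> x \<in> carrier R"
  using delta_inv by (simp add: involutions_def)

lemma delta_N: "x \<in> Q \<Longrightarrow> \<delta> x \<in> N"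
  using N(2) by (metis generate.incl imageI)

lemma delta_com_phi: "p \<in> Y_points Q \<Longrightarrow> x \<in> Q \<Longrightarrow> com (\<delta> x) (\<phi> p)"
  using MN(3)[OF M(2) delta_N] by (simp add: com_sym)

lemma delta_com: "x \<in> Q \<Longrightarrow> y \<in> Q \<Longrightarrow> com (\<delta> x) (\<phi> (Pt y))" "x \<in> Q \<Longrightarrow> y \<in> Q \<Longrightarrow> com (\<delta> x) (\<phi> (Bar y))"
  by (auto intro!: delta_com_phi simp: Y_points_def)

lemma S_subset: "l \<in> S \<Longrightarrow> x \<in> l \<Longrightarrow> x \<in> Q"
  using S_line gq.line_subset by blast

lemma S_near: "l \<in> S \<Longrightarrow> x \<in> l \<Longrightarrow> y \<in> l \<Longrightarrow> \<not> gq.far x y"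
  using gq.collin_line[OF S_line] by (auto simp: gq.far_def)

lemma eps_obtain:
  assumes "l \<in> S"
  obtains u where "u \<in> l" "\<epsilon> u = i"
  using eps_bij[OF assms] unfolding bij_betw_def by (metis UNIV_I imageE)

abbreviation "\<psi> \<equiv> psi R \<phi> d"

lemma psi_Tri:
  assumes l: "l \<in> S" "a \<in> l" "b \<in> l" "a \<noteq> b"
  obtains u where "u \<in> l" "u \<in> Q" "\<epsilon> u = i" "\<psi> (Tri a b i) = \<phi> (Pt b) \<otimes> \<phi> (Bar a) \<otimes> \<delta> u"
proof -
  obtain u where "u \<in> l" "\<epsilon> u = i" using eps_obtain[OF l(1)] .
  then show ?thesis using that[of u] d_eq[OF l, of u] S_subset[OF l(1)] by auto
qed

lemma S_points_cases:
  assumes "p \<in> S_points Q S"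
  obtains x where "p = Pt x" "x \<in> Q" | x where "p = Bar x" "x \<in> Q" | x where "p = BarBar x" "x \<in> Q"
    | a b i l where "p = Tri a b i" "l \<in> S" "a \<in> l" "b \<in> l" "a \<noteq> b"
  using assms by (auto simp: S_points_def Y_points_def)

text \<open>An element of \<open>M \<inter> N\<close> is the identity or \<open>lam\<close>, hence
  central, but a value of \<delta> fails to commute with the value at any far point.\<close>

lemma delta_not_M: "x \<in> Q \<Longrightarrow> \<delta> x \<notin> M"
proof
  assume x: "x \<in> Q" "\<delta> x \<in> M"
  then have "\<delta> x \<in> {\<one>, lam}" using MN(2) delta_N by blast
  moreover have "\<delta> x \<noteq> \<one>" using delta_inv[OF x(1)] by (simp add: involutions_def)
  ultimately have e: "\<delta> x = lam" by blast
  obtain y where y: "gq.far x y" by (rule gq.exists_far_both[OF x(1) x(1)]) simp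
  then have "y \<in> Q" by (simp add: gq.far_def)
  then show False using delta_far[OF y] com_lam[OF delta_closed] e by simp
qed

lemma psi_involution: "\<psi> \<in> S_points Q S \<rightarrow> involutions R"
proof
  fix p assume "p \<in> S_points Q S"
  then show "\<psi> p \<in> involutions R"
  proof (cases rule: S_points_cases)
    case (4 a b i l)
    obtain u where u: "u \<in> l" "u \<in> Q" "\<psi> (Tri a b i) = \<phi> (Pt b) \<otimes> \<phi> (Bar a) \<otimes> \<delta> u"
      using psi_Tri[OF 4(2-5)] by metis
    have Q: "a \<in> Q" "b \<in> Q" using S_subset 4 by blast+
    have c: "com (\<phi> (Bar a)) (\<phi> (Pt b))"
      using phi_com_iff[of b a] S_near[OF 4(2), of b a] Q 4 by (simp add: com_sym)
    have sq: "\<phi> (Pt b) \<otimes> \<phi> (Pt b) = \<one>" "\<phi> (Bar a) \<otimes> \<phi> (Bar a) = \<one>" "\<delta> u \<otimes> \<delta> u = \<one>"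
      using phi_involution Q delta_inv u by (auto simp: involutions_def)
    have "\<psi> p \<otimes> \<psi> p = \<one>"
      using mult_triples(1)[of "\<phi> (Pt b)" "\<phi> (Bar a)" "\<delta> u" "\<phi> (Pt b)" "\<phi> (Bar a)" "\<delta> u"]
        c delta_com u Q sq 4(1) by simp
    \<comment> \<open>Otherwise \<open>\<delta> u\<close> would be the inverse of an element of
      \<open>M\<close>.\<close>
    moreover have "\<psi> p \<noteq> \<one>"
    proof
      assume "\<psi> p = \<one>"
      then have "inv (\<phi> (Pt b) \<otimes> \<phi> (Bar a)) = \<delta> u"
        using u Q 4(1) inv_equality[of "\<delta> u" "\<phi> (Pt b) \<otimes> \<phi> (Bar a)"]
        by (metis inv_comm delta_closed m_closed phi_closed(1,2))
      moreover have "\<phi> (Pt b) \<in> M" "\<phi> (Bar a) \<in> M" using M(2) Q by (auto simp: Y_points_def)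
      ultimately have "\<delta> u \<in> M" using M(1) by (metis subgroup.m_closed subgroup.m_inv_closed)
      then show False using delta_not_M u by blast
    qed
    ultimately show ?thesis using u Q 4(1) by (simp add: involutions_def)
  qed (use phi_involution in simp_all)
qed

text \<open>The sets of points \<open>z\<close> for which the image of a point fails to commute with \<open>\<phi> (Pt z)\<close> and
  with \<open>\<phi> (Bar z)\<close> determine its two underlying points in \<open>Q\<close>; \<open>\<delta>\<close> then separates the indices of
  triples.\<close>

fun barred :: "'p spoint \<Rightarrow> 'p option" where
  "barred (Pt x) = None" | "barred (Bar x) = Some x" | "barred (BarBar x) = Some x"
| "barred (Tri a b i) = Some a"

fun unbarred :: "'p spoint \<Rightarrow> 'p option" where
  "unbarred (Pt x) = Some x" | "unbarred (Bar x) = None" | "unbarred (BarBar x) = Some x"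
| "unbarred (Tri a b i) = Some b"

text \<open>Values of \<delta> commute with \<open>M\<close>, and each copy of \<open>Q\<close> has
  commuting images. So \<open>\<phi> (Bar z)\<close> detects only a factor from \<open>Pt\<close>,
  and \<open>\<phi> (Pt z)\<close> only one from \<open>Bar\<close>.\<close>

lemma psi_com:
  assumes p: "p \<in> S_points Q S" and z: "z \<in> Q"
  shows "com (\<psi> p) (\<phi> (Bar z)) \<longleftrightarrow> (\<forall>x. unbarred p = Some x \<longrightarrow> \<not> gq.far x z)"
    and "com (\<psi> p) (\<phi> (Pt z)) \<longleftrightarrow> (\<forall>x. barred p = Some x \<longrightarrow> \<not> gq.far x z)"
proof -
  have PP: "com (\<phi> (Pt x)) (\<phi> (Pt z))" and BB: "com (\<phi> (Bar x)) (\<phi> (Bar z))"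
    and PB: "com (\<phi> (Pt x)) (\<phi> (Bar z)) \<longleftrightarrow> \<not> gq.far x z"
    and BP: "com (\<phi> (Bar x)) (\<phi> (Pt z)) \<longleftrightarrow> \<not> gq.far x z" if "x \<in> Q" for x
    using phi_com_same[of Pt x z] phi_com_same[of Bar x z] phi_com_iff that z
    by (auto simp: com_sym gq.far_sym)
  have "(com (\<psi> p) (\<phi> (Bar z)) \<longleftrightarrow> (\<forall>x. unbarred p = Some x \<longrightarrow> \<not> gq.far x z)) \<and>
    (com (\<psi> p) (\<phi> (Pt z)) \<longleftrightarrow> (\<forall>x. barred p = Some x \<longrightarrow> \<not> gq.far x z))"
    using p
  proof (cases rule: S_points_cases)
    case (3 x)
    then show ?thesis using PP BB PB BP z by (simp add: phi_fibre[symmetric] com_mult_left)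
  next
    case (4 a b i l)
    obtain u where u: "u \<in> l" "u \<in> Q" "\<psi> (Tri a b i) = \<phi> (Pt b) \<otimes> \<phi> (Bar a) \<otimes> \<delta> u"
      using psi_Tri[OF 4(2-5)] by metis
    have Q: "a \<in> Q" "b \<in> Q" using S_subset 4 by blast+
    have "\<psi> p = \<phi> (Pt b) \<otimes> \<phi> (Bar a) \<otimes> \<delta> u" using u 4(1) by simp
    then show ?thesis
      using Q u(2) z PP BB PB BP delta_com 4(1) by (simp del: psi.simps add: com_mult_left)
  qed (use PP BB PB BP in simp_all)
  then show "com (\<psi> p) (\<phi> (Bar z)) \<longleftrightarrow> (\<forall>x. unbarred p = Some x \<longrightarrow> \<not> gq.far x z)"
    "com (\<psi> p) (\<phi> (Pt z)) \<longleftrightarrow> (\<forall>x. barred p = Some x \<longrightarrow> \<not> gq.far x z)" by auto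
qed

text \<open>\<open>None\<close> makes the condition true for every \<open>z\<close>; it differs from
  every \<open>Some x\<close> because each point has a far point.\<close>

lemma far_signature:
  assumes o: "set_option o1 \<subseteq> Q" "set_option o2 \<subseteq> Q"
    and eq: "\<And>z. z \<in> Q \<Longrightarrow> (\<forall>x. o1 = Some x \<longrightarrow> \<not> gq.far x z) = (\<forall>x. o2 = Some x \<longrightarrow> \<not> gq.far x z)"
  shows "o1 = o2"
proof -
  have ex: "\<exists>z\<in>Q. gq.far x z" if x: "x \<in> Q" for x
  proof -
    obtain z where "gq.far x z" by (rule gq.exists_far_both[OF x x]) simp
    then show ?thesis by (auto simp: gq.far_def)
  qed
  show ?thesis
  proof (cases o1; cases o2)
    fix x y assume o': "o1 = Some x" "o2 = Some y"
    show ?thesis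
    proof (rule ccontr)
      assume "o1 \<noteq> o2"
      then have "\<exists>z\<in>Q. gq.far x z \<noteq> gq.far y z" using gq.far_separates[of x y] o o' by auto
      then show False using eq o' by auto
    qed
  qed (use ex eq o in force)+
qed

lemma psi_inj: "inj_on \<psi> (S_points Q S)"
proof (rule inj_onI)
  fix p q assume p: "p \<in> S_points Q S" and q: "q \<in> S_points Q S" and eq: "\<psi> p = \<psi> q"
  have sub: "set_option (barred p) \<subseteq> Q \<and> set_option (unbarred p) \<subseteq> Q" if "p \<in> S_points Q S" for p
    using that by (cases rule: S_points_cases) (auto intro: S_subset)
  have b: "barred p = barred q"
    using far_signature[of "barred p" "barred q"] sub p q psi_com(2)[OF p] psi_com(2)[OF q] eq by simp
  have ub: "unbarred p = unbarred q"
    using far_signature[of "unbarred p" "unbarred q"] sub p q psi_com(1)[OF p] psi_com(1)[OF q] eq by simp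
  show "p = q"
  proof (cases "\<exists>a b i. p = Tri a b i")
    case False
    \<comment> \<open>The pattern of the two options gives the type: when both are
      \<open>Some\<close>, they agree for a \<open>BarBar\<close> point and differ for a
      triple.\<close>
    then show ?thesis using b ub p q
      by (cases p; cases q) (auto simp: S_points_def Y_points_def)
  next
    case True
    then obtain a b i where pt: "p = Tri a b i" by blast
    have ab: "a \<noteq> b" using p pt by (auto simp: S_points_def Y_points_def)
    obtain j where qt: "q = Tri a b j" using b ub pt ab by (cases q) auto
    obtain l where l: "l \<in> S" "a \<in> l" "b \<in> l" using p pt by (auto simp: S_points_def Y_points_def)
    obtain u where u: "u \<in> l" "u \<in> Q" "\<epsilon> u = i" "\<psi> (Tri a b i) = \<phi> (Pt b) \<otimes> \<phi> (Bar a) \<otimes> \<delta> u"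
      using psi_Tri[OF l ab] .
    obtain v where v: "v \<in> l" "v \<in> Q" "\<epsilon> v = j" "\<psi> (Tri a b j) = \<phi> (Pt b) \<otimes> \<phi> (Bar a) \<otimes> \<delta> v"
      using psi_Tri[OF l ab] .
    have Q: "a \<in> Q" "b \<in> Q" using S_subset l by blast+
    have "\<phi> (Pt b) \<otimes> \<phi> (Bar a) \<otimes> \<delta> u = \<phi> (Pt b) \<otimes> \<phi> (Bar a) \<otimes> \<delta> v"
      using eq u(4) v(4) pt qt by simp
    then have "\<delta> u = \<delta> v" using Q u(2) v(2) by simp
    then have "u = v" using delta_inj u v by (auto dest: inj_onD)
    then show ?thesis using pt qt u v by simp
  qed
qed

lemma Y_in_S_points: "Y_points Q \<subseteq> S_points Q S" by (simp add: S_points_def)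

lemma Pt_in: "x \<in> Q \<Longrightarrow> Pt x \<in> S_points Q S" "x \<in> Q \<Longrightarrow> Bar x \<in> S_points Q S"
  "x \<in> Q \<Longrightarrow> BarBar x \<in> S_points Q S"
  by (auto simp: S_points_def Y_points_def)

lemma Tri_in: "l \<in> S \<Longrightarrow> a \<in> l \<Longrightarrow> b \<in> l \<Longrightarrow> a \<noteq> b \<Longrightarrow> Tri a b i \<in> S_points Q S"
  by (auto simp: S_points_def)

section \<open>The product relations on the lines, and generation\<close>

lemma spread_line_facts:
  assumes l: "{a, b, c} \<in> S" "distinct [a, b, c]"
  shows "a \<in> Q" "b \<in> Q" "c \<in> Q"
    and "F \<in> {Pt, Bar, BarBar} \<Longrightarrow> \<phi> (F a) \<otimes> \<phi> (F b) = \<phi> (F c)"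
    and "F \<in> {Pt, Bar, BarBar} \<Longrightarrow> \<phi> (F b) \<otimes> \<phi> (F c) = \<phi> (F a)"
    and "F \<in> {Pt, Bar, BarBar} \<Longrightarrow> \<phi> (F c) \<otimes> \<phi> (F b) = \<phi> (F a)"
    and "x \<in> {a, b, c} \<Longrightarrow> y \<in> {a, b, c} \<Longrightarrow> com (\<phi> (Bar x)) (\<phi> (Pt y))"
proof -
  have LQ: "{a, b, c} \<in> LQ" "{b, c, a} \<in> LQ" "{c, b, a} \<in> LQ" using S_line[OF l(1)] by (simp_all add: insert_commute)
  show Q: "a \<in> Q" "b \<in> Q" "c \<in> Q" using line_Q[OF LQ(1)] by auto
  show "\<phi> (F a) \<otimes> \<phi> (F b) = \<phi> (F c)" "\<phi> (F b) \<otimes> \<phi> (F c) = \<phi> (F a)" "\<phi> (F c) \<otimes> \<phi> (F b) = \<phi> (F a)"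
    if "F \<in> {Pt, Bar, BarBar}"
    using phi_line[OF LQ(1) _ that] phi_line[OF LQ(2) _ that] phi_line[OF LQ(3) _ that] l(2) by auto
  show "com (\<phi> (Bar x)) (\<phi> (Pt y))" if x: "x \<in> {a, b, c}" "y \<in> {a, b, c}"
  proof -
    have "x \<in> Q" "y \<in> Q" using x Q by auto
    then show ?thesis using phi_com_iff[of y x] S_near[OF l(1) x(2,1)] by (simp add: com_sym)
  qed
qed

text \<open>The value of \<open>d\<close> depends only on the spread line and the index, so both
  triples carry the same \<open>\<delta> u\<close> and only a relation for \<phi> remains.\<close>

lemma psi_line_L5:
  assumes l: "{a, b, c} \<in> S" "distinct [a, b, c]"
  shows "\<psi> (Pt a) \<otimes> \<psi> (Tri a b i) = \<psi> (Tri a c i)"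
proof -
  note f = spread_line_facts[OF l]
  obtain u where u: "u \<in> {a, b, c}" "\<epsilon> u = i" using eps_obtain[OF l(1)] .
  have uQ: "u \<in> Q" using S_subset[OF l(1) u(1)] .
  have "d a b i = \<delta> u" "d a c i = \<delta> u"
    using d_eq[OF l(1), of a b u] d_eq[OF l(1), of a c u] u l(2) by auto
  then show ?thesis using f(1-3) f(4)[of Pt, symmetric] uQ by (simp add: m_assoc)
qed

lemma psi_line_L6:
  assumes l: "{a, b, c} \<in> S" "distinct [a, b, c]"
  shows "\<psi> (Bar a) \<otimes> \<psi> (Tri b a i) = \<psi> (Tri c a i)"
proof -
  note f = spread_line_facts[OF l]
  obtain u where u: "u \<in> {a, b, c}" "\<epsilon> u = i" using eps_obtain[OF l(1)] .
  have uQ: "u \<in> Q" using S_subset[OF l(1) u(1)] .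
  have e: "d b a i = \<delta> u" "d c a i = \<delta> u"
    using d_eq[OF l(1), of b a u] d_eq[OF l(1), of c a u] u l(2) by auto
  have "\<phi> (Bar a) \<otimes> \<phi> (Pt a) = \<phi> (Pt a) \<otimes> \<phi> (Bar a)" using f(7)[of a a] by (simp add: com_def)
  then have "\<phi> (Bar a) \<otimes> (\<phi> (Pt a) \<otimes> \<phi> (Bar b) \<otimes> \<delta> u) = \<phi> (Pt a) \<otimes> (\<phi> (Bar a) \<otimes> \<phi> (Bar b)) \<otimes> \<delta> u"
    using f(1-3) uQ by (metis m_assoc m_closed phi_closed(1,2) delta_closed)
  then show ?thesis using f(4)[of Bar] e by simp
qed

lemma psi_line_L7:
  assumes l: "{a, b, c} \<in> S" "distinct [a, b, c]"
  shows "\<psi> (Tri b c i) \<otimes> \<psi> (Tri c b i) = \<psi> (BarBar a)"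
proof -
  note f = spread_line_facts[OF l]
  obtain u where u: "u \<in> {a, b, c}" "\<epsilon> u = i" using eps_obtain[OF l(1)] .
  have uQ: "u \<in> Q" using S_subset[OF l(1) u(1)] .
  have e: "d b c i = \<delta> u" "d c b i = \<delta> u"
    using d_eq[OF l(1), of b c u] d_eq[OF l(1), of c b u] u l(2) by auto
  have sq: "\<delta> u \<otimes> \<delta> u = \<one>" using delta_inv[OF uQ] by (simp add: involutions_def)
  show ?thesis
    using mult_triples(1)[of "\<phi> (Pt c)" "\<phi> (Bar b)" "\<delta> u" "\<phi> (Pt b)" "\<phi> (Bar c)" "\<delta> u"]
      f(1-3) uQ delta_com f(7)[of b b] f(6)[of Pt] f(5)[of Bar] sq e phi_fibre by simp
qed

text \<open>Three different indices pick out all three points of the spread line, where \<delta> is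
  multiplicative without \<open>lam\<close>. No \<open>lam\<close> comes from \<phi> either, since
  \<open>a\<close> and \<open>c\<close> are collinear.\<close>

lemma psi_line_L8:
  assumes l: "{a, b, c} \<in> S" "distinct [a, b, c]" and ijk: "{i, j, k} = (UNIV :: 3 set)"
  shows "\<psi> (Tri a b i) \<otimes> \<psi> (Tri b c j) = \<psi> (Tri c a k)"
proof -
  note f = spread_line_facts[OF l]
  have dis: "distinct [i, j, k]"
  proof -
    have "card {i, j, k} = 3" by (simp add: ijk)
    then show ?thesis by (auto simp: card_insert_if split: if_splits)
  qed
  obtain u where u: "u \<in> {a, b, c}" "u \<in> Q" "\<epsilon> u = i" "\<psi> (Tri a b i) = \<phi> (Pt b) \<otimes> \<phi> (Bar a) \<otimes> \<delta> u"
    by (rule psi_Tri[OF l(1), of a b i]) (use l(2) in auto)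
  obtain v where v: "v \<in> {a, b, c}" "v \<in> Q" "\<epsilon> v = j" "\<psi> (Tri b c j) = \<phi> (Pt c) \<otimes> \<phi> (Bar b) \<otimes> \<delta> v"
    by (rule psi_Tri[OF l(1), of b c j]) (use l(2) in auto)
  obtain w where w: "w \<in> {a, b, c}" "w \<in> Q" "\<epsilon> w = k" "\<psi> (Tri c a k) = \<phi> (Pt a) \<otimes> \<phi> (Bar c) \<otimes> \<delta> w"
    by (rule psi_Tri[OF l(1), of c a k]) (use l(2) in auto)
  have d3: "distinct [u, v, w]" using u v w dis by auto
  have eq: "{u, v, w} = {a, b, c}"
  proof (rule card_subset_eq)
    show "card {u, v, w} = card {a, b, c}" using d3 l(2) by simp
  qed (use u v w in auto)
  have dl: "\<delta> w = \<delta> u \<otimes> \<delta> v" using delta_S[OF _ d3] S_line[OF l(1)] l(1) unfolding eq by blast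
  show ?thesis unfolding u(4) v(4) w(4) dl
    using mult_triples(1)[of "\<phi> (Pt b)" "\<phi> (Bar a)" "\<delta> u" "\<phi> (Pt c)" "\<phi> (Bar b)" "\<delta> v"]
      f(1-3) u(2) v(2) delta_com f(7)[of a c] f(5)[of Pt] f(4)[of Bar] by simp
qed

lemma psi_line_L9:
  assumes abc: "{a, b, c} \<in> LQ" "distinct [a, b, c]" and uvw: "{u, v, w} \<in> LQ" "distinct [u, v, w]"
    and dis: "{a, b, c} \<inter> {u, v, w} = {}"
    and l: "l1 \<in> S" "l2 \<in> S" "l3 \<in> S" "a \<in> l1" "u \<in> l1" "b \<in> l2" "v \<in> l2" "c \<in> l3" "w \<in> l3"
    and jk: "j = i + \<theta> l1 l2" "k = i + \<theta> l1 l3"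
  shows "\<psi> (Tri a u i) \<otimes> \<psi> (Tri b v j) = \<psi> (Tri c w k)"
proof -
  have Q: "a \<in> Q" "b \<in> Q" "c \<in> Q" "u \<in> Q" "v \<in> Q" "w \<in> Q" using line_Q[OF abc(1)] line_Q[OF uvw(1)] by auto
  \<comment> \<open>A spread line with two points of \<open>{a, b, c}\<close> would be that line
    itself, which is disjoint from \<open>{u, v, w}\<close>. Hence the three spread lines are
    different.\<close>
  have not_both: False if "m \<in> S" "x \<in> m" "y \<in> m" "z \<in> m" "x \<in> {a, b, c}" "y \<in> {a, b, c}" "x \<noteq> y"
    "z \<in> {u, v, w}" for m x y z
    using gq.line_unique[OF S_line[OF that(1)] abc(1) that(2,3)] that dis by blast
  have ne: "l1 \<noteq> l2" "l1 \<noteq> l3" "l2 \<noteq> l3"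
    using not_both[of l1 a b u] not_both[of l1 a c u] not_both[of l2 b c v] l abc(2) by auto
  have col: "collin LQ a b" "collin LQ a c" "collin LQ b c"
    using gq.collin_line[OF abc(1)] abc(2) by auto
  have "\<epsilon> b = \<epsilon> a + \<theta> l1 l2" "\<epsilon> c = \<epsilon> a + \<theta> l1 l3" "\<epsilon> c = \<epsilon> b + \<theta> l2 l3"
    using collin_iff_theta l ne col by blast+
  \<comment> \<open>The line fixes \<open>j\<close> and \<open>k\<close> only relative to
    \<open>i\<close>. Additivity of \<theta>, read off from the collinear points \<open>a\<close>,
    \<open>b\<close>, \<open>c\<close>, relates \<open>k\<close> to \<open>j\<close> and so makes
    \<open>v'\<close> and \<open>w'\<close> collinear too.\<close>
  then have cocycle: "\<theta> l1 l3 = \<theta> l1 l2 + \<theta> l2 l3" by (simp add: add.assoc)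
  have au: "a \<noteq> u" "b \<noteq> v" "c \<noteq> w" using dis by auto
  obtain u' where u: "u' \<in> l1" "u' \<in> Q" "\<epsilon> u' = i" "\<psi> (Tri a u i) = \<phi> (Pt u) \<otimes> \<phi> (Bar a) \<otimes> \<delta> u'"
    using psi_Tri[OF l(1,4,5) au(1)] .
  obtain v' where v: "v' \<in> l2" "v' \<in> Q" "\<epsilon> v' = j" "\<psi> (Tri b v j) = \<phi> (Pt v) \<otimes> \<phi> (Bar b) \<otimes> \<delta> v'"
    using psi_Tri[OF l(2,6,7) au(2)] .
  obtain w' where w: "w' \<in> l3" "w' \<in> Q" "\<epsilon> w' = k" "\<psi> (Tri c w k) = \<phi> (Pt w) \<otimes> \<phi> (Bar c) \<otimes> \<delta> w'"
    using psi_Tri[OF l(3,8,9) au(3)] .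
  have "k = j + \<theta> l2 l3" using jk cocycle by (simp add: add.assoc)
  then have col': "collin LQ u' v'" "collin LQ u' w'" "collin LQ v' w'"
    using collin_iff_theta[OF l(1,2) ne(1) u(1) v(1)] collin_iff_theta[OF l(1,3) ne(2) u(1) w(1)]
      collin_iff_theta[OF l(2,3) ne(3) v(1) w(1)] u v w jk by auto
  have d3: "distinct [u', v', w']" using col' by (auto simp: collin_def)
  obtain z where z: "{u', v', z} \<in> LQ" "z \<noteq> u'" "z \<noteq> v'" using gq.obtain_third[OF col'(1)] by metis
  have "w' \<in> {u', v', z}"
    using gq.no_triangle[of w' u' v', OF _ _ z(1)] col' d3 by (auto simp: collin_sym)
  then have line: "{u', v', w'} \<in> LQ" using z d3 by auto
  have nS: "{u', v', w'} \<notin> S"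
    using S_unique[OF _ l(1), of "{u', v', w'}" u'] S_unique[OF _ l(2), of "{u', v', w'}" v'] ne u v by auto
  have dl: "\<delta> w' = \<delta> u' \<otimes> \<delta> v' \<otimes> lam" using delta_not_S[OF line d3 nS] .
  \<comment> \<open>The neighbour of \<open>a\<close> on \<open>{u, v, w}\<close> is
    \<open>u\<close>. This is the one non-commuting pair, and its \<open>lam\<close> meets the
    \<open>lam\<close> in \<open>dl\<close>.\<close>
  have "gq.far a v"
    using gq.far_on_line[OF uvw(1), of a u v] gq.collin_line[OF S_line[OF l(1)] l(4,5) au(1)] dis uvw(2) by auto
  then have nc: "\<not> com (\<phi> (Bar a)) (\<phi> (Pt v))" using phi_com_iff[of v a] Q by (simp add: com_sym gq.far_sym)
  show ?thesis unfolding u(4) v(4) w(4) dl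
    using mult_triples(2)[of "\<phi> (Pt u)" "\<phi> (Bar a)" "\<delta> u'" "\<phi> (Pt v)" "\<phi> (Bar b)" "\<delta> v'"]
      Q u(2) v(2) delta_com nc phi_line[OF uvw, of Pt] phi_line[OF abc, of Bar] by simp
qed

lemma psi_lines:
  assumes "l \<in> S_lines Q LQ S \<theta>"
  shows "\<exists>p q r. l = {p, q, r} \<and> {p, q, r} \<subseteq> S_points Q S \<and> \<psi> p \<otimes> \<psi> q = \<psi> r"
proof -
  have Y: "\<exists>p q r. F ` m = {p, q, r} \<and> {p, q, r} \<subseteq> S_points Q S \<and> \<psi> p \<otimes> \<psi> q = \<psi> r"
    if m: "m \<in> LQ" and F: "F \<in> {Pt, Bar, BarBar}" for m F
  proof -
    obtain x y z where xyz: "m = {x, y, z}" "x \<noteq> y" "y \<noteq> z" "x \<noteq> z"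
      using gq.card_line[OF m] by (auto simp: card_3_iff)
    have "x \<in> Q" "y \<in> Q" "z \<in> Q" using gq.line_subset[OF m] xyz by auto
    moreover have "\<phi> (F x) \<otimes> \<phi> (F y) = \<phi> (F z)" using phi_line[of x y z F] m F xyz by auto
    ultimately have "F ` m = {F x, F y, F z} \<and> {F x, F y, F z} \<subseteq> S_points Q S \<and> \<psi> (F x) \<otimes> \<psi> (F y) = \<psi> (F z)"
      using F Pt_in xyz(1) by auto
    then show ?thesis by blast
  qed
  show ?thesis
    using assms unfolding S_lines_def Y_lines_def
  proof (elim UnE CollectE exE conjE, goal_cases)
    case (1 m)
    then show ?thesis using Y[of m Pt] by simp
  next
    case (2 m)
    then show ?thesis using Y[of m Bar] by simp
  next
    case (3 m)
    then show ?thesis using Y[of m BarBar] by simp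
  next
    case (4 x)
    then have "{Pt x, Bar x, BarBar x} \<subseteq> S_points Q S \<and> \<psi> (Pt x) \<otimes> \<psi> (Bar x) = \<psi> (BarBar x)"
      using Pt_in phi_fibre by simp
    then show ?thesis using 4(1) by blast
  next
    case (5 a b c i)
    have "{Pt a, Tri a b i, Tri a c i} \<subseteq> S_points Q S"
      using Pt_in spread_line_facts(1-3)[OF 5(2,3)] Tri_in[OF 5(2)] 5(3) by auto
    then show ?thesis using psi_line_L5[OF 5(2,3)] 5(1) by blast
  next
    case (6 a b c i)
    have "{Bar a, Tri b a i, Tri c a i} \<subseteq> S_points Q S"
      using Pt_in spread_line_facts(1-3)[OF 6(2,3)] Tri_in[OF 6(2)] 6(3) by auto
    then show ?thesis using psi_line_L6[OF 6(2,3)] 6(1) by blast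
  next
    case (7 a b c i)
    have "{Tri b c i, Tri c b i, BarBar a} \<subseteq> S_points Q S"
      using Pt_in spread_line_facts(1-3)[OF 7(2,3)] Tri_in[OF 7(2)] 7(3) by auto
    moreover have "l = {Tri b c i, Tri c b i, BarBar a}" using 7(1) by (simp add: insert_commute)
    ultimately show ?thesis using psi_line_L7[OF 7(2,3)] by blast
  next
    case (8 a b c i j k)
    have "{Tri a b i, Tri b c j, Tri c a k} \<subseteq> S_points Q S"
      using Tri_in[OF 8(2)] 8(3) by auto
    then show ?thesis using psi_line_L8[OF 8(2-4)] 8(1) by blast
  next
    case (9 a b c u v w i j k)
    have thr: "x \<in> line_through LQ x y" "y \<in> line_through LQ x y" if xy: "collin LQ x y" for x y
    proof -
      obtain m where "m \<in> LQ" "x \<in> m" "y \<in> m" "x \<noteq> y" using xy by (auto simp: collin_def)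
      then show "x \<in> line_through LQ x y" "y \<in> line_through LQ x y"
        using line_through_eq[OF gq.pls] by metis+
    qed
    note t = thr[OF 9(7)] thr[OF 9(8)] thr[OF 9(9)]
    have ne: "a \<noteq> u" "b \<noteq> v" "c \<noteq> w" using 9(7-9) by (auto simp: collin_def)
    have "{Tri a u i, Tri b v j, Tri c w k} \<subseteq> S_points Q S"
      using Tri_in[OF 9(10) t(1,2) ne(1)] Tri_in[OF 9(11) t(3,4) ne(2)] Tri_in[OF 9(12) t(5,6) ne(3)]
      by simp
    then show ?thesis using psi_line_L9[OF 9(2-6) 9(10-12) t 9(13,14)] 9(1) by blast
  qed
qed

text \<open>The images of \<open>Y\<close> generate \<open>M\<close>. Cancelling the part in
  \<open>M\<close> from the image of a triple with index \<open>\<epsilon> u\<close> leaves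
  \<open>\<delta> u\<close>, so \<open>N\<close> is reached as well.\<close>

lemma psi_generates: "generate R (\<psi> ` S_points Q S) = carrier R"
proof -
  let ?H = "generate R (\<psi> ` S_points Q S)"
  have sub: "\<psi> ` S_points Q S \<subseteq> carrier R" using psi_involution by (auto simp: involutions_def)
  have H: "subgroup ?H R" using generate_is_subgroup[OF sub] .
  have inH: "\<psi> p \<in> ?H" if "p \<in> S_points Q S" for p using that by (auto intro: generate.incl)
  have "\<phi> p = \<psi> p" if "p \<in> Y_points Q" for p using that by (auto simp: Y_points_def)
  then have "\<phi> ` Y_points Q \<subseteq> ?H" using inH Y_in_S_points by auto
  then have MH: "M \<subseteq> ?H" using generate_subgroup_incl[OF _ H] M(3) by blast
  have "\<delta> u \<in> ?H" if uQ: "u \<in> Q" for u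
  proof -
    obtain l where l: "l \<in> S" "u \<in> l" using S_cover[OF uQ] by blast
    obtain a b where ab: "l = {u, a, b}" "a \<noteq> u" "b \<noteq> u" "a \<noteq> b"
      using card_3_others[OF gq.card_line[OF S_line[OF l(1)]] l(2)] .
    have Q: "a \<in> Q" "b \<in> Q" using S_subset[OF l(1)] ab by auto
    have "d a b (\<epsilon> u) = \<delta> u" using d_eq[OF l(1) _ _ ab(4) l(2)] ab(1) by simp
    then have e: "\<psi> (Tri a b (\<epsilon> u)) = \<phi> (Pt b) \<otimes> \<phi> (Bar a) \<otimes> \<delta> u" by simp
    have t: "\<psi> (Tri a b (\<epsilon> u)) \<in> ?H" by (intro inH Tri_in[OF l(1) _ _ ab(4)]) (auto simp: ab(1))
    have "\<phi> (Pt b) \<in> ?H" "\<phi> (Bar a) \<in> ?H" using MH M(2) Q by (auto simp: Y_points_def)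
    then have m: "inv (\<phi> (Pt b) \<otimes> \<phi> (Bar a)) \<in> ?H" using H by (simp add: subgroup.m_closed subgroup.m_inv_closed)
    have "\<delta> u = inv (\<phi> (Pt b) \<otimes> \<phi> (Bar a)) \<otimes> (\<phi> (Pt b) \<otimes> \<phi> (Bar a) \<otimes> \<delta> u)"
      using Q uQ by (metis delta_closed inv_closed l_inv l_one m_assoc m_closed phi_closed(1,2))
    then show ?thesis using subgroup.m_closed[OF H m t] e by simp
  qed
  then have "\<delta> ` Q \<subseteq> ?H" by blast
  then have "N \<subseteq> ?H" using generate_subgroup_incl[OF _ H] N(2) by blast
  then have "M <#> N \<subseteq> ?H" using MH subgroup.m_closed[OF H] by (auto simp: set_mult_def)
  then show ?thesis using MN(1) subgroup.subset[OF H] by blast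
qed

theorem psi_nonabelian_representation:
  "nonabelian_representation (S_points Q S) (S_lines Q LQ S \<theta>) R \<psi>"
proof -
  have "\<not> comm_group R"
  proof
    assume "comm_group R"
    then interpret comm_group R .
    obtain p q where pq: "p \<in> Y_points Q" "q \<in> Y_points Q" "\<not> com (\<phi> p) (\<phi> q)" using noncommuting by blast
    then have "\<phi> p \<in> carrier R" "\<phi> q \<in> carrier R" using phi_inv by (auto simp: involutions_def)
    then show False using pq m_comm by (auto simp: com_def)
  qed
  then show ?thesis
    unfolding nonabelian_representation_def
    using representationI[OF psi_involution psi_inj psi_lines psi_generates] by blast
qed

end

section \<open>Instantiating the abstract setting with the near hexagon and the groups\<close>

theorem theorem5p3:
  fixes P :: "'p set" and L :: "'p set set"
    and T1 T2 S :: "'p set set"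
    and Q Qb Qbb Lstar Rstar Mstar Q1 :: "'p set"
    and W :: "3 \<Rightarrow> 'p set"
    and \<theta> :: "'p set \<Rightarrow> 'p set \<Rightarrow> 3"
    and \<epsilon> :: "'p \<Rightarrow> 3"
    and R :: "('g, 'b) monoid_scheme"
    and lam :: 'g and M N :: "'g set"
    and \<phi> :: "'p spoint \<Rightarrow> 'g" and \<delta> :: "'p \<Rightarrow> 'g"
  assumes Delta: "slim_dense_near_hexagon P L" "card P = 243"
    and T1: "partition_on P T1" "\<forall>X\<in>T1. Q52_quad P L X"
    and T2: "partition_on P T2" "\<forall>X\<in>T2. Q52_quad P L X"
    and T1_T2: "\<forall>X\<in>T1. \<forall>X'\<in>T2. X \<inter> X' \<in> L"
    and Q: "Q \<in> T1" "Qb \<in> T1" "Q \<noteq> Qb"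
    and Qbb: "Qbb = reflect L Q ` Qb"
    and S: "S = {Q \<inter> X | X. X \<in> T2}"
    and Lstar: "Lstar \<in> S"
    and Rstar: "Rstar = quad_on T2 Lstar"
    and W: "bij_betw W UNIV
              {X. W2_subquadrangle L Rstar X \<and> Rstar \<inter> (Q \<union> Qb \<union> Qbb) \<subseteq> X}"
    and theta: "\<forall>L1\<in>S. \<forall>L2\<in>S. \<forall>i.
              (proj L Rstar \<circ> proj L (quad_on T2 L2) \<circ> proj L (quad_on T2 L1)) ` W i
                = W (i + \<theta> L1 L2)"
    and Q1: "Q1 \<in> T1 - {Q, Qb, Qbb}"
    and Mstar: "Mstar = Rstar \<inter> Q1"
    and eps: "\<epsilon> = eps L Lstar Mstar W"
    and R: "extraspecial_minus 9 R" "derived R (carrier R) = {\<one>\<^bsub>R\<^esub>, lam}"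
    and M: "subgroup M R" "extraspecial_plus 6 (R\<lparr>carrier := M\<rparr>)"
    and N: "subgroup N R" "extraspecial_minus 3 (R\<lparr>carrier := N\<rparr>)"
    and M_N: "M <#>\<^bsub>R\<^esub> N = carrier R" "\<forall>x\<in>M. \<forall>y\<in>N. commutator R x y = \<one>\<^bsub>R\<^esub>"
             "M \<inter> N = {\<one>\<^bsub>R\<^esub>, lam}"
    and phi: "nonabelian_representation (Y_points Q) (Y_lines Q (lines_in L Q))
                (R\<lparr>carrier := M\<rparr>) \<phi>"
    and delta: "\<delta> \<in> Q \<rightarrow> involutions (R\<lparr>carrier := N\<rparr>)" "inj_on \<delta> Q"
      "\<forall>x\<in>Q. \<forall>y\<in>Q. commutator R (\<delta> x) (\<delta> y) = \<one>\<^bsub>R\<^esub> \<longleftrightarrow> y = x \<or> collin L x y"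
      "\<forall>x\<in>Q. \<forall>y\<in>Q. collin L x y \<longrightarrow>
         \<delta> (third L x y) =
           (if line_through L x y \<in> S then \<delta> x \<otimes>\<^bsub>R\<^esub> \<delta> y else \<delta> x \<otimes>\<^bsub>R\<^esub> \<delta> y \<otimes>\<^bsub>R\<^esub> lam)"
      "generate R (\<delta> ` Q) = N"
  shows "nonabelian_representation (S_points Q S) (S_lines Q (lines_in L Q) S \<theta>)
           R (psi R \<phi> (delta_ext L \<epsilon> \<delta>))"
proof -
  interpret theta_setting P L T1 T2 Q Qb Qbb Lstar Rstar Mstar Q1 S W \<theta> \<epsilon>
    using Delta T1 T2 T1_T2 Q Qbb S Lstar Rstar W theta Q1 Mstar eps
    unfolding slim_dense_near_hexagon_def by unfold_locales blast+
  let ?LQ = "lines_in L Q" and ?RM = "R\<lparr>carrier := M\<rparr>"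
  have exR: "extraspecial2 R" using R(1) by (simp add: extraspecial_minus_def)
  interpret R: group R using exR by (simp add: extraspecial2_def)
  interpret c2: class2_group R lam using R.class2_groupI[OF exR R(2)] .
  interpret gq: slim_gq 4 Q ?LQ using T1_gq[OF Q(1)] by unfold_locales
  have MR: "M \<subseteq> carrier R" and NR: "N \<subseteq> carrier R" using subgroup.subset M N by blast+
  have rep: "representation (Y_points Q) (Y_lines Q ?LQ) ?RM \<phi>" and nab: "\<not> comm_group ?RM"
    using phi by (auto simp: nonabelian_representation_def)
  have phiM: "\<phi> p \<in> M" "\<phi> p \<in> involutions R" if "p \<in> Y_points Q" for p
    using rep that MR by (auto simp: representation_def involutions_def Pi_iff)
  have plsY: "partial_linear_space (Y_points Q) (Y_lines Q ?LQ)" using rep by (simp add: representation_def)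
  have phi_prod: "\<phi> p \<otimes>\<^bsub>R\<^esub> \<phi> q = \<phi> r"
    if "{p, q, r} \<in> Y_lines Q ?LQ" "distinct [p, q, r]" for p q r
  proof -
    have "\<phi> p \<otimes>\<^bsub>?RM\<^esub> \<phi> q = \<phi> (third (Y_lines Q ?LQ) p q)"
      using rep that unfolding representation_def by (metis distinct_length_2_or_more insertI1 insertI2)
    then show ?thesis using third_eq[OF plsY that(1)] that(2) by auto
  qed
  have genM: "generate R (\<phi> ` Y_points Q) = M"
  proof -
    have "\<phi> ` Y_points Q \<subseteq> M" using phiM by blast
    then have "generate ?RM (\<phi> ` Y_points Q) = generate R (\<phi> ` Y_points Q)"
      using R.generate_consistent M(1) by blast
    then show ?thesis using rep by (simp add: representation_def)
  qed
  have com_comm: "c2.com x y \<longleftrightarrow> commutator R x y = \<one>\<^bsub>R\<^esub>" if "x \<in> carrier R" "y \<in> carrier R" for x y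
    using R.commutator_eq_one[OF that] by (simp add: c2.com_def)
  have noncomm: "\<exists>p\<in>Y_points Q. \<exists>q\<in>Y_points Q. \<not> c2.com (\<phi> p) (\<phi> q)"
  proof (rule ccontr)
    assume "\<not> ?thesis"
    then have c: "x \<otimes>\<^bsub>R\<^esub> y = y \<otimes>\<^bsub>R\<^esub> x" if "x \<in> \<phi> ` Y_points Q" "y \<in> \<phi> ` Y_points Q" for x y
      using that by (auto simp: c2.com_def)
    have sub: "\<phi> ` Y_points Q \<subseteq> carrier R" using phiM MR by blast
    have "x \<otimes>\<^bsub>R\<^esub> y = y \<otimes>\<^bsub>R\<^esub> x" if "x \<in> M" "y \<in> M" for x y
      using R.generate_commutes[OF sub c] that genM by blast
    moreover have "group ?RM" using rep by (simp add: representation_def)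
    ultimately have "comm_group ?RM" by (intro group.group_comm_groupI) auto
    then show False using nab by blast
  qed
  have collinQ: "collin ?LQ x y \<longleftrightarrow> collin L x y" if "x \<in> Q" "y \<in> Q" for x y
    using collin_lines_in[OF Q(1) that] .
  have deltaR: "\<delta> x \<in> involutions R" if "x \<in> Q" for x
    using delta(1) that NR by (auto simp: involutions_def Pi_iff)
  then have delta_c: "\<delta> x \<in> carrier R" if "x \<in> Q" for x using that by (auto simp: involutions_def)
  \<comment> \<open>The conditions on \<delta> are phrased with \<open>third\<close> and
    \<open>line_through\<close> in the whole near hexagon, while \<open>psi_setting\<close> speaks
    of explicit lines of \<open>Q\<close>.\<close>
  have third_LQ: "third L x y = z" "line_through L x y = {x, y, z}" "collin L x y" "x \<in> Q" "y \<in> Q"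
    if "{x, y, z} \<in> ?LQ" "distinct [x, y, z]" for x y z
    using that third_eq[OF pls, of x y z] line_through_eq[OF pls, of "{x, y, z}" x y]
      collin_line[of "{x, y, z}" x y] by (auto simp: lines_in_def)
  interpret psi_setting R lam Q ?LQ \<phi> S \<theta> \<epsilon> \<delta> "delta_ext L \<epsilon> \<delta>" M N
  proof (intro psi_setting.intro Y_representation.intro psi_setting_axioms.intro Y_representation_axioms.intro)
    show "class2_group R lam" "slim_gq 4 Q ?LQ" by unfold_locales
    show "\<phi> p \<in> involutions R" if "p \<in> Y_points Q" for p using phiM that by blast
    show "\<phi> (F x) \<otimes>\<^bsub>R\<^esub> \<phi> (F y) = \<phi> (F z)"
      if l: "{x, y, z} \<in> ?LQ" "distinct [x, y, z]" and F: "F \<in> {Pt, Bar, BarBar}" for x y z F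
    proof (rule phi_prod)
      have "F ` {x, y, z} \<in> Y_lines Q ?LQ" using l F unfolding Y_lines_def by blast
      then show "{F x, F y, F z} \<in> Y_lines Q ?LQ" by simp
      show "distinct [F x, F y, F z]" using l F by auto
    qed
    show "\<phi> (Pt x) \<otimes>\<^bsub>R\<^esub> \<phi> (Bar x) = \<phi> (BarBar x)" if "x \<in> Q" for x
      by (rule phi_prod) (use that in \<open>auto simp: Y_lines_def\<close>)
    show "\<exists>p\<in>Y_points Q. \<exists>q\<in>Y_points Q. \<not> c2.com (\<phi> p) (\<phi> q)" by (rule noncomm)
    show "l \<in> ?LQ" if "l \<in> S" for l using S_line[OF that] by (simp add: lines_in_def)
    show "l = m" if "l \<in> S" "m \<in> S" "x \<in> l" "x \<in> m" for l m x using S_unique that by blast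
    show "\<exists>l\<in>S. x \<in> l" if "x \<in> Q" for x using S_cover that .
    show "bij_betw \<epsilon> l UNIV" if "l \<in> S" for l using eps_bij that .
    show "collin ?LQ x y \<longleftrightarrow> \<epsilon> y = \<epsilon> x + \<theta> l m"
      if "l \<in> S" "m \<in> S" "l \<noteq> m" "x \<in> l" "y \<in> m" for l m x y
    proof -
      have "x \<in> Q" "y \<in> Q" using S_line that by blast+
      then show ?thesis using collin_iff_theta[OF that] collinQ by blast
    qed
    show "delta_ext L \<epsilon> \<delta> a b (\<epsilon> u) = \<delta> u"
      if l: "l \<in> S" "a \<in> l" "b \<in> l" "a \<noteq> b" and u: "u \<in> l" for l a b u
    proof -
      have "line_through L a b = l" using line_through_eq[OF pls _ l(2-4)] S_line[OF l(1)] by blast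
      moreover have "(THE v. v \<in> l \<and> \<epsilon> v = \<epsilon> u) = u"
        using u eps_bij[OF l(1)] by (auto simp: bij_betw_def dest: inj_onD)
      ultimately show ?thesis by (simp add: delta_ext_def)
    qed
    show "subgroup M R" "subgroup N R" "generate R (\<phi> ` Y_points Q) = M" "generate R (\<delta> ` Q) = N"
      "M <#>\<^bsub>R\<^esub> N = carrier R" "M \<inter> N = {\<one>\<^bsub>R\<^esub>, lam}" "inj_on \<delta> Q"
      by (fact M(1) N(1) genM delta(5) M_N(1) M_N(3) delta(2))+
    show "\<phi> p \<in> M" if "p \<in> Y_points Q" for p using phiM that by blast
    show "c2.com g h" if "g \<in> M" "h \<in> N" for g h
      using com_comm[of g h] M_N(2) that MR NR by blast
    show "\<delta> x \<in> involutions R" if "x \<in> Q" for x using deltaR that .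
    show "\<not> c2.com (\<delta> x) (\<delta> y)" if "gq.far x y" for x y
    proof -
      have xy: "x \<in> Q" "y \<in> Q" "y \<noteq> x" "\<not> collin L x y" using that collinQ by (auto simp: gq.far_def)
      then have "commutator R (\<delta> x) (\<delta> y) \<noteq> \<one>\<^bsub>R\<^esub>" using delta(3) by simp
      then show ?thesis using com_comm[OF delta_c[OF xy(1)] delta_c[OF xy(2)]] by simp
    qed
    show "\<delta> z = \<delta> x \<otimes>\<^bsub>R\<^esub> \<delta> y" if "{x, y, z} \<in> ?LQ" "distinct [x, y, z]" "{x, y, z} \<in> S" for x y z
      using delta(4) third_LQ[OF that(1,2)] that(3) by auto
    show "\<delta> z = \<delta> x \<otimes>\<^bsub>R\<^esub> \<delta> y \<otimes>\<^bsub>R\<^esub> lam"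
      if "{x, y, z} \<in> ?LQ" "distinct [x, y, z]" "{x, y, z} \<notin> S" for x y z
      using delta(4) third_LQ[OF that(1,2)] that(3) by auto
  qed
  show ?thesis by (rule psi_nonabelian_representation)
qed

end
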